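(* Assume that the $\mathcal{M}^C_{k,\sigma}$-leaf parametric normal form is associated with $s=2$ for some $2\le k\le n$ and $C\in\mathbb{S}^{k-1,\sigma}_{>0}$, where $\sigma\in S^k_n$. A secondary stable flow-invariant $k$-hypertorus bifurcates from the origin on the $\mathcal{M}^C_{k,\sigma}$-leaf variety given by $$T_{SupP}:=\{(\nu_0,\nu_1)\,|\,\nu_0=0,\ \nu_1<0\}.$$ A secondary unstable invariant $k$-hypertorus bifurcates from the origin on the variety $$T_{SubP}:=\{(\nu_0,\nu_1)\,|\,\nu_0=0,\ \nu_1>0\}.$$ There is a secondary double saddle-node type bifurcation of flow-invariant $k$-hypertori at the leaf-transition set $$T_{2SD}:=\Big\{(\nu_0,\nu_1)\,\Big|\,\Big(\frac{\nu_1}{2a_2}\Big)^2-\frac{\nu_0}{a_2}=0,\ a_2\nu_1<0\Big\}.$$ Here, two invariant hypertori (bifurcated at $T_{SupP}$ and $T_{SubP}$) collide when their radii converge, and then they both disappear, similarly to a saddle-node type bifurcation. These bifurcations are five-determined. One of the invariant hypertori always lives inside the other one until the radii of the inner hypertorus and the outer hypertorus converge. When $\nu_1^2>4a_2\nu_0$ and $\nu_0>0$, the origin and the outer hypertorus are unstable while the inner invariant hypertorus is stable. For $\nu_1^2>4a_2\nu_0$ and $\nu_0<0$, the origin and the outer invariant hypertorus are stable while the inner invariant $\mathbb{T}_k$-torus is repelling.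
   Context: $S^k_n$ is the set of permutations $\sigma$ of $\{1,\dots,n\}$ with $\sigma(i)<\sigma(j)$ for $i<j\le k$ and for $k<i<j\le n$. $\mathbb{S}^{k-1,\sigma}_{>0}=\{(c_1,\dots,c_n):\sum_{i\le k}c_{\sigma(i)}^2=1,\ c_{\sigma(i)}>0\ (i\le k),\ c_{\sigma(i)}=0\ (i>k)\}$. With $(\rho_i,\theta_i)$ the polar coordinates of $(x_i,y_i)$, the leaf $\mathcal{M}^C_{k,\sigma}\subset\mathbb{R}^{2n}$ is the set where $\rho_{\sigma(i)}=\frac{c_{\sigma(i)}}{c_{\sigma(k)}}\rho_{\sigma(k)}>0$ for $i\le k$ and $(x_{\sigma(i)},y_{\sigma(i)})=(0,0)$ for $i>k$ (its closure contains the origin); it is homeomorphic to $\mathbb{T}_k\times\mathbb{R}^+$, where $\mathbb{T}_k$ is a $k$-dimensional Clifford torus. For a natural number $s$, the (infinite-level) leaf parametric normal form on $\mathcal{M}^C_{k,\sigma}$ is, for $1\le i\le k$, $$\dot\rho_{\sigma(i)}=\rho_{\sigma(i)}\sum_{j=0}^{s}\nu_j\rho_{\sigma(k)}^{2j},\qquad \dot\theta_{\sigma(i)}=\omega_{\sigma(i)}+\sum_{j=0}^s\hat b^i_j(\mu,C)\,\rho_{\sigma(k)}^{2j}.$$ Here $\mu$ is the parameter vector of the system; $\nu_s=a_s\neq0$ does not depend on $\mu$; $\nu_0,\dots,\nu_{s-1}$ are the coefficients $\hat a_j(\mu,C)$, which vanish at $\mu=0$ and serve as small real unfolding parameters; $\hat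 b^i_0(0,C)=0$ for $1\le i\le k$, and $\hat b^1_j(\mu,C)=0$ for $0\le j\le s-1$; all $\omega_i\neq0$ and $\omega_i/\omega_j\notin\mathbb{Q}$ for $i<j$. Thus for $s=2$ the amplitude equation is $\dot\rho_{\sigma(k)}=\rho_{\sigma(k)}(\nu_0+\nu_1\rho_{\sigma(k)}^2+a_2\rho_{\sigma(k)}^4)$ with $a_2\neq0$. An invariant $k$-hypertorus ($\mathbb{T}_k$-torus) on the leaf is a set $\{\rho_{\sigma(k)}=r\}$ with $r>0$ a zero of the right-hand side of the amplitude equation. Stability refers to the dynamics on the leaf. Leaf-transition sets are sets of parameters at which the qualitative dynamics on the leaf changes. "Secondary" refers to invariant manifolds arising by bifurcation from the equilibrium at the origin, and to the bifurcations of these manifolds. "Double saddle-node" refers to the saddle-node type bifurcation occurring simultaneously at the two points $\pm r$ of the $\mathbb{Z}_2$-equivariant amplitude equation. "Five-determined" means that the qualitative local dynamics is determined by the terms of degree at most five.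
   Formalization: The inner/outer stability claims are made only where two hypertori exist (also characterized exactly), since ν₁²>4a₂ν₀ with the sign of ν₀ does not ensure two (a₂=−1, ν₀=1, ν₁=0 gives one, stable); five-determinacy is stated for the amplitude equation. *)

theory Defs
  imports "HOL-Analysis.Analysis"
begin

text \<open>
  The index set \<open>{1..n}\<close> is a finite linearly ordered type \<^typ>\<open>'n\<close>, with \<open>n = CARD('n)\<close>, and
  $R^{2n}$ is \<^typ>\<open>complex ^ 'n\<close> through $z_i = x_i + \mathrm{i} y_i$, so that the polar coordinates
  of $(x_i, y_i)$ are given by $z_i$ = \<open>rcis \<rho>\<^sub>i \<theta>\<^sub>i\<close>.  A permutation of \<open>{1..n}\<close> is a bijection
  \<open>{1..n} \<rightarrow> 'n\<close>.
\<close>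

definition shuffle_perms :: "nat \<Rightarrow> (nat \<Rightarrow> 'n::{finite,linorder}) set" where
  "shuffle_perms k = {\<sigma>. bij_betw \<sigma> {1..CARD('n)} UNIV
     \<and> (\<forall>i j. 1 \<le> i \<and> i < j \<and> j \<le> k \<longrightarrow> \<sigma> i < \<sigma> j)
     \<and> (\<forall>i j. k < i \<and> i < j \<and> j \<le> CARD('n) \<longrightarrow> \<sigma> i < \<sigma> j)}"

definition positive_sphere :: "nat \<Rightarrow> (nat \<Rightarrow> 'n::finite) \<Rightarrow> (real ^ 'n) set" where
  "positive_sphere k \<sigma> = {c. (\<Sum>i=1..k. (c $ \<sigma> i)\<^sup>2) = 1
     \<and> (\<forall>i\<in>{1..k}. c $ \<sigma> i > 0) \<and> (\<forall>i\<in>{k<..CARD('n)}. c $ \<sigma> i = 0)}"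

definition leaf :: "nat \<Rightarrow> (nat \<Rightarrow> 'n::finite) \<Rightarrow> real ^ 'n \<Rightarrow> (complex ^ 'n) set" where
  "leaf k \<sigma> C = {z.
     (\<forall>i\<in>{1..k}. cmod (z $ \<sigma> i) = C $ \<sigma> i / C $ \<sigma> k * cmod (z $ \<sigma> k) \<and> cmod (z $ \<sigma> i) > 0)
     \<and> (\<forall>i\<in>{k<..CARD('n)}. z $ \<sigma> i = 0)}"

definition hypertorus ::
    "nat \<Rightarrow> (nat \<Rightarrow> 'n::finite) \<Rightarrow> real ^ 'n \<Rightarrow> real \<Rightarrow> (complex ^ 'n) set" where
  "hypertorus k \<sigma> C r = {z \<in> leaf k \<sigma> C. cmod (z $ \<sigma> k) = r}"

text \<open>The part of \<open>X\<close> enclosed by \<open>S\<close>; the constant \<^const>\<open>inside\<close> is about the complement of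
  \<open>S\<close> in the whole space, which a hypertorus does not separate.\<close>

definition inside_in :: "'a::real_normed_vector set \<Rightarrow> 'a set \<Rightarrow> 'a set" where
  "inside_in X S = {x \<in> X - S. bounded (connected_component_set (X - S) x)}"

text \<open>
  The radial coefficient \<open>a j \<mu>\<close> is $\nu_j = \hat a_j(\mu, C)$ for \<open>j < s\<close> and $a_s$ for \<open>j = s\<close>;
  \<open>b i j \<mu>\<close> is $\hat b^i_j(\mu, C)$.
\<close>

definition radial_rate :: "nat \<Rightarrow> (nat \<Rightarrow> 'm \<Rightarrow> real) \<Rightarrow> 'm \<Rightarrow> real \<Rightarrow> real" where
  "radial_rate s a \<mu> r = (\<Sum>j=0..s. a j \<mu> * r ^ (2 * j))"

definition angular_rate ::
    "nat \<Rightarrow> (nat \<Rightarrow> 'n) \<Rightarrow> ('n \<Rightarrow> real) \<Rightarrow> (nat \<Rightarrow> nat \<Rightarrow> 'm \<Rightarrow> real) \<Rightarrow> 'm \<Rightarrow> nat \<Rightarrow> real \<Rightarrow> real" where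
  "angular_rate s \<sigma> \<omega> b \<mu> i r = \<omega> (\<sigma> i) + (\<Sum>j=0..s. b i j \<mu> * r ^ (2 * j))"

definition amplitude :: "nat \<Rightarrow> (nat \<Rightarrow> 'm \<Rightarrow> real) \<Rightarrow> 'm \<Rightarrow> real \<Rightarrow> real" where
  "amplitude s a \<mu> r = r * radial_rate s a \<mu> r"

definition hypertorus_radii :: "nat \<Rightarrow> (nat \<Rightarrow> 'm \<Rightarrow> real) \<Rightarrow> 'm \<Rightarrow> real set" where
  "hypertorus_radii s a \<mu> = {r. r > 0 \<and> amplitude s a \<mu> r = 0}"

text \<open>
  Solutions on the interval \<open>J\<close>, in polar coordinates, of the normal form on the closed leaf.
  Radii may be zero, so the equilibrium at the origin is a solution as well.
\<close>

definition leaf_solution ::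
    "nat \<Rightarrow> (nat \<Rightarrow> 'n::finite) \<Rightarrow> real ^ 'n \<Rightarrow> (real \<Rightarrow> real) \<Rightarrow> (nat \<Rightarrow> real \<Rightarrow> real)
      \<Rightarrow> real set \<Rightarrow> (real \<Rightarrow> complex ^ 'n) \<Rightarrow> bool" where
  "leaf_solution k \<sigma> C A B J z \<longleftrightarrow>
     (\<forall>t\<in>J. z t \<in> closure (leaf k \<sigma> C)) \<and>
     (\<exists>\<rho> \<theta>. \<forall>i\<in>{1..k}. \<forall>t\<in>J.
        \<rho> i t \<ge> 0 \<and> z t $ \<sigma> i = rcis (\<rho> i t) (\<theta> i t) \<and>
        (\<rho> i has_real_derivative \<rho> i t * A (\<rho> k t)) (at t within J) \<and>
        (\<theta> i has_real_derivative B i (\<rho> k t)) (at t within J))"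

definition scalar_solution :: "(real \<Rightarrow> real) \<Rightarrow> real set \<Rightarrow> (real \<Rightarrow> real) \<Rightarrow> bool" where
  "scalar_solution f J x \<longleftrightarrow> (\<forall>t\<in>J. (x has_real_derivative f (x t)) (at t within J))"

text \<open>A dynamical system on \<open>X\<close> is given by the predicate \<open>sol J z\<close>: \<open>z\<close> is a solution on the
  time interval \<open>J\<close>.\<close>

type_synonym 'a system = "real set \<Rightarrow> (real \<Rightarrow> 'a) \<Rightarrow> bool"

definition lyapunov_stable :: "'a::metric_space system \<Rightarrow> 'a set \<Rightarrow> bool" where
  "lyapunov_stable sol S \<longleftrightarrow> (\<forall>\<epsilon>>0. \<exists>\<delta>>0. \<forall>T\<ge>0. \<forall>z.
     sol {0..T} z \<and> infdist (z 0) S < \<delta> \<longrightarrow> infdist (z T) S < \<epsilon>)"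

definition asymptotically_stable :: "'a::metric_space set \<Rightarrow> 'a system \<Rightarrow> 'a set \<Rightarrow> bool" where
  "asymptotically_stable X sol S \<longleftrightarrow> lyapunov_stable sol S \<and>
     (\<exists>\<delta>>0. (\<forall>x\<in>X. infdist x S < \<delta> \<longrightarrow> (\<exists>z. sol {0..} z \<and> z 0 = x)) \<and>
       (\<forall>z. sol {0..} z \<and> infdist (z 0) S < \<delta> \<longrightarrow> ((\<lambda>t. infdist (z t) S) \<longlongrightarrow> 0) at_top))"

definition flow_invariant :: "'a system \<Rightarrow> 'a set \<Rightarrow> bool" where
  "flow_invariant sol S \<longleftrightarrow>
     (\<forall>J z t\<^sub>0. is_interval J \<and> t\<^sub>0 \<in> J \<and> sol J z \<and> z t\<^sub>0 \<in> S \<longrightarrow> (\<forall>t\<in>J. z t \<in> S))"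

definition repelling :: "'a::metric_space set \<Rightarrow> 'a system \<Rightarrow> 'a set \<Rightarrow> bool" where
  "repelling X sol S \<longleftrightarrow> asymptotically_stable X (\<lambda>J z. sol (uminus ` J) (\<lambda>t. z (- t))) S"

text \<open>
  \<open>R \<mu>\<close> is the set of radii of the invariant hypertori at the parameter \<open>\<mu>\<close> and \<open>P \<mu> r\<close> a property
  of the hypertorus of radius \<open>r\<close>.  Near \<open>\<mu>\<^sub>0\<close> there are parameters (the set \<open>D\<close>) with exactly one
  hypertorus close to the origin, it has property \<open>P\<close> and shrinks to the origin as \<open>\<mu> \<rightarrow> \<mu>\<^sub>0\<close>, and
  there are parameters without any hypertorus close to the origin.
\<close>

definition bifurcates_from_origin ::
    "'m::euclidean_space set \<Rightarrow> ('m \<Rightarrow> real set) \<Rightarrow> ('m \<Rightarrow> real \<Rightarrow> bool) \<Rightarrow> 'm \<Rightarrow> bool" where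
  "bifurcates_from_origin V R P \<mu>\<^sub>0 \<longleftrightarrow>
     (\<exists>\<epsilon>>0. \<exists>W r. open W \<and> \<mu>\<^sub>0 \<in> W \<and> W \<subseteq> V \<and>
       (let D = {\<mu>\<in>W. R \<mu> \<inter> {..<\<epsilon>} \<noteq> {}} in
         \<mu>\<^sub>0 \<in> closure (interior D) \<and> \<mu>\<^sub>0 \<in> closure (interior (W - D)) \<and>
         (\<forall>\<mu>\<in>D. R \<mu> \<inter> {..<\<epsilon>} = {r \<mu>} \<and> P \<mu> (r \<mu>)) \<and>
         (r \<longlongrightarrow> 0) (at \<mu>\<^sub>0 within D)))"

text \<open>
  \<open>Z \<mu>\<close> is the set of equilibria (or of radii of hypertori) at \<open>\<mu>\<close>, and \<open>Q \<mu> x y\<close> says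
  that \<open>x\<close> is attracting and \<open>y\<close> is repelling: two elements of \<open>Z \<mu>\<close> of opposite stability
  collide at \<open>x\<^sub>0\<close> and disappear.
\<close>

definition saddle_node_bifurcation ::
    "'m::euclidean_space set \<Rightarrow> ('m \<Rightarrow> real set) \<Rightarrow> ('m \<Rightarrow> real \<Rightarrow> real \<Rightarrow> bool)
      \<Rightarrow> 'm \<Rightarrow> real \<Rightarrow> bool" where
  "saddle_node_bifurcation V Z Q \<mu>\<^sub>0 x\<^sub>0 \<longleftrightarrow>
     (\<exists>\<epsilon>>0. \<exists>W. open W \<and> \<mu>\<^sub>0 \<in> W \<and> W \<subseteq> V \<and>
       (let Y = (\<lambda>\<mu>. Z \<mu> \<inter> ball x\<^sub>0 \<epsilon>); D = {\<mu>\<in>W. card (Y \<mu>) = 2} in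
         Y \<mu>\<^sub>0 = {x\<^sub>0} \<and> (\<forall>\<mu>\<in>W. finite (Y \<mu>) \<and> card (Y \<mu>) \<le> 2) \<and>
         \<mu>\<^sub>0 \<in> closure (interior D) \<and> \<mu>\<^sub>0 \<in> closure (interior {\<mu>\<in>W. Y \<mu> = {}}) \<and>
         (\<forall>\<mu>\<in>D. \<exists>x y. Y \<mu> = {x, y} \<and> Q \<mu> x y) \<and>
         (\<forall>\<eta>>0. \<forall>\<^sub>F \<mu> in at \<mu>\<^sub>0 within D. Y \<mu> \<subseteq> ball x\<^sub>0 \<eta>)))"

text \<open>
  \<open>f\<close> is the family of amplitude equations, considered on the whole line; the saddle-node
  bifurcation takes place for the hypertori and at both points \<open>r\<^sub>0\<close> and \<open>- r\<^sub>0\<close>.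
\<close>

definition double_saddle_node_bifurcation ::
    "'m::euclidean_space set \<Rightarrow> ('m \<Rightarrow> real \<Rightarrow> real) \<Rightarrow> ('m \<Rightarrow> real set)
      \<Rightarrow> ('m \<Rightarrow> real \<Rightarrow> real \<Rightarrow> bool) \<Rightarrow> 'm \<Rightarrow> bool" where
  "double_saddle_node_bifurcation V f R Q \<mu>\<^sub>0 \<longleftrightarrow>
     (\<exists>r\<^sub>0>0. saddle_node_bifurcation V R Q \<mu>\<^sub>0 r\<^sub>0 \<and>
       (\<forall>x\<^sub>0\<in>{r\<^sub>0, - r\<^sub>0}. saddle_node_bifurcation V (\<lambda>\<mu>. {x. f \<mu> x = 0})
          (\<lambda>\<mu> x y. asymptotically_stable UNIV (scalar_solution (f \<mu>)) {x}
                 \<and> repelling UNIV (scalar_solution (f \<mu>)) {y}) \<mu>\<^sub>0 x\<^sub>0))"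

definition T_SupP :: "(real \<times> real) set" where
  "T_SupP = {(\<nu>\<^sub>0, \<nu>\<^sub>1). \<nu>\<^sub>0 = 0 \<and> \<nu>\<^sub>1 < 0}"

definition T_SubP :: "(real \<times> real) set" where
  "T_SubP = {(\<nu>\<^sub>0, \<nu>\<^sub>1). \<nu>\<^sub>0 = 0 \<and> \<nu>\<^sub>1 > 0}"

definition T_2SD :: "real \<Rightarrow> (real \<times> real) set" where
  "T_2SD a\<^sub>2 = {(\<nu>\<^sub>0, \<nu>\<^sub>1). (\<nu>\<^sub>1 / (2 * a\<^sub>2))\<^sup>2 - \<nu>\<^sub>0 / a\<^sub>2 = 0 \<and> a\<^sub>2 * \<nu>\<^sub>1 < 0}"

primrec C_k_on :: "nat \<Rightarrow> ('a::euclidean_space \<Rightarrow> real) \<Rightarrow> 'a set \<Rightarrow> bool" where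
  "C_k_on 0 f S \<longleftrightarrow> continuous_on S f"
| "C_k_on (Suc m) f S \<longleftrightarrow> f differentiable_on S \<and>
     (\<forall>b\<in>Basis. C_k_on m (\<lambda>x. frechet_derivative f (at x) b) S)"

text \<open>\<open>y\<close> is on the forward orbit of \<open>x\<close> under \<open>x' = f x\<close> restricted to \<open>U\<close>.\<close>

definition reaches :: "(real \<Rightarrow> real) \<Rightarrow> real set \<Rightarrow> real \<Rightarrow> real \<Rightarrow> bool" where
  "reaches f U x y \<longleftrightarrow>
     (\<exists>T\<ge>0. \<exists>\<xi>. scalar_solution f {0..T} \<xi> \<and> \<xi> ` {0..T} \<subseteq> U \<and> \<xi> 0 = x \<and> \<xi> T = y)"

text \<open>
  Local topological equivalence near \<open>(0, 0)\<close> of two parametric families of scalar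
  \<open>\<int>\<^sub>2\<close>-equivariant equations: a homeomorphism \<open>\<Phi>\<close> of the parameters and, for every \<open>\<nu>\<close>, an
  odd homeomorphism \<open>h\<close> mapping orbits to orbits and preserving the direction of time.
\<close>

definition locally_equivalent ::
    "('p::euclidean_space \<Rightarrow> real \<Rightarrow> real) \<Rightarrow> ('p \<Rightarrow> real \<Rightarrow> real) \<Rightarrow> bool" where
  "locally_equivalent g f \<longleftrightarrow>
     (\<exists>N N' \<Phi> \<Phi>' \<epsilon> \<delta>. open N \<and> open N' \<and> 0 \<in> N \<and> homeomorphism N N' \<Phi> \<Phi>' \<and> \<Phi> 0 = 0 \<and>
       \<epsilon> > 0 \<and> \<delta> > 0 \<and>
       (\<forall>\<nu>\<in>N. \<exists>h h'. homeomorphism {-\<epsilon>..\<epsilon>} {-\<delta>..\<delta>} h h' \<and> (\<forall>x\<in>{-\<epsilon>..\<epsilon>}. h (- x) = - h x) \<and>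
          (\<forall>x\<in>{-\<epsilon>..\<epsilon>}. \<forall>y\<in>{-\<epsilon>..\<epsilon>}.
             reaches (g \<nu>) {-\<epsilon>..\<epsilon>} x y \<longleftrightarrow> reaches (f (\<Phi> \<nu>)) {-\<delta>..\<delta>} (h x) (h y))))"

text \<open>
  Every smooth \<open>\<int>\<^sub>2\<close>-equivariant family \<open>g\<close> with the same terms of degree at most \<open>m\<close> in the state
  variable as \<open>f\<close> is locally equivalent to \<open>f\<close>.
\<close>

definition determined :: "nat \<Rightarrow> ('p::euclidean_space \<Rightarrow> real \<Rightarrow> real) \<Rightarrow> bool" where
  "determined m f \<longleftrightarrow>
     (\<forall>g G. open G \<and> (0, 0) \<in> G \<and> (\<forall>l. C_k_on l (\<lambda>(\<nu>, x). g \<nu> x) G) \<and>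
        (\<forall>\<nu> x. (\<nu>, x) \<in> G \<longrightarrow> (\<nu>, - x) \<in> G \<and> g \<nu> (- x) = - g \<nu> x) \<and>
        (\<forall>\<nu> j. (\<nu>, 0) \<in> G \<and> j \<le> m \<longrightarrow> (deriv ^^ j) (g \<nu>) 0 = (deriv ^^ j) (f \<nu>) 0)
      \<longrightarrow> locally_equivalent g f)"

end

theory Submission
  imports Defs
begin

text \<open>
  On the closed leaf all moduli are proportional to the modulus \<open>r\<close> of the coordinate \<open>\<sigma> k\<close>, the
  norm of a point is a constant multiple of \<open>r\<close>, and its distance to the hypertorus of radius \<open>r\<^sub>0\<close> is the same
  multiple of \<open>\<bar>r - r\<^sub>0\<bar>\<close> (\<open>infdist_hypertorus\<close>).  Solutions on the leaf project to solutions
  of the scalar amplitude equation, and every nonnegative scalar solution lifts, the phases being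
  obtained by integration (\<open>leaf_solution_lift\<close>).  Stability of a hypertorus or of the origin, in either
  direction of time, is therefore stability of an equilibrium of a scalar equation, and is decided by the
  sign of the derivative there (\<open>scalar_reduction\<close>).  Scalar solutions are constructed by inverting
  the time needed to travel along an interval without equilibria (\<open>flow_of_positive_field\<close>).

  In \<open>u = r\<^sup>2\<close> the positive equilibria are the positive roots of \<open>\<nu>\<^sub>0 + \<nu>\<^sub>1 * u + a\<^sub>2 * u\<^sup>2\<close>, and the derivative
  at such a root has the sign of the slope \<open>\<nu>\<^sub>1 + 2 * a\<^sub>2 * u\<close>.  A small root is close to \<open>- \<nu>\<^sub>0 / \<nu>\<^sub>1\<close> and its
  slope is close to \<open>\<nu>\<^sub>1\<close>: this gives the two pitchfork bifurcations (\<open>bifurcates_from_originI\<close>).  Two roots merge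
  where the discriminant vanishes, with slopes of opposite signs (\<open>saddle_node_bifurcationI\<close>).  Conversely, roots
  that tend to \<open>0\<close> or to each other force \<open>\<nu>\<^sub>0 = 0\<close> or a double root by continuity.  The parameters of the system
  enter only through \<open>(\<nu>\<^sub>0, \<nu>\<^sub>1)\<close>, and since that map is open, every region of the plane whose closure
  contains \<open>(\<nu>\<^sub>0, \<nu>\<^sub>1) \<mu>\<close> is reached by parameters near \<open>\<mu>\<close> (\<open>closure_interior_preimage\<close>).

  For the five-determinacy let \<open>F\<close> be an odd smooth family with the given Taylor polynomial of degree five.
  Integrating the positive fifth derivative back shows that \<open>F x / x\<close> is strictly convex in \<open>x\<^sup>2\<close>, after
  reversing the signs of the field and of the parameters if \<open>a\<^sub>2 < 0\<close>; hence \<open>F\<close> has at most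
  two positive zeros, and its sign pattern depends only on the sign of \<open>\<nu>\<^sub>0\<close> and on the side of the fold.  The fold is the graph of a continuous function of
  \<open>\<nu>\<^sub>0\<close> (\<open>fold_graph\<close>), because \<open>F\<close> is strictly increasing in \<open>\<nu>\<^sub>1\<close>.  The shear of the plane along \<open>\<nu>\<^sub>1\<close> that moves the
  fold of \<open>F\<close> onto that of the truncated family preserves the sign patterns, and two odd scalar equations with the
  same sign pattern have the same orbits up to a piecewise linear odd homeomorphism.
\<close>

section \<open>Scalar autonomous equations\<close>

lemma antiderivative_on_line:
  fixes h :: "real \<Rightarrow> real"
  assumes "continuous_on UNIV h"
  obtains H where "\<And>t. (H has_real_derivative h t) (at t)"
proof -
  have "\<exists>H. \<forall>t. -\<infinity> < ereal t \<longrightarrow> ereal t < \<infinity> \<longrightarrow> (H has_vector_derivative h t) (at t)"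
    using assms by (intro einterval_antiderivative) (auto simp: continuous_on_eq_continuous_at)
  then show ?thesis
    using that by (auto simp: has_real_derivative_iff_has_vector_derivative)
qed

text \<open>The time needed to reach \<open>w\<close> is the integral of \<open>1 / h\<close>.  It maps the line onto the line because
  \<open>1 / h \<ge> 1 / L\<close>, and its inverse is the solution.\<close>

lemma flow_of_positive_field:
  fixes h :: "real \<Rightarrow> real"
  assumes h: "continuous_on UNIV h" and pos: "\<And>v. 0 < h v" and le: "\<And>v. h v \<le> L"
  obtains v where "v 0 = v0" "\<And>t. (v has_real_derivative h (v t)) (at t)"
proof -
  have "L > 0"
    using pos le by (metis less_le_trans)
  have "continuous_on UNIV (\<lambda>w. 1 / h w)"
    using h pos by (intro continuous_intros) (auto simp: less_imp_neq[symmetric])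
  then obtain \<tau>' where \<tau>': "\<And>w. (\<tau>' has_real_derivative 1 / h w) (at w)"
    by (rule antiderivative_on_line) blast
  define \<tau> where "\<tau> w = \<tau>' w - \<tau>' v0" for w
  have \<tau>: "(\<tau> has_real_derivative 1 / h w) (at w)" for w
    unfolding \<tau>_def using \<tau>' by (auto intro!: derivative_eq_intros)
  have cont: "isCont \<tau> w" for w
    using \<tau> DERIV_isCont by blast
  have growth: "(y - x) / L \<le> \<tau> y - \<tau> x" if xy: "x < y" for x y
  proof -
    obtain z where "\<tau> y - \<tau> x = (y - x) * (1 / h z)"
      using MVT2[OF xy, of \<tau> "\<lambda>w. 1 / h w"] \<tau> by auto
    moreover have "1 / L \<le> 1 / h z"
      using pos le by (intro divide_left_mono) (auto intro: \<open>0 < L\<close> mult_pos_pos)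
    ultimately show ?thesis
      using xy mult_left_mono[of "1 / L" "1 / h z" "y - x"] by simp
  qed
  have "strict_mono \<tau>"
  proof
    fix x y :: real assume "x < y"
    then have "0 < (y - x) / L" using \<open>L > 0\<close> by simp
    then show "\<tau> x < \<tau> y" using growth[OF \<open>x < y\<close>] by linarith
  qed
  then have inj: "inj \<tau>"
    by (rule strict_mono_imp_inj_on)
  have "\<exists>w. \<tau> w = t" for t
  proof -
    have 1: "t \<le> \<tau> (L * (\<bar>t\<bar> + 1) + v0)"
    proof -
      have "\<bar>t\<bar> + 1 = (L * (\<bar>t\<bar> + 1) + v0 - v0) / L"
        using \<open>L > 0\<close> by simp
      also have "\<dots> \<le> \<tau> (L * (\<bar>t\<bar> + 1) + v0) - \<tau> v0"
        using \<open>L > 0\<close> by (intro growth) (simp add: add_pos_nonneg add_nonneg_pos)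
      finally show ?thesis by (simp add: \<tau>_def)
    qed
    have 2: "\<tau> (v0 - L * (\<bar>t\<bar> + 1)) \<le> t"
    proof -
      have "\<bar>t\<bar> + 1 = (v0 - (v0 - L * (\<bar>t\<bar> + 1))) / L"
        using \<open>L > 0\<close> by simp
      also have "\<dots> \<le> \<tau> v0 - \<tau> (v0 - L * (\<bar>t\<bar> + 1))"
        using \<open>L > 0\<close> by (intro growth) (simp add: add_pos_nonneg add_nonneg_pos)
      finally show ?thesis by (simp add: \<tau>_def)
    qed
    have "0 < L * (\<bar>t\<bar> + 1)"
      using \<open>L > 0\<close> by (simp add: add_nonneg_pos)
    then obtain w where "\<tau> w = t"
      using IVT'[of \<tau> "v0 - L * (\<bar>t\<bar> + 1)" t "L * (\<bar>t\<bar> + 1) + v0"] 1 2 cont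
      by (auto simp: continuous_at_imp_continuous_on)
    then show "\<exists>w. \<tau> w = t" by blast
  qed
  then have "surj \<tau>"
    by (metis surj_def)
  define v where "v = inv \<tau>"
  have v\<tau>: "v (\<tau> w) = w" and \<tau>v: "\<tau> (v t) = t" for w t
    unfolding v_def using inj \<open>surj \<tau>\<close> by (simp_all add: surj_f_inv_f)
  have "(v has_real_derivative h (v t)) (at t)" for t
  proof -
    have "isCont v (\<tau> (v t))"
      by (rule isCont_inverse_function[where d = 1]) (auto simp: v\<tau> cont)
    then have "(v has_real_derivative inverse (1 / h (v t))) (at t)"
      using \<tau> pos[of "v t"] \<tau>v
      by (intro DERIV_inverse_function[where f = \<tau> and a = "t - 1" and b = "t + 1"]) auto
    then show ?thesis by simp
  qed
  moreover have "v 0 = v0"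
    using v\<tau>[of v0] by (simp add: \<tau>_def)
  ultimately show ?thesis using that by blast
qed

lemma scalar_solution_subset:
  "scalar_solution F J \<xi> \<Longrightarrow> I \<subseteq> J \<Longrightarrow> scalar_solution F I \<xi>"
  unfolding scalar_solution_def by (meson has_field_derivative_subset subset_iff)

lemma scalar_solution_continuous:
  "scalar_solution F J \<xi> \<Longrightarrow> continuous_on J \<xi>"
  unfolding scalar_solution_def by (auto intro: DERIV_continuous_on)

lemma scalar_solution_DERIV:
  assumes "scalar_solution F {a..b} \<xi>" "a < t" "t < b"
  shows "(\<xi> has_real_derivative F (\<xi> t)) (at t)"
  using assms unfolding scalar_solution_def
  by (metis atLeastAtMost_iff at_within_Icc_at less_eq_real_def)

lemma DERIV_reverse:
  fixes f :: "real \<Rightarrow> real"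
  assumes "t \<in> uminus ` I" "(f has_real_derivative D) (at (- t) within I)"
  shows "((\<lambda>t. f (- t)) has_real_derivative - D) (at t within uminus ` I)"
proof -
  have "(f has_real_derivative D) (at (- t) within uminus ` (uminus ` I))"
    using assms by (simp add: image_image)
  moreover have "(uminus has_real_derivative - 1) (at t within uminus ` I)"
    by (auto intro!: derivative_eq_intros)
  ultimately have "(f \<circ> uminus has_real_derivative D * (- 1)) (at t within uminus ` I)"
    by (rule DERIV_image_chain)
  then show ?thesis by (simp add: o_def)
qed

lemma scalar_solution_reverse_iff:
  "scalar_solution F (uminus ` J) (\<lambda>t. \<xi> (- t)) \<longleftrightarrow> scalar_solution (\<lambda>x. - F x) J \<xi>"
proof -
  have rev: "scalar_solution (\<lambda>x. - G x) (uminus ` I) (\<lambda>t. \<eta> (- t))" if "scalar_solution G I \<eta>" for G I \<eta>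
    using that DERIV_reverse unfolding scalar_solution_def by auto
  show ?thesis
  proof
    assume "scalar_solution F (uminus ` J) (\<lambda>t. \<xi> (- t))"
    from rev[OF this] show "scalar_solution (\<lambda>x. - F x) J \<xi>"
      by (simp add: image_image)
  next
    assume "scalar_solution (\<lambda>x. - F x) J \<xi>"
    from rev[OF this] show "scalar_solution F (uminus ` J) (\<lambda>t. \<xi> (- t))"
      by simp
  qed
qed

text \<open>Freezing the field outside of \<open>{x..y}\<close> gives a positive field on the whole line; as it is
  bounded away from zero, \<open>y\<close> is reached after a finite time.\<close>

lemma solution_upwards:
  assumes "x \<le> y" and F: "continuous_on {x..y} F" and pos: "\<And>w. w \<in> {x..y} \<Longrightarrow> 0 < F w"
  obtains T \<xi> where "0 \<le> T" "scalar_solution F {0..T} \<xi>" "\<xi> ` {0..T} \<subseteq> {x..y}" "\<xi> 0 = x" "\<xi> T = y"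
proof -
  define c where "c w = max x (min y w)" for w
  have c: "c w \<in> {x..y}" for w
    using \<open>x \<le> y\<close> by (auto simp: c_def)
  have "compact (F ` {x..y})"
    using F by (intro compact_continuous_image) auto
  then obtain L where L: "\<And>w. w \<in> {x..y} \<Longrightarrow> F w \<le> L"
    by (metis compact_imp_bounded bounded_real abs_le_D1 image_eqI)
  have cont: "continuous_on UNIV (\<lambda>w. F (c w))"
    unfolding c_def using \<open>x \<le> y\<close>
    by (intro continuous_on_compose2[OF F] continuous_intros) auto
  obtain v where v0: "v 0 = x" and v: "\<And>t. (v has_real_derivative F (c (v t))) (at t)"
    by (rule flow_of_positive_field[OF cont, of L x]) (use pos L c in auto)
  obtain w0 where w0: "w0 \<in> {x..y}" "\<And>w. w \<in> {x..y} \<Longrightarrow> F w0 \<le> F w"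
    using continuous_attains_inf[of "{x..y}" F] F \<open>x \<le> y\<close> by auto
  define m where "m = F w0"
  have "m > 0" using pos w0 by (simp add: m_def)
  have mono: "v s + m * (t - s) \<le> v t" if "s \<le> t" for s t
  proof -
    have "(\<lambda>r. v r - m * r) s \<le> (\<lambda>r. v r - m * r) t"
    proof (rule DERIV_nonneg_imp_nondecreasing[OF that])
      fix r
      have "((\<lambda>r. v r - m * r) has_real_derivative F (c (v r)) - m) (at r)"
        using v by (auto intro!: derivative_eq_intros)
      then show "\<exists>d. ((\<lambda>r. v r - m * r) has_real_derivative d) (at r) \<and> 0 \<le> d"
        using w0(2)[OF c] by (auto simp: m_def)
    qed
    then show ?thesis by (simp add: algebra_simps)
  qed
  have isC: "continuous_on A v" for A
    using v by (meson DERIV_isCont continuous_at_imp_continuous_on)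
  have "\<exists>T\<ge>0. T \<le> (y - x) / m \<and> v T = y"
    using mono[of 0 "(y - x) / m"] \<open>m > 0\<close> \<open>x \<le> y\<close> v0
    by (intro IVT') (auto simp: isC)
  then obtain T where T: "0 \<le> T" "v T = y" by blast
  have range: "v t \<in> {x..y}" if "t \<in> {0..T}" for t
  proof -
    have "0 \<le> m * t" "0 \<le> m * (T - t)"
      using that \<open>m > 0\<close> by auto
    then show ?thesis
      using mono[of 0 t] mono[of t T] that v0 T by auto
  qed
  then have "scalar_solution F {0..T} v"
    unfolding scalar_solution_def
    by (metis DERIV_subset atLeastAtMost_iff c_def max.absorb2 min.absorb2 subset_UNIV v)
  with that T range v0 show ?thesis by blast
qed

lemma solution_downwards:
  assumes "y \<le> x" and F: "continuous_on {y..x} F" and neg: "\<And>w. w \<in> {y..x} \<Longrightarrow> F w < 0"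
  obtains T \<xi> where "0 \<le> T" "scalar_solution F {0..T} \<xi>" "\<xi> ` {0..T} \<subseteq> {y..x}" "\<xi> 0 = x" "\<xi> T = y"
proof -
  have cont: "continuous_on {- x..- y} (\<lambda>w. - F (- w))"
    by (intro continuous_intros continuous_on_compose2[OF F]) auto
  obtain T \<xi> where *: "0 \<le> T" "scalar_solution (\<lambda>w. - F (- w)) {0..T} \<xi>"
    "\<xi> ` {0..T} \<subseteq> {- x..- y}" "\<xi> 0 = - x" "\<xi> T = - y"
    by (rule solution_upwards[OF _ cont]) (use assms in auto)
  have "scalar_solution F {0..T} (\<lambda>t. - \<xi> t)"
    using *(2) unfolding scalar_solution_def by (auto intro!: derivative_eq_intros)
  moreover have "(\<lambda>t. - \<xi> t) ` {0..T} \<subseteq> {y..x}"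
    using *(3) by (force simp: image_subset_iff)
  ultimately show ?thesis
    using that[of T "\<lambda>t. - \<xi> t"] * by auto
qed

text \<open>Gronwall: the squared distance to an equilibrium grows at most like \<open>exp (2 * L * t)\<close>, so a
  solution that starts at the equilibrium never leaves it.\<close>

lemma equilibrium_forward:
  assumes sol: "scalar_solution F {a..b} \<xi>" and "a \<le> b" and "\<xi> a = c"
    and L: "\<And>t. t \<in> {a..b} \<Longrightarrow> \<bar>F (\<xi> t)\<bar> \<le> L * \<bar>\<xi> t - c\<bar>"
  shows "\<xi> b = c"
proof -
  define \<phi> where "\<phi> t = (\<xi> t - c)\<^sup>2 * exp (- 2 * L * t)" for t
  have "\<phi> b \<le> \<phi> a"
  proof (rule DERIV_nonpos_imp_decreasing_open[OF \<open>a \<le> b\<close>])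
    fix t assume t: "a < t" "t < b"
    have "(\<phi> has_real_derivative (2 * ((\<xi> t - c) * F (\<xi> t)) - 2 * L * (\<xi> t - c)\<^sup>2) * exp (- 2 * L * t)) (at t)"
      unfolding \<phi>_def using scalar_solution_DERIV[OF sol t]
      by (auto intro!: derivative_eq_intros simp: algebra_simps power2_eq_square)
    moreover have "(\<xi> t - c) * F (\<xi> t) \<le> L * (\<xi> t - c)\<^sup>2"
    proof -
      have "(\<xi> t - c) * F (\<xi> t) \<le> \<bar>\<xi> t - c\<bar> * \<bar>F (\<xi> t)\<bar>"
        by (metis abs_ge_self abs_mult)
      also have "\<dots> \<le> \<bar>\<xi> t - c\<bar> * (L * \<bar>\<xi> t - c\<bar>)"
        using L t by (intro mult_left_mono) auto
      finally show ?thesis by (simp add: power2_eq_square algebra_simps)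
    qed
    ultimately show "\<exists>y. (\<phi> has_real_derivative y) (at t) \<and> y \<le> 0"
      by (intro exI conjI) (auto simp: mult_nonpos_nonneg)
  next
    show "continuous_on {a..b} \<phi>"
      unfolding \<phi>_def by (intro continuous_intros scalar_solution_continuous[OF sol])
  qed
  then have "(\<xi> b - c)\<^sup>2 * exp (- 2 * L * b) \<le> 0"
    using \<open>\<xi> a = c\<close> by (simp add: \<phi>_def)
  then show ?thesis by (simp add: mult_le_0_iff)
qed

text \<open>Backwards in time the same estimate holds for the reversed solution.\<close>

lemma equilibrium_unique:
  assumes sol: "scalar_solution F J \<xi>" and "is_interval J" and "s \<in> J" "t \<in> J" and "\<xi> s = c"
    and L: "\<And>r. r \<in> closed_segment s t \<Longrightarrow> \<bar>F (\<xi> r)\<bar> \<le> L * \<bar>\<xi> r - c\<bar>"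
  shows "\<xi> t = c"
proof (cases "s \<le> t")
  case True
  then have "{s..t} \<subseteq> J"
    using assms(2-4) by (meson atLeastAtMost_iff mem_is_interval_1_I subsetI)
  with True show ?thesis
    using equilibrium_forward[of F s t \<xi> c L] assms scalar_solution_subset[OF sol]
    by (auto simp: closed_segment_eq_real_ivl)
next
  case False
  then have sub: "{t..s} \<subseteq> J"
    using assms(2-4) by (meson atLeastAtMost_iff mem_is_interval_1_I subsetI)
  have "scalar_solution (\<lambda>w. - F w) {- s..- t} (\<lambda>r. \<xi> (- r))"
    using scalar_solution_subset[OF sol sub] scalar_solution_reverse_iff[of "\<lambda>w. - F w" "{t..s}" \<xi>]
    by simp
  then have "(\<lambda>r. \<xi> (- r)) (- t) = c"
    by (rule equilibrium_forward[where L = L]) (use False L \<open>\<xi> s = c\<close> in \<open>auto simp: closed_segment_eq_real_ivl\<close>)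
  then show ?thesis by simp
qed

lemma equilibrium_unique_C1:
  assumes F: "\<And>w. (F has_real_derivative F' w) (at w)" and F': "continuous_on UNIV F'"
    and sol: "scalar_solution F J \<xi>" "is_interval J" "s \<in> J" "t \<in> J" and "F (\<xi> s) = 0"
  shows "\<xi> t = \<xi> s"
proof -
  let ?K = "\<xi> ` closed_segment s t"
  have "closed_segment s t \<subseteq> J"
    using sol by (simp add: closed_segment_subset is_interval_convex_1)
  then have "compact ?K" "connected ?K"
    using scalar_solution_continuous[OF sol(1)]
    by (auto intro!: compact_continuous_image connected_continuous_image elim: continuous_on_subset)
  then obtain L where L: "\<And>w. w \<in> ?K \<Longrightarrow> \<bar>F' w\<bar> \<le> L"
    using compact_continuous_image[OF continuous_on_subset[OF F'], of ?K]
    by (metis compact_imp_bounded bounded_real image_eqI subset_UNIV)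
  have "\<bar>F (\<xi> r)\<bar> \<le> L * \<bar>\<xi> r - \<xi> s\<bar>" if "r \<in> closed_segment s t" for r
  proof -
    have "convex ?K"
      using \<open>connected ?K\<close> by (metis is_interval_connected_1 is_interval_convex_1)
    then have "norm (F (\<xi> r) - F (\<xi> s)) \<le> L * norm (\<xi> r - \<xi> s)"
      by (rule field_differentiable_bound[where f' = F'])
        (use F L that in \<open>auto intro: has_field_derivative_at_within\<close>)
    then show ?thesis using \<open>F (\<xi> s) = 0\<close> by simp
  qed
  then show ?thesis
    using equilibrium_unique[OF sol] by blast
qed


text \<open>An orbit moves with the sign of the field and cannot pass an equilibrium.\<close>

lemma reaches_iff:
  assumes "convex U" and lip: "L-lipschitz_on U F" and "x \<in> U" "y \<in> U"
  shows "reaches F U x y \<longleftrightarrow>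
    x = y \<or> (x < y \<and> (\<forall>w\<in>{x..y}. 0 < F w)) \<or> (y < x \<and> (\<forall>w\<in>{y..x}. F w < 0))"
proof
  have cont: "continuous_on A F" if "A \<subseteq> U" for A
    using lipschitz_on_continuous_on[OF lip] that continuous_on_subset by blast
  have seg: "{u..v} \<subseteq> U" if "u \<in> U" "v \<in> U" for u v
    using \<open>convex U\<close> that by (metis closed_segment_subset closed_segment_eq_real_ivl atLeastatMost_empty_iff empty_subsetI)
  {
    assume "x = y \<or> (x < y \<and> (\<forall>w\<in>{x..y}. 0 < F w)) \<or> (y < x \<and> (\<forall>w\<in>{y..x}. F w < 0))"
    then show "reaches F U x y"
    proof (elim disjE)
      assume "x = y"
      then show ?thesis
        unfolding reaches_def scalar_solution_def using \<open>x \<in> U\<close>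
        by (intro exI[of _ 0] exI[of _ "\<lambda>_. x"])
          (auto simp: has_field_derivative_def has_derivative_def bounded_linear_mult_right at_within_def)
    next
      assume "x < y \<and> (\<forall>w\<in>{x..y}. 0 < F w)"
      then obtain T \<xi> where "0 \<le> T" "scalar_solution F {0..T} \<xi>" "\<xi> ` {0..T} \<subseteq> {x..y}" "\<xi> 0 = x" "\<xi> T = y"
        using solution_upwards[of x y F] cont[OF seg] assms by auto
      then show ?thesis
        unfolding reaches_def using seg[OF \<open>x \<in> U\<close> \<open>y \<in> U\<close>] by blast
    next
      assume "y < x \<and> (\<forall>w\<in>{y..x}. F w < 0)"
      then obtain T \<xi> where "0 \<le> T" "scalar_solution F {0..T} \<xi>" "\<xi> ` {0..T} \<subseteq> {y..x}" "\<xi> 0 = x" "\<xi> T = y"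
        using solution_downwards[of y x F] cont[OF seg] assms by auto
      then show ?thesis
        unfolding reaches_def using seg[OF \<open>y \<in> U\<close> \<open>x \<in> U\<close>] by blast
    qed
  }
  {
    assume "reaches F U x y"
    then obtain T \<xi> where T: "0 \<le> T" and sol: "scalar_solution F {0..T} \<xi>"
      and U: "\<xi> ` {0..T} \<subseteq> U" and x: "\<xi> 0 = x" and y: "\<xi> T = y"
      unfolding reaches_def by blast
    have stay: "\<xi> t = \<xi> s" if "s \<in> {0..T}" "t \<in> {0..T}" "F (\<xi> s) = 0" for s t
    proof (rule equilibrium_unique[OF sol _ that(1,2) refl])
      fix r assume "r \<in> closed_segment s t"
      then have "r \<in> {0..T}"
        using that by (auto simp: closed_segment_eq_real_ivl split: if_splits)
      then show "\<bar>F (\<xi> r)\<bar> \<le> L * \<bar>\<xi> r - \<xi> s\<bar>"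
        using lipschitz_onD[OF lip, of "\<xi> r" "\<xi> s"] U that
        by (simp add: dist_real_def image_subset_iff)
    qed simp
    have cont\<xi>: "continuous_on {0..T} \<xi>"
      by (rule scalar_solution_continuous[OF sol])
    then have contF\<xi>: "continuous_on {0..T} (\<lambda>t. F (\<xi> t))"
      using continuous_on_compose2[OF cont[OF U]] by blast
    show "x = y \<or> (x < y \<and> (\<forall>w\<in>{x..y}. 0 < F w)) \<or> (y < x \<and> (\<forall>w\<in>{y..x}. F w < 0))"
    proof (cases "\<exists>s\<in>{0..T}. F (\<xi> s) = 0")
      case True
      then show ?thesis
        by (metis stay x y T atLeastAtMost_iff order_refl)
    next
      case False
      then have same: "(\<forall>t\<in>{0..T}. 0 < F (\<xi> t)) \<or> (\<forall>t\<in>{0..T}. F (\<xi> t) < 0)"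
      proof -
        have "is_interval ((\<lambda>t. F (\<xi> t)) ` {0..T})"
          using contF\<xi> by (simp add: is_interval_connected_1 connected_continuous_image)
        then have "0 \<in> (\<lambda>t. F (\<xi> t)) ` {0..T}"
          if "t \<in> {0..T}" "u \<in> {0..T}" "F (\<xi> t) \<le> 0" "0 \<le> F (\<xi> u)" for t u
          by (rule mem_is_interval_1_I[of _ "F (\<xi> t)" "F (\<xi> u)"]) (use that in auto)
        then show ?thesis
          using False by (metis (no_types, lifting) image_iff linorder_not_less order.order_iff_strict)
      qed
      have image: "\<exists>t\<in>{0..T}. \<xi> t = w" if "w \<in> closed_segment x y" for w
      proof -
        have "is_interval (\<xi> ` {0..T})"
          using cont\<xi> by (simp add: is_interval_connected_1 connected_continuous_image)
        then have "closed_segment x y \<subseteq> \<xi> ` {0..T}"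
          using x y T by (intro closed_segment_subset) (auto simp: is_interval_convex_1)
        then show ?thesis using that by blast
      qed
      from same show ?thesis
      proof
        assume pos: "\<forall>t\<in>{0..T}. 0 < F (\<xi> t)"
        have "\<xi> 0 \<le> \<xi> T"
        proof (rule DERIV_nonneg_imp_increasing_open[OF T])
          show "\<exists>d. (\<xi> has_real_derivative d) (at t) \<and> 0 \<le> d" if "0 < t" "t < T" for t
            using scalar_solution_DERIV[OF sol that] pos that by (intro exI[of _ "F (\<xi> t)"]) (auto intro: less_imp_le)
        qed (rule cont\<xi>)
        then show ?thesis
          using pos image x y by (cases "x = y") (auto simp: closed_segment_eq_real_ivl, metis)
      next
        assume neg: "\<forall>t\<in>{0..T}. F (\<xi> t) < 0"
        have "\<xi> T \<le> \<xi> 0"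
        proof (rule DERIV_nonpos_imp_decreasing_open[OF T])
          show "\<exists>d. (\<xi> has_real_derivative d) (at t) \<and> d \<le> 0" if "0 < t" "t < T" for t
            using scalar_solution_DERIV[OF sol that] neg that by (intro exI[of _ "F (\<xi> t)"]) (auto intro: less_imp_le)
        qed (rule cont\<xi>)
        then show ?thesis
          using neg image x y by (cases "x = y") (auto simp: closed_segment_eq_real_ivl, metis)
      qed
    qed
  }
qed

definition attracts_within :: "(real \<Rightarrow> real) \<Rightarrow> real \<Rightarrow> real \<Rightarrow> bool" where
  "attracts_within F c d \<longleftrightarrow> 0 < d \<and> (\<forall>w. 0 < \<bar>w - c\<bar> \<and> \<bar>w - c\<bar> < d \<longrightarrow> (w - c) * F w < 0)"

lemma attracts_within_from_derivative:
  assumes "F c = 0" "(F has_real_derivative D) (at c)" "D < 0"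
  shows "\<exists>d. attracts_within F c d"
proof -
  obtain d1 where d1: "d1 > 0" "\<And>h. 0 < h \<Longrightarrow> h < d1 \<Longrightarrow> F (c + h) < 0"
    using DERIV_neg_dec_right[OF assms(2,3)] \<open>F c = 0\<close> by auto
  obtain d2 where d2: "d2 > 0" "\<And>h. 0 < h \<Longrightarrow> h < d2 \<Longrightarrow> 0 < F (c - h)"
    using DERIV_neg_dec_left[OF assms(2,3)] \<open>F c = 0\<close> by auto
  have "(w - c) * F w < 0" if "0 < \<bar>w - c\<bar>" "\<bar>w - c\<bar> < min d1 d2" for w
  proof (cases "c < w")
    case True
    then show ?thesis
      using d1(2)[of "w - c"] that by (simp add: mult_less_0_iff)
  next
    case False
    then show ?thesis
      using d2(2)[of "c - w"] that by (auto simp: mult_less_0_iff)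
  qed
  then show ?thesis
    using d1(1) d2(1) by (auto simp: attracts_within_def intro!: exI[of _ "min d1 d2"])
qed

lemma compact_Icc_superlevel:
  fixes f :: "real \<Rightarrow> real"
  assumes "continuous_on {a..b} f"
  shows "compact {t\<in>{a..b}. \<rho> \<le> f t}"
proof -
  have "closed {t\<in>{a..b}. \<rho> \<le> f t}"
    using continuous_on_closed_Collect_le[OF continuous_on_const assms] by simp
  moreover have "{t\<in>{a..b}. \<rho> \<le> f t} = {a..b} \<inter> {t\<in>{a..b}. \<rho> \<le> f t}"
    by auto
  ultimately show ?thesis
    by (metis compact_Icc compact_Int_closed)
qed

text \<open>The first time at which the solution is farther from \<open>c\<close> than at the start would have to be
  preceded by a stretch on which the distance grows although the field points towards \<open>c\<close>.\<close>

lemma distance_to_attractor_decreases: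
  assumes att: "attracts_within F c d" and sol: "scalar_solution F {a..b} \<xi>" and "a \<le> b"
    and near: "\<bar>\<xi> a - c\<bar> < d"
  shows "\<bar>\<xi> b - c\<bar> \<le> \<bar>\<xi> a - c\<bar>"
proof (rule ccontr)
  assume "\<not> ?thesis"
  then obtain \<rho> where \<rho>: "\<bar>\<xi> a - c\<bar> < \<rho>" "\<rho> < d" "\<rho> < \<bar>\<xi> b - c\<bar>"
    using near dense[of "\<bar>\<xi> a - c\<bar>" "min d \<bar>\<xi> b - c\<bar>"] by auto
  have cont: "continuous_on {a..b} (\<lambda>t. \<bar>\<xi> t - c\<bar>)"
    by (intro continuous_intros scalar_solution_continuous[OF sol])
  define S where "S = {t\<in>{a..b}. \<rho> \<le> \<bar>\<xi> t - c\<bar>}"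
  have "compact S"
    unfolding S_def by (intro compact_Icc_superlevel cont)
  then obtain t1 where "t1 \<in> S" and first: "\<And>t. t \<in> S \<Longrightarrow> t1 \<le> t"
  proof -
    have "S \<noteq> {}"
      using \<rho> \<open>a \<le> b\<close> by (force simp: S_def)
    then show ?thesis
      using compact_attains_inf[OF \<open>compact S\<close>] that by blast
  qed
  then have t1: "a \<le> t1" "t1 \<le> b" "\<rho> \<le> \<bar>\<xi> t1 - c\<bar>"
    by (auto simp: S_def)
  have before: "\<bar>\<xi> t - c\<bar> < d" if "a < t" "t < t1" for t
    using first[of t] that t1 \<rho> by (fastforce simp: S_def)
  have sol1: "scalar_solution F {a..t1} \<xi>"
    using scalar_solution_subset[OF sol] t1 by auto
  have "(\<xi> t1 - c)\<^sup>2 \<le> (\<xi> a - c)\<^sup>2"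
  proof (rule DERIV_nonpos_imp_decreasing_open[OF \<open>a \<le> t1\<close>])
    fix t assume t: "a < t" "t < t1"
    have "((\<lambda>t. (\<xi> t - c)\<^sup>2) has_real_derivative 2 * ((\<xi> t - c) * F (\<xi> t))) (at t)"
      using scalar_solution_DERIV[OF sol1 t] by (auto intro!: derivative_eq_intros)
    moreover have "(\<xi> t - c) * F (\<xi> t) \<le> 0"
      using att before[OF t] unfolding attracts_within_def
      by (cases "\<xi> t = c") (auto intro: less_imp_le)
    ultimately show "\<exists>y. ((\<lambda>t. (\<xi> t - c)\<^sup>2) has_real_derivative y) (at t) \<and> y \<le> 0"
      by (metis mult_nonneg_nonpos zero_le_numeral)
  next
    show "continuous_on {a..t1} (\<lambda>t. (\<xi> t - c)\<^sup>2)"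
      by (intro continuous_intros scalar_solution_continuous[OF sol1])
  qed
  then have "\<bar>\<xi> t1 - c\<bar> \<le> \<bar>\<xi> a - c\<bar>"
    by (simp add: abs_le_square_iff)
  then show False using t1 \<rho> by linarith
qed

text \<open>If the distance did not tend to zero, the solution would stay in a compact annulus around \<open>c\<close>, where
  \<open>(w - c) * F w\<close> is bounded by a negative constant, and the squared distance would decrease
  linearly forever.\<close>

lemma solution_tends_to_attractor:
  assumes att: "attracts_within F c d" and F: "continuous_on UNIV F"
    and sol: "scalar_solution F {0..} \<xi>" and near: "\<bar>\<xi> 0 - c\<bar> < d"
  shows "((\<lambda>t. \<bar>\<xi> t - c\<bar>) \<longlongrightarrow> 0) at_top"
proof -
  have dec: "\<bar>\<xi> t - c\<bar> \<le> \<bar>\<xi> s - c\<bar>" if "0 \<le> s" "s \<le> t" for s t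
  proof -
    have "\<bar>\<xi> s - c\<bar> < d"
      using distance_to_attractor_decreases[OF att, of 0 s \<xi>] near that scalar_solution_subset[OF sol, of "{0..s}"]
      by auto
    then show ?thesis
      using distance_to_attractor_decreases[OF att, of s t \<xi>] that scalar_solution_subset[OF sol, of "{s..t}"]
      by auto
  qed
  have "\<exists>t\<ge>0. \<bar>\<xi> t - c\<bar> < \<eta>" if "\<eta> > 0" for \<eta>
  proof (rule ccontr)
    assume "\<not> ?thesis"
    then have far: "\<eta> \<le> \<bar>\<xi> t - c\<bar>" if "0 \<le> t" for t
      using that by (meson not_le_imp_less)
    define K where "K = cball c \<bar>\<xi> 0 - c\<bar> - ball c \<eta>"
    have K: "\<xi> t \<in> K" if "0 \<le> t" for t
      using far[OF that] dec[of 0 t] that by (auto simp: K_def dist_real_def)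
    have "compact K"
      by (auto simp: K_def intro: compact_diff)
    moreover have "continuous_on K (\<lambda>w. (w - c) * F w)"
      by (intro continuous_intros continuous_on_subset[OF F]) auto
    ultimately obtain w0 where w0: "w0 \<in> K" "\<And>w. w \<in> K \<Longrightarrow> (w - c) * F w \<le> (w0 - c) * F w0"
      using continuous_attains_sup[of K "\<lambda>w. (w - c) * F w"] K[of 0] by auto
    define m where "m = - ((w0 - c) * F w0)"
    have "m > 0"
      using att w0(1) near \<open>\<eta> > 0\<close>
      by (auto simp: m_def attracts_within_def K_def dist_real_def abs_minus_commute)
    have lin: "(\<xi> T - c)\<^sup>2 + 2 * m * T \<le> (\<xi> 0 - c)\<^sup>2" if "T \<ge> 0" for T
    proof -
      have solT: "scalar_solution F {0..T} \<xi>"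
        using scalar_solution_subset[OF sol] by auto
      have "(\<lambda>t. (\<xi> t - c)\<^sup>2 + 2 * m * t) T \<le> (\<lambda>t. (\<xi> t - c)\<^sup>2 + 2 * m * t) 0"
      proof (rule DERIV_nonpos_imp_decreasing_open[OF that])
        fix t assume t: "0 < t" "t < T"
        have "((\<lambda>t. (\<xi> t - c)\<^sup>2 + 2 * m * t) has_real_derivative 2 * ((\<xi> t - c) * F (\<xi> t)) + 2 * m) (at t)"
          using scalar_solution_DERIV[OF solT t] by (auto intro!: derivative_eq_intros)
        moreover have "(\<xi> t - c) * F (\<xi> t) \<le> - m"
          using w0(2)[OF K, of t] t by (simp add: m_def)
        ultimately show "\<exists>y. ((\<lambda>t. (\<xi> t - c)\<^sup>2 + 2 * m * t) has_real_derivative y) (at t) \<and> y \<le> 0"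
          by (intro exI conjI) auto
      next
        show "continuous_on {0..T} (\<lambda>t. (\<xi> t - c)\<^sup>2 + 2 * m * t)"
          by (intro continuous_intros scalar_solution_continuous[OF solT])
      qed
      then show ?thesis by simp
    qed
    have "2 * m * (((\<xi> 0 - c)\<^sup>2 + 1) / (2 * m)) = (\<xi> 0 - c)\<^sup>2 + 1"
      using \<open>m > 0\<close> by simp
    moreover have "0 \<le> ((\<xi> 0 - c)\<^sup>2 + 1) / (2 * m)"
      using \<open>m > 0\<close> by simp
    ultimately show False
      using lin[of "((\<xi> 0 - c)\<^sup>2 + 1) / (2 * m)"] zero_le_power2[of "\<xi> (((\<xi> 0 - c)\<^sup>2 + 1) / (2 * m)) - c"]
      by linarith
  qed
  then show ?thesis
    unfolding tendsto_iff eventually_at_top_linorder dist_real_def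
    by (metis abs_idempotent diff_zero dec order_le_less_trans)
qed

text \<open>With \<open>w = c \<plusminus> exp (- v)\<close> the equation towards \<open>c\<close> turns into \<open>v' = h v\<close> with a positive \<open>h\<close>
  that is bounded by the Lipschitz constant, so \<open>v\<close> exists for all times and \<open>w\<close> does not reach \<open>c\<close>.\<close>

lemma solution_near_attractor:
  assumes att: "attracts_within F c d" and F: "continuous_on UNIV F" and "F c = 0"
    and L: "\<And>w. \<bar>w - c\<bar> < d \<Longrightarrow> \<bar>F w\<bar> \<le> L * \<bar>w - c\<bar>" and near: "\<bar>x0 - c\<bar> < d"
  obtains \<xi> where "scalar_solution F {0..} \<xi>" "\<xi> 0 = x0" "\<And>t. 0 \<le> t \<Longrightarrow> \<xi> t \<in> closed_segment c x0"
proof (cases "x0 = c")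
  case True
  show ?thesis
  proof (rule that)
    show "scalar_solution F {0..} (\<lambda>_. c)"
      unfolding scalar_solution_def \<open>F c = 0\<close> by (intro ballI derivative_intros)
  qed (simp_all add: True)
next
  case False
  define s where "s = sgn (x0 - c)"
  have s: "s * s = 1" "\<bar>s\<bar> = 1" "s * \<bar>x0 - c\<bar> = x0 - c"
    using False by (auto simp: s_def sgn_if)
  define v0 where "v0 = - ln \<bar>x0 - c\<bar>"
  have exp0: "exp (- v0) = \<bar>x0 - c\<bar>"
    using False by (simp add: v0_def)
  define W where "W v = c + s * exp (- v)" for v
  have W0: "W v0 = x0"
    using s exp0 by (simp add: W_def)
  define h where "h v = - s * F (W (max v v0)) / exp (- max v v0)" for v
  have Wd: "\<bar>W (max v v0) - c\<bar> = exp (- max v v0)" "exp (- max v v0) < d" for v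
  proof -
    show "\<bar>W (max v v0) - c\<bar> = exp (- max v v0)"
      using s by (simp add: W_def abs_mult)
    have "exp (- max v v0) \<le> exp (- v0)" by simp
    then show "exp (- max v v0) < d"
      using near exp0 by linarith
  qed
  have hpos: "0 < h v" for v
  proof -
    have "(W (max v v0) - c) * F (W (max v v0)) < 0"
      using att Wd[of v] unfolding attracts_within_def by (metis exp_gt_zero)
    then have "s * exp (- max v v0) * F (W (max v v0)) < 0"
      by (simp add: W_def)
    then have "exp (- max v v0) * (- s * F (W (max v v0))) > 0"
      by (simp add: mult.assoc mult.left_commute)
    then show ?thesis
      unfolding h_def by (simp add: zero_less_mult_iff mult_less_0_iff divide_less_0_iff)
  qed
  have hL: "h v \<le> L" for v
  proof -
    have "- s * F (W (max v v0)) \<le> \<bar>- s * F (W (max v v0))\<bar>"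
      by (rule abs_ge_self)
    also have "\<dots> = \<bar>F (W (max v v0))\<bar>"
      using s by (simp add: abs_mult)
    also have "\<dots> \<le> L * exp (- max v v0)"
      using L[of "W (max v v0)"] Wd[of v] by simp
    finally show ?thesis
      unfolding h_def by (subst pos_divide_le_eq) simp_all
  qed
  have "continuous_on UNIV h"
    unfolding h_def W_def by (intro continuous_intros continuous_on_compose2[OF F]) auto
  then obtain v where v0: "v 0 = v0" and v: "\<And>t. (v has_real_derivative h (v t)) (at t)"
    using flow_of_positive_field[of h L v0] hpos hL by blast
  have ge: "v0 \<le> v t" if "0 \<le> t" for t
    using DERIV_nonneg_imp_nondecreasing[OF that, of v] v hpos v0 by (metis less_imp_le)
  have W': "((\<lambda>t. W (v t)) has_real_derivative F (W (v t))) (at t within {0..})" if "0 \<le> t" for t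
  proof -
    have "((\<lambda>t. W (v t)) has_real_derivative - (s * exp (- v t)) * h (v t)) (at t within {0..})"
      unfolding W_def
      by (rule has_field_derivative_at_within) (auto intro!: derivative_eq_intros v)
    moreover have "- (s * exp (- v t)) * h (v t) = F (W (v t))"
    proof -
      have "h (v t) * exp (- v t) = - s * F (W (v t))"
        using ge[OF that] by (simp add: h_def max_absorb1)
      then have "- (s * exp (- v t)) * h (v t) = (s * s) * F (W (v t))"
        by (metis (no_types, lifting) mult.assoc mult.commute mult_minus_left minus_minus)
      then show ?thesis using s(1) by simp
    qed
    ultimately show ?thesis by simp
  qed
  show ?thesis
  proof (rule that)
    show "scalar_solution F {0..} (\<lambda>t. W (v t))"
      using W' by (simp add: scalar_solution_def)
    show "W (v 0) = x0"
      using v0 W0 by simp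
    show "W (v t) \<in> closed_segment c x0" if "0 \<le> t" for t
    proof -
      have "exp (- v t) \<le> \<bar>x0 - c\<bar>"
        using ge[OF that] exp0 by (metis exp_le_cancel_iff neg_le_iff_le)
      then show ?thesis
        by (auto simp: W_def s_def sgn_if closed_segment_eq_real_ivl split: if_splits)
    qed
  qed
qed


lemma C1_lipschitz_at:
  fixes F :: "real \<Rightarrow> real"
  assumes F: "\<And>w. (F has_real_derivative F' w) (at w)" and F': "continuous_on UNIV F'" and "F c = 0"
  obtains L where "\<And>w. \<bar>w - c\<bar> < d \<Longrightarrow> \<bar>F w\<bar> \<le> L * \<bar>w - c\<bar>"
proof -
  have "compact (F' ` cball c d)"
    by (intro compact_continuous_image continuous_on_subset[OF F']) auto
  then obtain L where L: "\<And>w. w \<in> cball c d \<Longrightarrow> \<bar>F' w\<bar> \<le> L"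
    by (metis compact_imp_bounded bounded_real image_eqI)
  have "\<bar>F w\<bar> \<le> L * \<bar>w - c\<bar>" if "\<bar>w - c\<bar> < d" for w
  proof -
    have "norm (F w - F c) \<le> L * norm (w - c)"
      by (rule field_differentiable_bound[of "cball c d" F F'])
        (use F L that in \<open>auto intro: has_field_derivative_at_within simp: dist_real_def\<close>)
    then show ?thesis using \<open>F c = 0\<close> by simp
  qed
  with that show ?thesis by blast
qed

text \<open>A system whose distance to an invariant set is measured by one coordinate \<open>p\<close>, which takes
  its values in \<open>I\<close> and satisfies an autonomous scalar equation.  Both the amplitude equation itself
  and the flow on the leaf are of this kind, in either direction of time.\<close>

locale scalar_reduction =
  fixes X :: "'a::metric_space set" and sol :: "'a system" and p :: "'a \<Rightarrow> real"
    and F F' :: "real \<Rightarrow> real" and I :: "real set"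
  assumes in_X: "sol J z \<Longrightarrow> t \<in> J \<Longrightarrow> z t \<in> X"
    and proj: "sol J z \<Longrightarrow> scalar_solution F J (\<lambda>t. p (z t))"
    and lift: "convex J \<Longrightarrow> closed J \<Longrightarrow> 0 \<in> J \<Longrightarrow> scalar_solution F J \<xi> \<Longrightarrow> \<xi> ` J \<subseteq> I \<Longrightarrow>
      x \<in> X \<Longrightarrow> p x = \<xi> 0 \<Longrightarrow> \<exists>z. sol J z \<and> z 0 = x \<and> (\<forall>t\<in>J. p (z t) = \<xi> t)"
    and range: "p ` X = I" and convex_I: "convex I"
    and deriv: "\<And>w. (F has_real_derivative F' w) (at w)" and deriv_cont: "continuous_on UNIV F'"
begin

lemma asymptotically_stable_if:
  assumes "0 < m" and dist: "\<And>x. x \<in> X \<Longrightarrow> infdist x S = m * \<bar>p x - c\<bar>"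
    and "c \<in> I" "F c = 0" "F' c < 0"
  shows "asymptotically_stable X sol S"
proof -
  obtain d where att: "attracts_within F c d"
    using attracts_within_from_derivative[OF \<open>F c = 0\<close> deriv \<open>F' c < 0\<close>] by blast
  have "d > 0" using att by (simp add: attracts_within_def)
  have F: "continuous_on UNIV F"
    using deriv by (meson DERIV_isCont continuous_at_imp_continuous_on)
  obtain L where L: "\<And>w. \<bar>w - c\<bar> < d \<Longrightarrow> \<bar>F w\<bar> \<le> L * \<bar>w - c\<bar>"
    by (rule C1_lipschitz_at[OF deriv deriv_cont \<open>F c = 0\<close>]) blast
  have "lyapunov_stable sol S"
    unfolding lyapunov_stable_def
  proof (intro allI impI)
    fix \<epsilon> :: real assume "\<epsilon> > 0"
    have "infdist (z T) S < \<epsilon>"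
      if "0 \<le> T" and z: "sol {0..T} z" and near: "infdist (z 0) S < min \<epsilon> (m * d)" for T z
    proof -
      have X: "z 0 \<in> X" "z T \<in> X"
        using in_X[OF z] \<open>0 \<le> T\<close> by auto
      then have "\<bar>p (z 0) - c\<bar> < d"
        using near dist \<open>0 < m\<close> by auto
      then have "\<bar>p (z T) - c\<bar> \<le> \<bar>p (z 0) - c\<bar>"
        by (rule distance_to_attractor_decreases[OF att proj[OF z] \<open>0 \<le> T\<close>])
      then have "infdist (z T) S \<le> infdist (z 0) S"
        using X dist \<open>0 < m\<close> by simp
      then show ?thesis using near by simp
    qed
    then show "\<exists>\<delta>>0. \<forall>T\<ge>0. \<forall>z. sol {0..T} z \<and> infdist (z 0) S < \<delta> \<longrightarrow> infdist (z T) S < \<epsilon>"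
      using \<open>\<epsilon> > 0\<close> \<open>0 < m\<close> \<open>d > 0\<close> by (intro exI[of _ "min \<epsilon> (m * d)"]) simp
  qed
  moreover have "\<exists>z. sol {0..} z \<and> z 0 = x" if "x \<in> X" "infdist x S < m * d" for x
  proof -
    have "\<bar>p x - c\<bar> < d"
      using that dist \<open>0 < m\<close> by simp
    then obtain \<xi> where \<xi>: "scalar_solution F {0..} \<xi>" "\<xi> 0 = p x"
      "\<And>t. 0 \<le> t \<Longrightarrow> \<xi> t \<in> closed_segment c (p x)"
      using solution_near_attractor[OF att F \<open>F c = 0\<close> L] by blast
    have "p x \<in> I"
      using range \<open>x \<in> X\<close> by blast
    then have "\<xi> ` {0..} \<subseteq> I"
      using \<xi>(3) closed_segment_subset[OF \<open>c \<in> I\<close> _ convex_I] by fastforce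
    then show ?thesis
      using lift[of "{0..}" \<xi> x] \<xi> \<open>x \<in> X\<close> by auto
  qed
  moreover have "((\<lambda>t. infdist (z t) S) \<longlongrightarrow> 0) at_top"
    if z: "sol {0..} z" and near: "infdist (z 0) S < m * d" for z
  proof -
    have X: "z t \<in> X" if "0 \<le> t" for t
      using in_X[OF z] that by auto
    then have "\<bar>p (z 0) - c\<bar> < d"
      using near dist \<open>0 < m\<close> by simp
    then have "((\<lambda>t. m * \<bar>p (z t) - c\<bar>) \<longlongrightarrow> m * 0) at_top"
      by (intro tendsto_intros solution_tends_to_attractor[OF att F proj[OF z]])
    moreover have "\<forall>\<^sub>F t in at_top. m * \<bar>p (z t) - c\<bar> = infdist (z t) S"
      using eventually_ge_at_top[of 0] by eventually_elim (simp add: dist X)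
    ultimately show ?thesis
      using tendsto_cong[of "\<lambda>t. m * \<bar>p (z t) - c\<bar>"] by simp
  qed
  ultimately show ?thesis
    unfolding asymptotically_stable_def using \<open>0 < m\<close> \<open>d > 0\<close>
    by (intro conjI exI[of _ "m * d"]) auto
qed

text \<open>To the right of \<open>c\<close> the field is positive, so arbitrarily close to \<open>c\<close> there start solutions
  that travel a fixed distance.\<close>

lemma unstable_if:
  assumes "0 < m" and dist: "\<And>x. x \<in> X \<Longrightarrow> infdist x S = m * \<bar>p x - c\<bar>"
    and "{c..} \<subseteq> I" "F c = 0" "0 < F' c"
  shows "\<not> lyapunov_stable sol S"
proof
  assume stable: "lyapunov_stable sol S"
  obtain d where "d > 0" and d: "\<And>h. 0 < h \<Longrightarrow> h < d \<Longrightarrow> 0 < F (c + h)"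
    using DERIV_pos_inc_right[OF deriv \<open>0 < F' c\<close>] \<open>F c = 0\<close> by auto
  have "0 < m * (d / 2)"
    using \<open>0 < m\<close> \<open>d > 0\<close> by simp
  then obtain \<delta> where "\<delta> > 0" and \<delta>: "\<And>T z. 0 \<le> T \<Longrightarrow> sol {0..T} z \<Longrightarrow> infdist (z 0) S < \<delta> \<Longrightarrow>
      infdist (z T) S < m * (d / 2)"
    using stable unfolding lyapunov_stable_def by meson
  define h where "h = min (d / 2) (\<delta> / (2 * m))"
  have h: "0 < h" "h \<le> d / 2" "m * h < \<delta>"
  proof -
    have "m * h \<le> m * (\<delta> / (2 * m))"
      using \<open>0 < m\<close> by (intro mult_left_mono) (auto simp: h_def)
    also have "\<dots> < \<delta>"
      using \<open>0 < m\<close> \<open>\<delta> > 0\<close> by simp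
    finally show "m * h < \<delta>" .
  qed (use \<open>0 < m\<close> \<open>d > 0\<close> \<open>\<delta> > 0\<close> in \<open>auto simp: h_def\<close>)
  have cont: "continuous_on A F" for A
    using deriv by (meson DERIV_isCont continuous_at_imp_continuous_on)
  have pos: "0 < F w" if "w \<in> {c + h..c + d / 2}" for w
    using d[of "w - c"] that h \<open>d > 0\<close> by auto
  obtain T \<xi> where \<xi>: "0 \<le> T" "scalar_solution F {0..T} \<xi>" "\<xi> ` {0..T} \<subseteq> {c + h..c + d / 2}"
    "\<xi> 0 = c + h" "\<xi> T = c + d / 2"
    by (rule solution_upwards[OF _ cont pos]) (use h in auto)
  have "{c + h..c + d / 2} \<subseteq> I"
    using \<open>{c..} \<subseteq> I\<close> h by (meson atLeastAtMost_iff atLeast_iff le_add_same_cancel1 less_imp_le order_trans subsetD subsetI)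
  then have "\<xi> ` {0..T} \<subseteq> I"
    using \<xi>(3) by blast
  moreover obtain x where "x \<in> X" "p x = \<xi> 0"
    using range \<open>{c..} \<subseteq> I\<close> \<xi>(4) h by (metis (no_types, lifting) atLeast_iff imageE le_add_same_cancel1 less_imp_le subsetD)
  ultimately obtain z where z: "sol {0..T} z" "\<forall>t\<in>{0..T}. p (z t) = \<xi> t"
    using lift[of "{0..T}" \<xi> x] \<xi> by auto
  have "z 0 \<in> X" "z T \<in> X"
    using in_X[OF z(1)] \<xi>(1) by auto
  then have "infdist (z 0) S = m * h" "infdist (z T) S = m * (d / 2)"
    using dist z(2) \<xi> h \<open>d > 0\<close> by auto
  then show False
    using \<delta>[OF \<xi>(1) z(1)] h by simp
qed

end

lemma scalar_reduction_self:
  assumes "\<And>w. (F has_real_derivative F' w) (at w)" "continuous_on UNIV F'"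
  shows "scalar_reduction UNIV (scalar_solution F) (\<lambda>x. x) F F' UNIV"
  using assms by unfold_locales auto

lemma scalar_asymptotically_stable:
  assumes "\<And>w. (F has_real_derivative F' w) (at w)" "continuous_on UNIV F'" "F c = 0" "F' c < 0"
  shows "asymptotically_stable UNIV (scalar_solution F) {c}"
  by (rule scalar_reduction.asymptotically_stable_if[OF scalar_reduction_self[OF assms(1,2)], of 1 _ c])
    (use assms in \<open>auto simp: dist_real_def\<close>)

lemma scalar_repelling:
  assumes F: "\<And>w. (F has_real_derivative F' w) (at w)" "continuous_on UNIV F'" "F c = 0" "0 < F' c"
  shows "repelling UNIV (scalar_solution F) {c}"
proof -
  have "asymptotically_stable UNIV (scalar_solution (\<lambda>w. - F w)) {c}"
    by (rule scalar_asymptotically_stable[where F' = "\<lambda>w. - F' w"])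
      (use F in \<open>auto intro: derivative_intros continuous_on_minus\<close>)
  then show ?thesis
    unfolding repelling_def scalar_solution_reverse_iff .
qed

section \<open>Geometry of the leaf\<close>

lemma continuous_extension_from_interval:
  fixes f :: "real \<Rightarrow> real"
  assumes "convex J" "closed J" "J \<noteq> {}" "continuous_on J f"
  obtains g where "continuous_on UNIV g" "\<And>t. t \<in> J \<Longrightarrow> g t = f t"
proof
  show "continuous_on UNIV (f \<circ> closest_point J)"
  proof (rule continuous_on_compose)
    show "continuous_on UNIV (closest_point J)"
      by (rule continuous_on_closest_point[OF assms(1-3)])
    have "range (closest_point J) \<subseteq> J"
      using closest_point_in_set[OF assms(2,3)] by blast
    then show "continuous_on (range (closest_point J)) f"
      by (rule continuous_on_subset[OF assms(4)])
  qed
qed (simp add: closest_point_self)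

text \<open>The closed leaf as a cone over a torus: the amplitude \<open>cmod (z $ \<sigma> k)\<close> determines all the
  other ones, and the distances to the hypertori and to the origin.\<close>

locale leaf_geometry =
  fixes k :: nat and \<sigma> :: "nat \<Rightarrow> 'n::{finite,linorder}" and C :: "real ^ ('n::{finite,linorder})"
  assumes k: "1 \<le> k" "k \<le> CARD('n)"
    and \<sigma>: "\<sigma> \<in> shuffle_perms k" and C: "C \<in> positive_sphere k \<sigma>"
begin

abbreviation "X \<equiv> closure (leaf k \<sigma> C)"
abbreviation "amp z \<equiv> cmod (z $ \<sigma> k)"

lemma bij: "bij_betw \<sigma> {1..CARD('n)} UNIV"
  using \<sigma> by (simp add: shuffle_perms_def)

lemma index_cases:
  obtains i where "i \<in> {1..k}" "j = \<sigma> i" | i where "i \<in> {k<..CARD('n)}" "j = \<sigma> i"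
proof -
  obtain i where "i \<in> {1..CARD('n)}" "j = \<sigma> i"
    using bij by (metis UNIV_I bij_betw_imp_surj_on imageE)
  then show ?thesis
    using that(1)[of i] that(2)[of i] by (cases "i \<le> k") auto
qed

lemma C_pos: "i \<in> {1..k} \<Longrightarrow> 0 < C $ \<sigma> i"
  and C_zero: "i \<in> {k<..CARD('n)} \<Longrightarrow> C $ \<sigma> i = 0"
  and C_sum: "(\<Sum>i=1..k. (C $ \<sigma> i)\<^sup>2) = 1"
  using C by (auto simp: positive_sphere_def)

lemma C_k: "0 < C $ \<sigma> k"
  using C_pos k by auto

text \<open>Taking the closure adds the origin, the limit of the points \<open>t *\<^sub>R C\<close> for \<open>t \<longlongrightarrow> 0\<close>.\<close>

lemma closure_leaf:
  "X = {z. (\<forall>i\<in>{1..k}. cmod (z $ \<sigma> i) = C $ \<sigma> i / C $ \<sigma> k * amp z)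
          \<and> (\<forall>i\<in>{k<..CARD('n)}. z $ \<sigma> i = 0)}" (is "X = ?Y")
proof
  have "closed {z. cmod (z $ \<sigma> i) = C $ \<sigma> i / C $ \<sigma> k * amp z}" for i
    by (intro closed_Collect_eq continuous_intros)
  moreover have "closed {z. z $ \<sigma> i = (0 :: complex)}" for i
    by (intro closed_Collect_eq continuous_intros)
  ultimately have "closed ?Y"
    by (auto simp: Collect_conj_eq Collect_ball_eq intro!: closed_Int closed_INT)
  then show "X \<subseteq> ?Y"
    by (intro closure_minimal) (auto simp: leaf_def)
  show "?Y \<subseteq> X"
  proof
    fix z assume z: "z \<in> ?Y"
    show "z \<in> X"
    proof (cases "amp z = 0")
      case False
      have pos: "0 < cmod (z $ \<sigma> i)" if "i \<in> {1..k}" for i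
      proof -
        have "cmod (z $ \<sigma> i) = C $ \<sigma> i / C $ \<sigma> k * amp z"
          using z that by blast
        also have "\<dots> > 0"
          using False C_pos[OF that] C_k by (intro mult_pos_pos) auto
        finally show ?thesis .
      qed
      have "z \<in> leaf k \<sigma> C"
        unfolding leaf_def using z pos by blast
      then show ?thesis using closure_subset by blast
    next
      case True
      have "z $ j = 0" for j
      proof (rule index_cases[of j])
        fix i assume "i \<in> {1..k}" and j: "j = \<sigma> i"
        then have "cmod (z $ \<sigma> i) = C $ \<sigma> i / C $ \<sigma> k * amp z"
          using z by blast
        then show ?thesis
          unfolding True j by simp
      qed (use z in blast)
      then have "z = 0" by (simp add: vec_eq_iff)
      define w :: "real \<Rightarrow> complex ^ ('n::{finite,linorder})" where "w t = (\<chi> j. of_real (t * C $ j / C $ \<sigma> k))" for t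
      have "w t \<in> leaf k \<sigma> C" if "0 < t" for t
      proof -
        have 1: "cmod (w t $ \<sigma> i) = t * C $ \<sigma> i / C $ \<sigma> k" if "i \<in> {1..k}" for i
          using C_pos[OF that] C_k \<open>0 < t\<close> by (simp add: w_def norm_divide norm_mult)
        have 2: "w t $ \<sigma> i = 0" if "i \<in> {k<..CARD('n)}" for i
          using C_zero[OF that] by (simp add: w_def)
        have 3: "0 < cmod (w t $ \<sigma> i)" if "i \<in> {1..k}" for i
          using C_pos[OF that] C_k \<open>0 < t\<close> by (simp add: w_def norm_divide norm_mult)
        have "amp (w t) = t"
          using 1[of k] k C_k by simp
        then have "cmod (w t $ \<sigma> i) = C $ \<sigma> i / C $ \<sigma> k * amp (w t)" if "i \<in> {1..k}" for i
          using 1[OF that] by simp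
        with 2 3 show ?thesis
          unfolding leaf_def by blast
      qed
      moreover have "(w \<longlongrightarrow> 0) (at_right 0)"
      proof (rule vec_tendstoI)
        fix j
        have "((\<lambda>t. complex_of_real (t * C $ j / C $ \<sigma> k)) \<longlongrightarrow> of_real (0 * C $ j / C $ \<sigma> k)) (at_right 0)"
          by (intro tendsto_intros) (use C_k in simp)
        then show "((\<lambda>t. w t $ j) \<longlongrightarrow> 0 $ j) (at_right 0)"
          by (simp add: w_def)
      qed
      ultimately show ?thesis
        unfolding \<open>z = 0\<close>
      proof (intro Lim_in_closed_set[OF closed_closure])
        show "\<forall>\<^sub>F t in at_right 0. w t \<in> X"
          using eventually_at_right_less[of 0]
          by eventually_elim (use closure_subset \<open>\<And>t. 0 < t \<Longrightarrow> w t \<in> leaf k \<sigma> C\<close> in blast)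
      qed auto
    qed
  qed
qed

lemma closure_leaf_amp: "z \<in> X \<Longrightarrow> i \<in> {1..k} \<Longrightarrow> cmod (z $ \<sigma> i) = C $ \<sigma> i / C $ \<sigma> k * amp z"
  and closure_leaf_zero: "z \<in> X \<Longrightarrow> i \<in> {k<..CARD('n)} \<Longrightarrow> z $ \<sigma> i = 0"
  unfolding closure_leaf by blast+

lemma closure_leafI:
  assumes "\<And>i. i \<in> {1..k} \<Longrightarrow> cmod (z $ \<sigma> i) = C $ \<sigma> i / C $ \<sigma> k * \<rho>"
    and "\<And>i. i \<in> {k<..CARD('n)} \<Longrightarrow> z $ \<sigma> i = 0"
  shows "z \<in> X" "amp z = \<rho>"
proof -
  show "amp z = \<rho>"
    using assms(1)[of k] k C_k by simp
  then show "z \<in> X"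
    unfolding closure_leaf using assms by blast
qed

lemma norm_closure_leaf:
  assumes "z \<in> X"
  shows "norm z = 1 / C $ \<sigma> k * amp z"
proof -
  have "(norm z)\<^sup>2 = (\<Sum>j\<in>UNIV. (cmod (z $ j))\<^sup>2)"
    by (simp add: norm_vec_def L2_set_def sum_nonneg)
  also have "\<dots> = (\<Sum>i=1..CARD('n). (cmod (z $ \<sigma> i))\<^sup>2)"
    by (rule sum.reindex_bij_betw[OF bij, symmetric])
  also have "\<dots> = (\<Sum>i=1..k. (cmod (z $ \<sigma> i))\<^sup>2)"
    using k closure_leaf_zero[OF assms] by (intro sum.mono_neutral_right) auto
  also have "\<dots> = (\<Sum>i=1..k. (C $ \<sigma> i)\<^sup>2 * (amp z / C $ \<sigma> k)\<^sup>2)"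
  proof (rule sum.cong)
    show "(cmod (z $ \<sigma> i))\<^sup>2 = (C $ \<sigma> i)\<^sup>2 * (amp z / C $ \<sigma> k)\<^sup>2" if "i \<in> {1..k}" for i
      unfolding closure_leaf_amp[OF assms that] by (simp add: power_mult_distrib power_divide)
  qed simp
  also have "\<dots> = (amp z / C $ \<sigma> k)\<^sup>2"
    using C_sum by (simp only: sum_distrib_right[symmetric] mult_1_left)
  finally show ?thesis
    using C_k by (simp add: power2_eq_iff_nonneg)
qed

lemma closure_leaf_scale:
  assumes "z \<in> X" "0 \<le> t"
  shows "t *\<^sub>R z \<in> X" "amp (t *\<^sub>R z) = t * amp z"
proof -
  have "cmod ((t *\<^sub>R z) $ \<sigma> i) = C $ \<sigma> i / C $ \<sigma> k * (t * amp z)" if "i \<in> {1..k}" for i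
    using \<open>0 \<le> t\<close> by (simp add: closure_leaf_amp[OF assms(1) that])
  then show "t *\<^sub>R z \<in> X" "amp (t *\<^sub>R z) = t * amp z"
    by (rule closure_leafI; simp add: closure_leaf_zero[OF assms(1)])+
qed

lemma hypertorus_eq:
  assumes "0 < r"
  shows "hypertorus k \<sigma> C r = {z \<in> X. amp z = r}"
proof -
  have "0 < cmod (z $ \<sigma> i)" if "z \<in> X" "amp z = r" "i \<in> {1..k}" for z i
    unfolding closure_leaf_amp[OF that(1,3)] that(2)
    using C_pos[OF that(3)] C_k \<open>0 < r\<close> by simp
  then have "z \<in> leaf k \<sigma> C" if "z \<in> X" "amp z = r" for z
    using that closure_leaf_amp[OF that(1)] closure_leaf_zero[OF that(1)]
    unfolding leaf_def by blast
  then show ?thesis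
    unfolding hypertorus_def using closure_subset by blast
qed

lemma amp_onto: "amp ` X = {0..}"
proof
  show "{0..} \<subseteq> amp ` X"
  proof
    fix t :: real assume "t \<in> {0..}"
    then have "0 \<le> t" by simp
    let ?z = "\<chi> j. complex_of_real (t * C $ j / C $ \<sigma> k)"
    have "cmod (?z $ \<sigma> i) = C $ \<sigma> i / C $ \<sigma> k * t" if "i \<in> {1..k}" for i
      using C_pos[OF that] C_k \<open>0 \<le> t\<close> by (simp add: abs_mult norm_divide norm_mult)
    moreover have "?z $ \<sigma> i = 0" if "i \<in> {k<..CARD('n)}" for i
      using C_zero[OF that] by simp
    ultimately have "?z \<in> X" "amp ?z = t"
      using closure_leafI[of ?z t] by blast+
    then show "t \<in> amp ` X" by (metis image_eqI)
  qed
qed auto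

text \<open>The difference of the norms bounds the distance from below; the bound is attained at the multiple of \<open>z\<close> that
  lies on the hypertorus, and at any of its points if \<open>z\<close> is the origin.\<close>

lemma infdist_hypertorus:
  assumes "0 < r" "z \<in> X"
  shows "infdist z (hypertorus k \<sigma> C r) = 1 / C $ \<sigma> k * \<bar>amp z - r\<bar>"
proof (rule antisym)
  let ?T = "hypertorus k \<sigma> C r"
  obtain w1 where "w1 \<in> X" "amp w1 = r"
  proof -
    have "r \<in> amp ` X"
      unfolding amp_onto using \<open>0 < r\<close> by simp
    then show ?thesis using that by blast
  qed
  then have w1: "w1 \<in> ?T"
    by (simp add: hypertorus_eq[OF \<open>0 < r\<close>])
  show "1 / C $ \<sigma> k * \<bar>amp z - r\<bar> \<le> infdist z ?T"
  proof -
    have "1 / C $ \<sigma> k * \<bar>amp z - r\<bar> \<le> dist z w" if "w \<in> ?T" for w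
    proof -
      have w: "w \<in> X" "amp w = r"
        using that by (auto simp: hypertorus_eq[OF \<open>0 < r\<close>])
      have "1 / C $ \<sigma> k * \<bar>amp z - r\<bar> = \<bar>norm z - norm w\<bar>"
        using w C_k by (simp add: norm_closure_leaf \<open>z \<in> X\<close> flip: diff_divide_distrib)
      also have "\<dots> \<le> dist z w"
        by (simp add: dist_norm norm_triangle_ineq3)
      finally show ?thesis .
    qed
    then show ?thesis
      using w1 by (auto simp: infdist_def intro!: cINF_greatest)
  qed
  show "infdist z ?T \<le> 1 / C $ \<sigma> k * \<bar>amp z - r\<bar>"
  proof (cases "amp z = 0")
    case True
    then have "norm z = 0"
      using norm_closure_leaf[OF \<open>z \<in> X\<close>] by simp
    then have "dist z w1 = 1 / C $ \<sigma> k * \<bar>amp z - r\<bar>"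
      using True norm_closure_leaf[OF \<open>w1 \<in> X\<close>] \<open>amp w1 = r\<close> \<open>0 < r\<close> by (simp add: dist_norm)
    then show ?thesis
      using infdist_le[OF w1, of z] by simp
  next
    case False
    then have pos: "0 < amp z" by simp
    define w where "w = (r / amp z) *\<^sub>R z"
    have "w \<in> ?T"
      using closure_leaf_scale[OF \<open>z \<in> X\<close>, of "r / amp z"] pos \<open>0 < r\<close>
      by (auto simp: w_def hypertorus_eq[OF \<open>0 < r\<close>])
    have "z - w = (1 - r / amp z) *\<^sub>R z"
      by (simp add: w_def scaleR_left_diff_distrib)
    then have "dist z w = \<bar>1 - r / amp z\<bar> * (1 / C $ \<sigma> k * amp z)"
      by (simp only: dist_norm norm_scaleR norm_closure_leaf[OF \<open>z \<in> X\<close>])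
    also have "\<dots> = 1 / C $ \<sigma> k * (\<bar>1 - r / amp z\<bar> * \<bar>amp z\<bar>)"
      by simp
    also have "\<bar>1 - r / amp z\<bar> * \<bar>amp z\<bar> = \<bar>amp z - r\<bar>"
    proof -
      have "(1 - r / amp z) * amp z = amp z - r"
        using pos by (simp add: left_diff_distrib)
      then show ?thesis by (metis abs_mult)
    qed
    finally show ?thesis
      using infdist_le[OF \<open>w \<in> ?T\<close>, of z] by simp
  qed
qed

lemma infdist_origin: "z \<in> X \<Longrightarrow> infdist z {0} = 1 / C $ \<sigma> k * \<bar>amp z - 0\<bar>"
  by (simp add: norm_closure_leaf)

text \<open>On a connected subset of the leaf that avoids a hypertorus the amplitude stays on one side
  of its radius.\<close>

lemma hypertorus_inside:
  assumes "0 < r1" "r1 < r2"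
  shows "hypertorus k \<sigma> C r1 \<subseteq> inside_in X (hypertorus k \<sigma> C r2)"
proof
  fix x assume x: "x \<in> hypertorus k \<sigma> C r1"
  let ?U = "X - hypertorus k \<sigma> C r2"
  let ?K = "connected_component_set ?U x"
  have r2: "0 < r2" using assms by simp
  have xU: "x \<in> ?U" "amp x = r1"
    using x assms by (auto simp: hypertorus_eq)
  have K: "?K \<subseteq> ?U"
    by (rule connected_component_subset)
  have "is_interval (amp ` ?K)"
    unfolding is_interval_connected_1
    by (intro connected_continuous_image continuous_intros) simp
  moreover have "r1 \<in> amp ` ?K"
    using xU by (metis connected_component_refl_eq imageI mem_Collect_eq)
  moreover have "r2 \<notin> amp ` ?K"
    using K by (auto simp: hypertorus_eq[OF r2])
  ultimately have "amp z < r2" if "z \<in> ?K" for z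
    using that assms mem_is_interval_1_I[of "amp ` ?K" r1 "amp z" r2] by force
  then have "norm z \<le> 1 / C $ \<sigma> k * r2" if "z \<in> ?K" for z
  proof -
    have "z \<in> X" using that K by blast
    then have "norm z = 1 / C $ \<sigma> k * amp z"
      by (rule norm_closure_leaf)
    also have "\<dots> \<le> 1 / C $ \<sigma> k * r2"
      using \<open>\<And>z. z \<in> ?K \<Longrightarrow> amp z < r2\<close>[OF that] C_k by (intro mult_left_mono) auto
    finally show ?thesis .
  qed
  then have "bounded ?K"
    by (intro boundedI)
  then show "x \<in> inside_in X (hypertorus k \<sigma> C r2)"
    using xU by (simp add: inside_in_def)
qed

section \<open>Reduction of the leaf dynamics to the amplitude equation\<close>

lemma leaf_solution_amp:
  assumes "leaf_solution k \<sigma> C A B J z"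
  shows "scalar_solution (\<lambda>x. x * A x) J (\<lambda>t. amp (z t))"
proof -
  obtain \<rho> \<theta> where \<rho>: "\<And>t. t \<in> J \<Longrightarrow> 0 \<le> \<rho> k t \<and> z t $ \<sigma> k = rcis (\<rho> k t) (\<theta> k t) \<and>
        (\<rho> k has_real_derivative \<rho> k t * A (\<rho> k t)) (at t within J)"
    using assms k unfolding leaf_solution_def by (metis atLeastAtMost_iff order_refl)
  have eq: "amp (z t) = \<rho> k t" if "t \<in> J" for t
    using \<rho>[OF that] by simp
  show ?thesis
    unfolding scalar_solution_def
  proof
    fix t assume t: "t \<in> J"
    then show "((\<lambda>t. amp (z t)) has_real_derivative amp (z t) * A (amp (z t))) (at t within J)"
      using \<rho>[OF t] eq
      by (subst has_field_derivative_cong_eventually[where g = "\<rho> k"])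
         (auto simp: eventually_at_filter)
  qed
qed

text \<open>The phases are recovered from the amplitude by integration.\<close>

lemma leaf_solution_lift:
  assumes B: "\<And>i. continuous_on UNIV (B i)"
    and J: "convex J" "closed J" "0 \<in> J"
    and sol: "scalar_solution (\<lambda>x. x * A x) J \<xi>" and "\<xi> ` J \<subseteq> {0..}"
    and z0: "z0 \<in> X" "amp z0 = \<xi> 0"
  shows "\<exists>z. leaf_solution k \<sigma> C A B J z \<and> z 0 = z0 \<and> (\<forall>t\<in>J. amp (z t) = \<xi> t)"
proof -
  obtain g where g: "continuous_on UNIV g" "\<And>t. t \<in> J \<Longrightarrow> g t = \<xi> t"
    using continuous_extension_from_interval[OF J(1,2) _ scalar_solution_continuous[OF sol]] J(3)
    by blast
  have "\<exists>H. (\<forall>t. (H has_real_derivative B i (g t)) (at t)) \<and> H 0 = Arg (z0 $ \<sigma> i)" for i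
  proof -
    have "continuous_on UNIV (\<lambda>t. B i (g t))"
      using continuous_on_compose2[OF B g(1)] by simp
    then obtain H where H: "\<And>t. (H has_real_derivative B i (g t)) (at t)"
      by (rule antiderivative_on_line) blast
    show ?thesis
      by (rule exI[of _ "\<lambda>t. H t - H 0 + Arg (z0 $ \<sigma> i)"]) (auto intro!: derivative_eq_intros H)
  qed
  then obtain \<theta> where \<theta>: "\<And>i t. (\<theta> i has_real_derivative B i (g t)) (at t)"
    "\<And>i. \<theta> i 0 = Arg (z0 $ \<sigma> i)"
    by metis
  define \<rho> where "\<rho> i t = C $ \<sigma> i / C $ \<sigma> k * \<xi> t" for i t
  define z :: "real \<Rightarrow> complex ^ ('n::{finite,linorder})"
    where "z t = (\<chi> j. rcis (\<rho> (inv_into {1..CARD('n)} \<sigma> j) t) (\<theta> (inv_into {1..CARD('n)} \<sigma> j) t))" for t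
  have z: "z t $ \<sigma> i = rcis (\<rho> i t) (\<theta> i t)" if "i \<in> {1..CARD('n)}" for t i
    using bij_betw_inv_into_left[OF bij that] by (simp add: z_def)
  have \<rho>k: "\<rho> k t = \<xi> t" for t
    using C_k by (simp add: \<rho>_def)
  have \<xi>: "0 \<le> \<xi> t" if "t \<in> J" for t
    using \<open>\<xi> ` J \<subseteq> {0..}\<close> that by auto
  have zX: "z t \<in> X" if "t \<in> J" for t
  proof (rule closure_leafI(1))
    show "cmod (z t $ \<sigma> i) = C $ \<sigma> i / C $ \<sigma> k * \<xi> t" if "i \<in> {1..k}" for i
      using z[of i] k that C_pos[OF that] C_k \<xi>[OF \<open>t \<in> J\<close>] by (auto simp: \<rho>_def abs_mult)
    show "z t $ \<sigma> i = 0" if "i \<in> {k<..CARD('n)}" for i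
      using z[of i] that C_zero[OF that] by (simp add: \<rho>_def)
  qed
  have "leaf_solution k \<sigma> C A B J z"
    unfolding leaf_solution_def
  proof (intro conjI ballI exI)
    fix i t assume i: "i \<in> {1..k}" and t: "t \<in> J"
    show "0 \<le> \<rho> i t"
      using C_pos[OF i] C_k \<xi>[OF t] by (simp add: \<rho>_def)
    show "z t $ \<sigma> i = rcis (\<rho> i t) (\<theta> i t)"
      using z i k by auto
    have "(\<xi> has_real_derivative \<xi> t * A (\<xi> t)) (at t within J)"
      using sol t by (simp add: scalar_solution_def)
    then show "(\<rho> i has_real_derivative \<rho> i t * A (\<rho> k t)) (at t within J)"
      unfolding \<rho>k unfolding \<rho>_def using C_k by (auto intro!: derivative_eq_intros)
    show "(\<theta> i has_real_derivative B i (\<rho> k t)) (at t within J)"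
      using \<theta>(1)[of i t] g(2)[OF t] by (simp add: \<rho>k has_field_derivative_at_within)
  qed (rule zX)
  moreover have "z 0 = z0"
  proof -
    have "z 0 $ j = z0 $ j" for j
    proof (rule index_cases[of j])
      fix i assume i: "i \<in> {1..k}" "j = \<sigma> i"
      then have "\<rho> i 0 = cmod (z0 $ \<sigma> i)"
        using closure_leaf_amp[OF z0(1) i(1)] z0(2) by (simp add: \<rho>_def)
      then show ?thesis
        using z[of i 0] i k \<theta>(2)[of i] by (auto simp: rcis_cmod_Arg)
    next
      fix i assume i: "i \<in> {k<..CARD('n)}" "j = \<sigma> i"
      then show ?thesis
        using z[of i 0] closure_leaf_zero[OF z0(1) i(1)] C_zero[OF i(1)] by (auto simp: \<rho>_def)
    qed
    then show ?thesis by (simp add: vec_eq_iff)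
  qed
  moreover have "\<forall>t\<in>J. amp (z t) = \<xi> t"
    using z[of k] k \<xi> \<rho>k by auto
  ultimately show ?thesis by blast
qed

lemma leaf_solution_reverse_iff:
  "leaf_solution k \<sigma> C A B (uminus ` J) (\<lambda>t. z (- t)) \<longleftrightarrow>
    leaf_solution k \<sigma> C (\<lambda>x. - A x) (\<lambda>i x. - B i x) J z"
proof -
  have rev: "leaf_solution k \<sigma> C (\<lambda>x. - A x) (\<lambda>i x. - B i x) (uminus ` I) (\<lambda>t. z (- t))"
    if sol: "leaf_solution k \<sigma> C A B I z" for A B I z
  proof -
    obtain \<rho> \<theta> where \<rho>: "\<And>i t. i \<in> {1..k} \<Longrightarrow> t \<in> I \<Longrightarrow>
        \<rho> i t \<ge> 0 \<and> z t $ \<sigma> i = rcis (\<rho> i t) (\<theta> i t) \<and>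
        (\<rho> i has_real_derivative \<rho> i t * A (\<rho> k t)) (at t within I) \<and>
        (\<theta> i has_real_derivative B i (\<rho> k t)) (at t within I)"
      using sol unfolding leaf_solution_def by blast
    have "\<forall>i\<in>{1..k}. \<forall>t\<in>uminus ` I.
        \<rho> i (- t) \<ge> 0 \<and> z (- t) $ \<sigma> i = rcis (\<rho> i (- t)) (\<theta> i (- t)) \<and>
        ((\<lambda>t. \<rho> i (- t)) has_real_derivative \<rho> i (- t) * - A (\<rho> k (- t))) (at t within uminus ` I) \<and>
        ((\<lambda>t. \<theta> i (- t)) has_real_derivative - B i (\<rho> k (- t))) (at t within uminus ` I)"
    proof (intro ballI)
      fix i t assume i: "i \<in> {1..k}" and t: "t \<in> uminus ` I"
      then have "- t \<in> I" by auto
      from \<rho>[OF i this] DERIV_reverse[OF t, of "\<rho> i"] DERIV_reverse[OF t, of "\<theta> i"]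
      show "\<rho> i (- t) \<ge> 0 \<and> z (- t) $ \<sigma> i = rcis (\<rho> i (- t)) (\<theta> i (- t)) \<and>
        ((\<lambda>t. \<rho> i (- t)) has_real_derivative \<rho> i (- t) * - A (\<rho> k (- t))) (at t within uminus ` I) \<and>
        ((\<lambda>t. \<theta> i (- t)) has_real_derivative - B i (\<rho> k (- t))) (at t within uminus ` I)"
        by simp
    qed
    moreover have "\<forall>t\<in>uminus ` I. z (- t) \<in> X"
      using sol unfolding leaf_solution_def by auto
    ultimately show ?thesis
      unfolding leaf_solution_def
      by (intro conjI exI[of _ "\<lambda>i t. \<rho> i (- t)"] exI[of _ "\<lambda>i t. \<theta> i (- t)"])
  qed
  show ?thesis
  proof
    assume "leaf_solution k \<sigma> C A B (uminus ` J) (\<lambda>t. z (- t))"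
    from rev[OF this] show "leaf_solution k \<sigma> C (\<lambda>x. - A x) (\<lambda>i x. - B i x) J z"
      by (simp add: image_image)
  next
    assume "leaf_solution k \<sigma> C (\<lambda>x. - A x) (\<lambda>i x. - B i x) J z"
    from rev[OF this] show "leaf_solution k \<sigma> C A B (uminus ` J) (\<lambda>t. z (- t))"
      by simp
  qed
qed

end

locale leaf_flow = leaf_geometry k \<sigma> C
  for k :: nat and \<sigma> :: "nat \<Rightarrow> 'n::{finite,linorder}" and C :: "real ^ ('n::{finite,linorder})" +
  fixes A :: "real \<Rightarrow> real" and B :: "nat \<Rightarrow> real \<Rightarrow> real" and F' :: "real \<Rightarrow> real"
  assumes B_cont: "\<And>i. continuous_on UNIV (B i)"
    and A_deriv: "\<And>x. ((\<lambda>x. x * A x) has_real_derivative F' x) (at x)"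
    and A_cont: "continuous_on UNIV F'"
begin

abbreviation "sol \<equiv> leaf_solution k \<sigma> C A B"
abbreviation "T \<equiv> hypertorus k \<sigma> C"

sublocale scalar_reduction X sol amp "\<lambda>x. x * A x" F' "{0..}"
proof
  show "z t \<in> X" if "sol J z" "t \<in> J" for J z t
    using that by (simp add: leaf_solution_def)
  show "\<exists>z. sol J z \<and> z 0 = x \<and> (\<forall>t\<in>J. amp (z t) = \<xi> t)"
    if "convex J" "closed J" "0 \<in> J" "scalar_solution (\<lambda>x. x * A x) J \<xi>" "\<xi> ` J \<subseteq> {0..}"
      "x \<in> X" "amp x = \<xi> 0" for J \<xi> x
    using leaf_solution_lift[OF B_cont that] .
qed (use leaf_solution_amp amp_onto A_deriv A_cont in auto)

lemma reversed: "leaf_flow k \<sigma> C (\<lambda>x. - A x) (\<lambda>i x. - B i x) (\<lambda>x. - F' x)"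
  using A_deriv A_cont B_cont
  by unfold_locales (auto intro: continuous_on_minus DERIV_minus)

lemma torus_invariant:
  assumes "0 < r" "A r = 0"
  shows "flow_invariant sol (T r)"
  unfolding flow_invariant_def
proof (intro allI impI ballI)
  fix J z s t
  assume *: "is_interval J \<and> s \<in> J \<and> sol J z \<and> z s \<in> T r" and t: "t \<in> J"
  then have "amp (z s) = r"
    by (simp add: hypertorus_def)
  then have "amp (z t) = r"
    using equilibrium_unique_C1[OF A_deriv A_cont leaf_solution_amp, of B J z s t] * t \<open>A r = 0\<close> by simp
  moreover have "z t \<in> X"
    using * t in_X by blast
  ultimately show "z t \<in> T r"
    using \<open>0 < r\<close> by (simp add: hypertorus_eq)
qed

lemma torus_stable:
  assumes "0 < r" "A r = 0" "F' r < 0"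
  shows "asymptotically_stable X sol (T r)"
  by (rule asymptotically_stable_if[of "1 / C $ \<sigma> k" _ r])
    (use assms C_k infdist_hypertorus[OF \<open>0 < r\<close>] in auto)

lemma torus_unstable:
  assumes "0 < r" "A r = 0" "0 < F' r"
  shows "\<not> lyapunov_stable sol (T r)"
  by (rule unstable_if[of "1 / C $ \<sigma> k" _ r])
    (use assms C_k infdist_hypertorus[OF \<open>0 < r\<close>] in auto)

lemma origin_stable:
  assumes "F' 0 < 0"
  shows "asymptotically_stable X sol {0}"
  by (rule asymptotically_stable_if[of "1 / C $ \<sigma> k" _ 0])
    (use assms C_k infdist_origin in auto)

lemma origin_unstable:
  assumes "0 < F' 0"
  shows "\<not> lyapunov_stable sol {0}"
  by (rule unstable_if[of "1 / C $ \<sigma> k" _ 0])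
    (use assms C_k infdist_origin in auto)

lemma torus_repelling:
  assumes "0 < r" "A r = 0" "0 < F' r"
  shows "repelling X sol (T r)"
proof -
  interpret rev: leaf_flow k \<sigma> C "\<lambda>x. - A x" "\<lambda>i x. - B i x" "\<lambda>x. - F' x"
    by (rule reversed)
  show ?thesis
    unfolding repelling_def leaf_solution_reverse_iff
    by (rule rev.torus_stable) (use assms in auto)
qed

end

section \<open>Bifurcations of the positive roots of the amplitude equation\<close>

lemma limit_point_of_closure_interior:
  fixes x :: "'a::euclidean_space"
  assumes "x \<in> closure (interior D)"
  shows "at x within D \<noteq> bot"
proof -
  have "x islimpt interior D"
    using assms by (metis closure_def UnE mem_Collect_eq interior_limit_point interior_interior interior_subset subsetD)
  then show ?thesis
    using islimpt_subset[OF _ interior_subset] trivial_limit_within by blast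
qed

lemma mem_closure_of_ray:
  fixes p q :: "'a::real_normed_vector"
  assumes "\<And>t. 0 < t \<Longrightarrow> p + t *\<^sub>R q \<in> S"
  shows "p \<in> closure S"
proof -
  have "((\<lambda>t. p + t *\<^sub>R q) \<longlongrightarrow> p + 0 *\<^sub>R q) (at_right 0)"
    by (intro tendsto_intros)
  moreover have "\<forall>\<^sub>F t in at_right 0. p + t *\<^sub>R q \<in> closure S"
    using eventually_at_right_less[of 0]
    by eventually_elim (use assms closure_subset in blast)
  ultimately have "p + 0 *\<^sub>R q \<in> closure S"
    by (intro Lim_in_closed_set[OF closed_closure]) auto
  then show ?thesis by simp
qed

text \<open>Continuity and openness of the map from the parameters to \<open>(a0, a1)\<close> are the only link between the two;
  \<open>R \<mu>\<close> are the radii at \<open>\<mu>\<close>.\<close>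

locale amplitude_family =
  fixes V :: "'m::euclidean_space set" and a0 a1 :: "'m \<Rightarrow> real" and a2 :: real and R :: "'m \<Rightarrow> real set"
  assumes V: "open V" and a2: "a2 \<noteq> 0"
    and R_iff: "\<mu> \<in> V \<Longrightarrow> r \<in> R \<mu> \<longleftrightarrow> 0 < r \<and> a0 \<mu> + a1 \<mu> * r\<^sup>2 + a2 * r ^ 4 = 0"
    and cont: "continuous_on V (\<lambda>\<mu>. (a0 \<mu>, a1 \<mu>))"
    and open_map: "open W \<Longrightarrow> W \<subseteq> V \<Longrightarrow> open ((\<lambda>\<mu>. (a0 \<mu>, a1 \<mu>)) ` W)"
begin

lemma cont_a: "continuous_on V a0" "continuous_on V a1"
  using continuous_on_fst[OF cont] continuous_on_snd[OF cont] by simp_all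

lemma tendsto_a:
  assumes "\<mu>0 \<in> V" "D \<subseteq> V"
  shows "(a0 \<longlongrightarrow> a0 \<mu>0) (at \<mu>0 within D)" "(a1 \<longlongrightarrow> a1 \<mu>0) (at \<mu>0 within D)"
  using cont_a assms unfolding continuous_on_def by (blast intro: tendsto_within_subset)+

lemma open_preimage:
  assumes "open W" "W \<subseteq> V" "open S"
  shows "open {\<mu>\<in>W. (a0 \<mu>, a1 \<mu>) \<in> S}"
  using continuous_open_preimage[OF continuous_on_subset[OF cont assms(2)] assms(1,3)]
  by (simp add: vimage_def Int_def)

text \<open>If a neighbourhood of \<open>\<mu>0\<close> missed the preimage of \<open>S\<close>, then its image would be an open set that contains a
  point of the closure of \<open>S\<close> but no point of \<open>S\<close>.\<close>

lemma closure_interior_preimage: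
  assumes W: "open W" "\<mu>0 \<in> W" "W \<subseteq> V" and "open S" "(a0 \<mu>0, a1 \<mu>0) \<in> closure S"
    and sub: "\<And>\<mu>. \<mu> \<in> W \<Longrightarrow> (a0 \<mu>, a1 \<mu>) \<in> S \<Longrightarrow> \<mu> \<in> D"
  shows "\<mu>0 \<in> closure (interior D)"
proof (rule ccontr)
  let ?\<nu> = "\<lambda>\<mu>. (a0 \<mu>, a1 \<mu>)"
  define U where "U = W - closure (interior D)"
  assume "\<not> ?thesis"
  then have "?\<nu> \<mu>0 \<in> ?\<nu> ` U"
    using W by (auto simp: U_def)
  moreover have "open (?\<nu> ` U)"
    using W by (intro open_map) (auto simp: U_def)
  ultimately obtain \<mu> where \<mu>: "\<mu> \<in> U" "?\<nu> \<mu> \<in> S"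
    using \<open>?\<nu> \<mu>0 \<in> closure S\<close> open_Int_closure_eq_empty[of "?\<nu> ` U" S] by blast
  have "{\<mu>\<in>W. ?\<nu> \<mu> \<in> S} \<subseteq> interior D"
    using sub by (intro interior_maximal open_preimage W \<open>open S\<close>) auto
  then have "\<mu> \<in> closure (interior D)"
    using \<mu> closure_subset by (auto simp: U_def)
  then show False using \<mu> by (simp add: U_def)
qed

text \<open>For small \<open>r\<close> the factor \<open>a1 + a2 * r\<^sup>2\<close> keeps the sign of \<open>a1\<close>, hence
  \<open>a0 = - r\<^sup>2 * (a1 + a2 * r\<^sup>2)\<close> has exactly one small positive solution on one side of \<open>a0 = 0\<close> and
  none on the other side.\<close>

lemma bifurcates_from_originI:
  assumes \<mu>0: "\<mu>0 \<in> V" "a0 \<mu>0 = 0" "a1 \<mu>0 \<noteq> 0"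
    and P: "\<And>\<mu> r. \<mu> \<in> V \<Longrightarrow> r \<in> R \<mu> \<Longrightarrow> 0 < a1 \<mu>0 * (a1 \<mu> + 2 * a2 * r\<^sup>2) \<Longrightarrow> P \<mu> r"
  shows "bifurcates_from_origin V R P \<mu>0"
proof -
  define c where "c = \<bar>a1 \<mu>0\<bar>"
  define s where "s = sgn (a1 \<mu>0)"
  have c: "c > 0" and s: "s * a1 \<mu>0 = c" "s * s = 1" "\<bar>s\<bar> = 1" "a1 \<mu>0 = c * s"
    using \<mu>0(3) by (auto simp: c_def s_def sgn_if)
  \<comment> \<open>for \<open>0 \<le> u \<le> \<epsilon>\<^sup>2\<close> the term \<open>a2 * u\<close> is at most a quarter of \<open>c\<close>\<close>
  define \<epsilon> where "\<epsilon> = sqrt (c / (4 * \<bar>a2\<bar>))"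
  have \<epsilon>: "\<epsilon> > 0" "\<bar>a2\<bar> * \<epsilon>\<^sup>2 = c / 4"
    using c a2 by (auto simp: \<epsilon>_def)
  define W where "W = {\<mu>\<in>V. (a0 \<mu>, a1 \<mu>) \<in> {p. \<bar>fst p\<bar> < \<epsilon>\<^sup>2 * (c / 2)} \<inter> {p. 3 / 4 * c < s * snd p}}"
  have "open W"
    unfolding W_def
    by (intro open_preimage V order_refl open_Int open_Collect_less continuous_intros)
  have WV: "W \<subseteq> V" by (auto simp: W_def)
  have "\<mu>0 \<in> W"
    using \<mu>0 c \<epsilon> s by (simp add: W_def)
  have W: "\<bar>a0 \<mu>\<bar> < \<epsilon>\<^sup>2 * (c / 2)" "3 / 4 * c < s * a1 \<mu>" if "\<mu> \<in> W" for \<mu>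
    using that by (auto simp: W_def)
  have slope: "c / 4 \<le> s * (a1 \<mu> + j * a2 * u)" "j = 1 \<Longrightarrow> c / 2 \<le> s * (a1 \<mu> + j * a2 * u)"
    if "\<mu> \<in> W" "0 \<le> u" "u \<le> \<epsilon>\<^sup>2" "j \<in> {1, 2}" for \<mu> u j
  proof -
    have "\<bar>s * (a2 * u)\<bar> \<le> \<bar>a2\<bar> * \<epsilon>\<^sup>2"
      using that s by (simp add: abs_mult mult_left_mono)
    then have "\<bar>s * (a2 * u)\<bar> \<le> c / 4"
      using \<epsilon>(2) by simp
    moreover have "s * (a1 \<mu> + j * a2 * u) = s * a1 \<mu> + j * (s * (a2 * u))"
      by (simp add: algebra_simps)
    ultimately show "c / 4 \<le> s * (a1 \<mu> + j * a2 * u)" "j = 1 \<Longrightarrow> c / 2 \<le> s * (a1 \<mu> + j * a2 * u)"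
      using W(2)[OF that(1)] that(4) by (auto simp: abs_le_iff)
  qed
  have W_iff: "r \<in> R \<mu> \<longleftrightarrow> 0 < r \<and> a0 \<mu> + a1 \<mu> * r\<^sup>2 + a2 * r ^ 4 = 0" if "\<mu> \<in> W" for \<mu> r
    using R_iff that WV by blast
  have sq: "r\<^sup>2 \<le> \<epsilon>\<^sup>2" "0 \<le> r\<^sup>2" if "\<mu> \<in> W" "r \<in> R \<mu>" "r < \<epsilon>" for r \<mu>
    using that by (auto simp: W_iff intro: power_mono)
  have root: "r\<^sup>2 * (c / 2) \<le> - s * a0 \<mu>" "s * a0 \<mu> < 0" if "\<mu> \<in> W" "r \<in> R \<mu>" "r < \<epsilon>" for \<mu> r
  proof -
    have "- s * a0 \<mu> = r\<^sup>2 * (s * (a1 \<mu> + 1 * a2 * r\<^sup>2))"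
    proof -
      have "a0 \<mu> = - (r\<^sup>2 * (a1 \<mu> + a2 * r\<^sup>2))"
        using that(1,2) by (simp add: W_iff algebra_simps power4_eq_xxxx power2_eq_square)
      then have "- s * a0 \<mu> = - s * - (r\<^sup>2 * (a1 \<mu> + a2 * r\<^sup>2))" by (rule arg_cong)
      then show ?thesis by (simp add: algebra_simps)
    qed
    also have "\<dots> \<ge> r\<^sup>2 * (c / 2)"
      using slope(2)[OF that(1) sq(2,1)[OF that], of 1] by (intro mult_left_mono) auto
    finally show "r\<^sup>2 * (c / 2) \<le> - s * a0 \<mu>" .
    moreover have "0 < r\<^sup>2 * (c / 2)"
      using that c by (auto simp: W_iff)
    ultimately show "s * a0 \<mu> < 0" by linarith
  qed
  have ex: "\<exists>r\<in>R \<mu>. r < \<epsilon>" if "\<mu> \<in> W" "s * a0 \<mu> < 0" for \<mu>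
  proof -
    define Q where "Q u = s * (a0 \<mu> + a1 \<mu> * u + a2 * u\<^sup>2)" for u
    have "Q 0 < 0" using that by (simp add: Q_def)
    have "Q (\<epsilon>\<^sup>2) = s * a0 \<mu> + \<epsilon>\<^sup>2 * (s * (a1 \<mu> + 1 * a2 * \<epsilon>\<^sup>2))"
      by (simp add: Q_def algebra_simps power2_eq_square)
    moreover have "\<epsilon>\<^sup>2 * (c / 2) \<le> \<epsilon>\<^sup>2 * (s * (a1 \<mu> + 1 * a2 * \<epsilon>\<^sup>2))"
      using slope(2)[OF that(1), of "\<epsilon>\<^sup>2" 1] by (intro mult_left_mono) auto
    moreover have "\<bar>s * a0 \<mu>\<bar> < \<epsilon>\<^sup>2 * (c / 2)"
      using W(1)[OF that(1)] s by (simp add: abs_mult)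
    ultimately have "0 < Q (\<epsilon>\<^sup>2)" by linarith
    then obtain u where u: "0 \<le> u" "u \<le> \<epsilon>\<^sup>2" "Q u = 0"
      using IVT'[of Q 0 0 "\<epsilon>\<^sup>2"] \<open>Q 0 < 0\<close>
      unfolding Q_def by (force intro!: continuous_intros)
    have "u \<noteq> 0" "u \<noteq> \<epsilon>\<^sup>2"
      using \<open>Q 0 < 0\<close> \<open>0 < Q (\<epsilon>\<^sup>2)\<close> u(3) by auto
    then have "0 < sqrt u" "sqrt u < \<epsilon>"
      using u \<epsilon> by (auto intro: real_less_lsqrt)
    moreover have "sqrt u ^ 4 = u\<^sup>2"
      using u(1) by (metis power2_eq_square power4_eq_xxxx power_mult_numeral real_sqrt_pow2 mult.assoc)
    ultimately have "sqrt u \<in> R \<mu>"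
      using u s that(1) by (auto simp: W_iff Q_def)
    then show ?thesis using \<open>sqrt u < \<epsilon>\<close> by blast
  qed
  have unique: "r = r'" if "\<mu> \<in> W" "r \<in> R \<mu>" "r' \<in> R \<mu>" "r < \<epsilon>" "r' < \<epsilon>" for \<mu> r r'
  proof (rule ccontr)
    assume "r \<noteq> r'"
    have "(r\<^sup>2 - r'\<^sup>2) * (a1 \<mu> + a2 * (r\<^sup>2 + r'\<^sup>2)) = 0"
    proof -
      have "a0 \<mu> + a1 \<mu> * r\<^sup>2 + a2 * r ^ 4 = 0" "a0 \<mu> + a1 \<mu> * r'\<^sup>2 + a2 * r' ^ 4 = 0"
        using that(1-3) by (auto simp: W_iff)
      then show ?thesis by algebra
    qed
    moreover have "r\<^sup>2 \<noteq> r'\<^sup>2"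
      using that \<open>r \<noteq> r'\<close> by (auto simp: W_iff power2_eq_iff)
    ultimately have "a1 \<mu> + 2 * a2 * ((r\<^sup>2 + r'\<^sup>2) / 2) = 0" by simp
    then show False
      using slope(1)[OF that(1), of "(r\<^sup>2 + r'\<^sup>2) / 2" 2] sq[OF that(1,2,4)] sq[OF that(1,3,5)] c by simp
  qed
  define D where "D = {\<mu>\<in>W. R \<mu> \<inter> {..<\<epsilon>} \<noteq> {}}"
  have D: "D = {\<mu>\<in>W. s * a0 \<mu> < 0}"
    using root(2) ex by (fastforce simp: D_def)
  define r where "r \<mu> = the_elem (R \<mu> \<inter> {..<\<epsilon>})" for \<mu>
  have r: "R \<mu> \<inter> {..<\<epsilon>} = {r \<mu>}" if "\<mu> \<in> D" for \<mu>
  proof -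
    obtain x where "x \<in> R \<mu> \<inter> {..<\<epsilon>}"
      using \<open>\<mu> \<in> D\<close> by (auto simp: D_def)
    then have "R \<mu> \<inter> {..<\<epsilon>} = {x}"
      using unique[of \<mu> x] \<open>\<mu> \<in> D\<close> by (auto simp: D_def)
    then show ?thesis by (simp add: r_def)
  qed
  then have r': "r \<mu> \<in> R \<mu>" "r \<mu> < \<epsilon>" if "\<mu> \<in> D" for \<mu>
    using that by blast+
  have "P \<mu> (r \<mu>)" if "\<mu> \<in> D" for \<mu>
  proof (rule P)
    have "\<mu> \<in> W" using that by (simp add: D)
    then show "\<mu> \<in> V" using WV by blast
    have "0 < s * (a1 \<mu> + 2 * a2 * (r \<mu>)\<^sup>2)"
      using slope(1)[OF \<open>\<mu> \<in> W\<close> sq(2,1)[OF \<open>\<mu> \<in> W\<close> r'[OF that]], of 2] c by simp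
    with c have "0 < c * (s * (a1 \<mu> + 2 * a2 * (r \<mu>)\<^sup>2))"
      by (rule mult_pos_pos)
    then show "0 < a1 \<mu>0 * (a1 \<mu> + 2 * a2 * (r \<mu>)\<^sup>2)"
      using s(4) by (simp add: mult.assoc)
  qed (rule r'[OF that])
  moreover have "(r \<longlongrightarrow> 0) (at \<mu>0 within D)"
  proof (rule Lim_null_comparison)
    show "\<forall>\<^sub>F \<mu> in at \<mu>0 within D. norm (r \<mu>) \<le> sqrt (\<bar>a0 \<mu>\<bar> / (c / 2))"
      unfolding eventually_at_filter
    proof (intro always_eventually allI impI)
      fix \<mu> assume "\<mu> \<in> D"
      then have "(r \<mu>)\<^sup>2 * (c / 2) \<le> - s * a0 \<mu>"
        using root(1)[of \<mu> "r \<mu>"] r' by (simp add: D)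
      also have "\<dots> \<le> \<bar>a0 \<mu>\<bar>"
        using s(3) by (metis abs_ge_self abs_minus_cancel abs_mult mult_1)
      finally have "(r \<mu>)\<^sup>2 \<le> \<bar>a0 \<mu>\<bar> / (c / 2)"
        using c by (subst pos_le_divide_eq) auto
      then show "norm (r \<mu>) \<le> sqrt (\<bar>a0 \<mu>\<bar> / (c / 2))"
        by (simp add: real_le_rsqrt)
    qed
    have "((\<lambda>\<mu>. sqrt (\<bar>a0 \<mu>\<bar> / (c / 2))) \<longlongrightarrow> sqrt (\<bar>a0 \<mu>0\<bar> / (c / 2))) (at \<mu>0 within D)"
      using WV c by (intro tendsto_intros tendsto_a \<mu>0) (auto simp: D)
    then show "((\<lambda>\<mu>. sqrt (\<bar>a0 \<mu>\<bar> / (c / 2))) \<longlongrightarrow> 0) (at \<mu>0 within D)"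
      using \<mu>0(2) by simp
  qed
  moreover have "\<mu>0 \<in> closure (interior D)"
  proof (rule closure_interior_preimage[OF \<open>open W\<close> \<open>\<mu>0 \<in> W\<close> WV])
    show "open {p. s * fst p < 0}" for p :: "real \<times> real"
      by (intro open_Collect_less continuous_intros)
    show "(a0 \<mu>0, a1 \<mu>0) \<in> closure {p. s * fst p < 0}"
      by (rule mem_closure_of_ray[where q = "(- s, 0)"]) (use \<mu>0 s in \<open>auto simp: mult.left_commute\<close>)
  qed (auto simp: D)
  moreover have "\<mu>0 \<in> closure (interior (W - D))"
  proof (rule closure_interior_preimage[OF \<open>open W\<close> \<open>\<mu>0 \<in> W\<close> WV])
    show "open {p. 0 < s * fst p}" for p :: "real \<times> real"
      by (intro open_Collect_less continuous_intros)
    show "(a0 \<mu>0, a1 \<mu>0) \<in> closure {p. 0 < s * fst p}"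
      by (rule mem_closure_of_ray[where q = "(s, 0)"]) (use \<mu>0 s in \<open>auto simp: mult.left_commute\<close>)
  qed (auto simp: D)
  ultimately show ?thesis
    unfolding bifurcates_from_origin_def Let_def
    using \<open>open W\<close> \<open>\<mu>0 \<in> W\<close> WV \<epsilon>(1) r
    by (intro exI[of _ \<epsilon>] conjI exI[of _ W] exI[of _ r]) (auto simp flip: D_def)
qed

text \<open>A root that tends to zero forces \<open>a0 = 0\<close>.  At \<open>a0 = a1 = 0\<close> the open map reaches the
  coefficients of \<open>a2 * (r\<^sup>2 - u) * (r\<^sup>2 - 2 * u)\<close> with arbitrarily small \<open>u > 0\<close>, which have two small
  roots.\<close>

lemma bifurcates_from_originD:
  assumes "bifurcates_from_origin V R P \<mu>0" and \<mu>0: "\<mu>0 \<in> V"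
  obtains \<mu> r where "a0 \<mu>0 = 0" "a1 \<mu>0 \<noteq> 0" "\<mu> \<in> V" "r \<in> R \<mu>" "P \<mu> r"
    "0 < a1 \<mu>0 * (a1 \<mu> + 2 * a2 * r\<^sup>2)"
proof -
  obtain \<epsilon> W r where "\<epsilon> > 0" and W: "open W" "\<mu>0 \<in> W" "W \<subseteq> V"
    and bif: "let D = {\<mu>\<in>W. R \<mu> \<inter> {..<\<epsilon>} \<noteq> {}} in
         \<mu>0 \<in> closure (interior D) \<and> \<mu>0 \<in> closure (interior (W - D)) \<and>
         (\<forall>\<mu>\<in>D. R \<mu> \<inter> {..<\<epsilon>} = {r \<mu>} \<and> P \<mu> (r \<mu>)) \<and>
         (r \<longlongrightarrow> 0) (at \<mu>0 within D)"
    using assms(1) unfolding bifurcates_from_origin_def by blast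
  define D where "D = {\<mu>\<in>W. R \<mu> \<inter> {..<\<epsilon>} \<noteq> {}}"
  have cl: "\<mu>0 \<in> closure (interior D)"
    and D: "\<And>\<mu>. \<mu> \<in> D \<Longrightarrow> R \<mu> \<inter> {..<\<epsilon>} = {r \<mu>}" "\<And>\<mu>. \<mu> \<in> D \<Longrightarrow> P \<mu> (r \<mu>)"
    and r0: "(r \<longlongrightarrow> 0) (at \<mu>0 within D)"
    using bif unfolding Let_def D_def[symmetric] by auto
  have nontriv: "at \<mu>0 within D \<noteq> bot"
    by (rule limit_point_of_closure_interior[OF cl])
  have DV: "D \<subseteq> V" using W by (auto simp: D_def)
  note lim = tendsto_a[OF \<mu>0 DV]
  have inD: "\<forall>\<^sub>F \<mu> in at \<mu>0 within D. \<mu> \<in> D"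
    by (simp add: eventually_at_filter)
  have rD: "r \<mu> \<in> R \<mu>" if "\<mu> \<in> D" for \<mu>
    using D(1)[OF that] by blast
  have a0: "a0 \<mu>0 = 0"
  proof (rule tendsto_unique[OF nontriv lim(1)])
    have "((\<lambda>\<mu>. - (a1 \<mu> * (r \<mu>)\<^sup>2 + a2 * (r \<mu>) ^ 4)) \<longlongrightarrow> - (a1 \<mu>0 * 0\<^sup>2 + a2 * 0 ^ 4)) (at \<mu>0 within D)"
      by (intro tendsto_intros lim r0)
    moreover have "\<forall>\<^sub>F \<mu> in at \<mu>0 within D. - (a1 \<mu> * (r \<mu>)\<^sup>2 + a2 * (r \<mu>) ^ 4) = a0 \<mu>"
      using inD by eventually_elim (use rD DV R_iff in force)
    ultimately show "(a0 \<longlongrightarrow> 0) (at \<mu>0 within D)"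
      by (simp add: tendsto_cong)
  qed
  have a1: "a1 \<mu>0 \<noteq> 0"
  proof
    assume "a1 \<mu>0 = 0"
    have "((\<lambda>u. (2 * a2 * u\<^sup>2, - 3 * a2 * u)) \<longlongrightarrow> (2 * a2 * 0\<^sup>2, - 3 * a2 * 0)) (at_right 0)"
      by (intro tendsto_intros)
    moreover have "open ((\<lambda>\<mu>. (a0 \<mu>, a1 \<mu>)) ` W)"
      by (rule open_map[OF W(1,3)])
    moreover have "(2 * a2 * 0\<^sup>2, - 3 * a2 * 0) \<in> (\<lambda>\<mu>. (a0 \<mu>, a1 \<mu>)) ` W"
      using W(2) a0 \<open>a1 \<mu>0 = 0\<close> by force
    ultimately have "\<forall>\<^sub>F u in at_right 0. (2 * a2 * u\<^sup>2, - 3 * a2 * u) \<in> (\<lambda>\<mu>. (a0 \<mu>, a1 \<mu>)) ` W"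
      by (rule topological_tendstoD)
    moreover have "\<forall>\<^sub>F u in at_right 0. 0 < u \<and> u < \<epsilon>\<^sup>2 / 2"
      using eventually_at_right_less[of 0] order_tendstoD(2)[OF tendsto_ident_at, of 0 "\<epsilon>\<^sup>2 / 2"] \<open>\<epsilon> > 0\<close>
      by (auto intro: eventually_conj)
    ultimately obtain u where elim: "(2 * a2 * u\<^sup>2, - 3 * a2 * u) \<in> (\<lambda>\<mu>. (a0 \<mu>, a1 \<mu>)) ` W" "0 < u \<and> u < \<epsilon>\<^sup>2 / 2"
      using eventually_happens[OF eventually_conj] trivial_limit_at_right_real by blast
    then obtain \<mu> where \<mu>: "\<mu> \<in> W" "a0 \<mu> = 2 * a2 * u\<^sup>2" "a1 \<mu> = - 3 * a2 * u" by auto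
    have mem: "sqrt w \<in> R \<mu> \<inter> {..<\<epsilon>}" if "w = u \<or> w = 2 * u" for w
    proof -
      have w: "0 < w" using that elim by auto
      have "(sqrt w)\<^sup>2 = w" "sqrt w ^ 4 = w\<^sup>2"
        using w by (simp_all add: power4_eq_xxxx power2_eq_square mult.assoc[symmetric])
      moreover have "a0 \<mu> + a1 \<mu> * w + a2 * w\<^sup>2 = 0"
        using that by (auto simp: \<mu>(2,3) algebra_simps power2_eq_square)
      moreover have "sqrt w < \<epsilon>"
        using that elim \<open>\<epsilon> > 0\<close> by (auto intro!: real_less_lsqrt)
      ultimately show ?thesis
        using w \<mu>(1) W(3) R_iff by auto
    qed
    then have "\<mu> \<in> D"
      using \<mu>(1) by (auto simp: D_def)
    then have "sqrt u = sqrt (2 * u)"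
    proof -
      have "sqrt u \<in> {r \<mu>}" "sqrt (2 * u) \<in> {r \<mu>}"
        using mem[of u] mem[of "2 * u"] unfolding D(1)[OF \<open>\<mu> \<in> D\<close>] by simp_all
      then show ?thesis by simp
    qed
    then show False using elim by simp
  qed
  have "((\<lambda>\<mu>. a1 \<mu>0 * (a1 \<mu> + 2 * a2 * (r \<mu>)\<^sup>2)) \<longlongrightarrow> a1 \<mu>0 * (a1 \<mu>0 + 2 * a2 * 0\<^sup>2)) (at \<mu>0 within D)"
    by (intro tendsto_intros lim r0)
  then have "\<forall>\<^sub>F \<mu> in at \<mu>0 within D. 0 < a1 \<mu>0 * (a1 \<mu> + 2 * a2 * (r \<mu>)\<^sup>2)"
    by (rule order_tendstoD(1)) (use a1 in \<open>auto simp: zero_less_mult_iff\<close>)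
  then have "\<exists>\<mu>. \<mu> \<in> D \<and> 0 < a1 \<mu>0 * (a1 \<mu> + 2 * a2 * (r \<mu>)\<^sup>2)"
    using inD nontriv by (metis (mono_tags, lifting) eventually_conj eventually_happens)
  then show ?thesis
    using that a0 a1 rD D(2) DV by blast
qed


text \<open>The quadratic in \<open>u = r\<^sup>2\<close> is \<open>a2 * ((u - vertex)\<^sup>2 - gap)\<close>.\<close>

definition vertex :: "'m \<Rightarrow> real" where "vertex \<mu> = - (a1 \<mu> / (2 * a2))"
definition gap :: "'m \<Rightarrow> real" where "gap \<mu> = (vertex \<mu>)\<^sup>2 - a0 \<mu> / a2"

lemma quadratic_eq: "a0 \<mu> + a1 \<mu> * u + a2 * u\<^sup>2 = a2 * ((u - vertex \<mu>)\<^sup>2 - gap \<mu>)"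
  using a2 by (simp add: vertex_def gap_def field_simps power2_eq_square)

lemma quartic_eq: "a0 \<mu> + a1 \<mu> * x\<^sup>2 + a2 * x ^ 4 = a2 * ((x\<^sup>2 - vertex \<mu>)\<^sup>2 - gap \<mu>)"
  using quadratic_eq[of \<mu> "x\<^sup>2"] by simp

lemma quartic_zero_iff: "a0 \<mu> + a1 \<mu> * x\<^sup>2 + a2 * x ^ 4 = 0 \<longleftrightarrow> (x\<^sup>2 - vertex \<mu>)\<^sup>2 = gap \<mu>"
  unfolding quartic_eq using a2 by simp

lemma slope_eq: "a1 \<mu> + 2 * a2 * u = 2 * a2 * (u - vertex \<mu>)"
  using a2 by (simp add: vertex_def field_simps)

lemma T_2SD_iff: "(a0 \<mu>, a1 \<mu>) \<in> T_2SD a2 \<longleftrightarrow> gap \<mu> = 0 \<and> 0 < vertex \<mu>"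
proof -
  have "0 < vertex \<mu> \<longleftrightarrow> a2 * a1 \<mu> < 0"
    using a2 by (auto simp: vertex_def divide_less_0_iff mult_less_0_iff)
  then show ?thesis
    by (simp add: T_2SD_def gap_def vertex_def power_divide)
qed

lemma tendsto_vertex_gap:
  assumes "\<mu>0 \<in> V" "D \<subseteq> V"
  shows "(vertex \<longlongrightarrow> vertex \<mu>0) (at \<mu>0 within D)" "(gap \<longlongrightarrow> gap \<mu>0) (at \<mu>0 within D)"
proof -
  note lim = tendsto_a[OF assms]
  have "2 * a2 \<noteq> 0" using a2 by simp
  then show v: "(vertex \<longlongrightarrow> vertex \<mu>0) (at \<mu>0 within D)"
    unfolding vertex_def by (intro tendsto_minus tendsto_divide lim tendsto_const)
  show "(gap \<longlongrightarrow> gap \<mu>0) (at \<mu>0 within D)"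
    unfolding gap_def by (intro tendsto_diff tendsto_power tendsto_divide v lim tendsto_const a2)
qed

text \<open>Near the fold the squared radii are \<open>vertex \<plusminus> sqrt gap\<close>, with the slope of the quadratic of
  opposite signs.  The sign \<open>e\<close> selects one of the two symmetric saddle-node points.\<close>

lemma saddle_node_bifurcationI:
  assumes \<mu>0: "\<mu>0 \<in> V" "gap \<mu>0 = 0" "0 < vertex \<mu>0" and e: "e \<in> {1, - 1}"
    and Z: "\<And>\<mu> x. \<mu> \<in> V \<Longrightarrow> 0 < e * x \<Longrightarrow> x \<in> Z \<mu> \<longleftrightarrow> (x\<^sup>2 - vertex \<mu>)\<^sup>2 = gap \<mu>"
    and Q: "\<And>\<mu> x y. \<mu> \<in> V \<Longrightarrow> 0 < e * x \<Longrightarrow> 0 < e * y \<Longrightarrow> x \<in> Z \<mu> \<Longrightarrow> y \<in> Z \<mu> \<Longrightarrow>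
      a2 * (x\<^sup>2 - vertex \<mu>) < 0 \<Longrightarrow> 0 < a2 * (y\<^sup>2 - vertex \<mu>) \<Longrightarrow> Q \<mu> x y"
  shows "saddle_node_bifurcation V Z Q \<mu>0 (e * sqrt (vertex \<mu>0))"
proof -
  have e': "e * e = 1" "\<bar>e\<bar> = 1" using e by auto
  define r0 where "r0 = sqrt (vertex \<mu>0)"
  define x0 where "x0 = e * r0"
  have r0: "0 < r0" "r0\<^sup>2 = vertex \<mu>0"
    using \<mu>0 by (auto simp: r0_def)
  \<comment> \<open>the ball must stay on one side of zero\<close>
  define \<epsilon> where "\<epsilon> = r0 / 2"
  have "0 < \<epsilon>" using r0 by (simp add: \<epsilon>_def)
  have side: "0 < e * x" if "x \<in> ball x0 \<epsilon>" for x
  proof -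
    have "e * (x - x0) \<ge> - \<bar>x - x0\<bar>"
      using e by (auto simp: abs_if)
    moreover have "e * x0 = r0"
      using e by (auto simp: x0_def)
    moreover have "\<bar>x - x0\<bar> < r0 / 2"
      using that by (simp add: \<epsilon>_def dist_real_def abs_minus_commute)
    ultimately show ?thesis
      using r0(1) by (simp add: algebra_simps)
  qed
  \<comment> \<open>\<open>w \<mu> / r0\<close> bounds the distance of the zeros at \<open>\<mu>\<close> from \<open>x0\<close>\<close>
  define w where "w \<mu> = \<bar>vertex \<mu> - vertex \<mu>0\<bar> + sqrt \<bar>gap \<mu>\<bar>" for \<mu>
  have near: "\<bar>x - x0\<bar> \<le> w \<mu> / r0" if "0 < e * x" "(x\<^sup>2 - vertex \<mu>)\<^sup>2 = gap \<mu>" for x \<mu>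
  proof -
    have "\<bar>x\<^sup>2 - vertex \<mu>\<bar> = sqrt \<bar>gap \<mu>\<bar>"
      using that(2) by (metis abs_power2 real_sqrt_abs)
    then have "\<bar>x\<^sup>2 - r0\<^sup>2\<bar> \<le> w \<mu>"
      unfolding r0(2) w_def by linarith
    moreover have "x\<^sup>2 - r0\<^sup>2 = (e * x - r0) * (e * x + r0)"
      using e by (auto simp: power2_eq_square algebra_simps)
    moreover have "\<bar>e * x - r0\<bar> * r0 \<le> \<bar>(e * x - r0) * (e * x + r0)\<bar>"
      using that(1) r0(1) unfolding abs_mult by (intro mult_left_mono) auto
    moreover have "\<bar>e * x - r0\<bar> = \<bar>x - x0\<bar>"
      using e by (auto simp: x0_def)
    ultimately have "\<bar>x - x0\<bar> * r0 \<le> w \<mu>" by simp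
    then show ?thesis
      using r0(1) by (subst pos_le_divide_eq) auto
  qed
  have w_lim: "(w \<longlongrightarrow> 0) (at \<mu>0 within D)" if "D \<subseteq> V" for D
  proof -
    have "(w \<longlongrightarrow> \<bar>vertex \<mu>0 - vertex \<mu>0\<bar> + sqrt \<bar>gap \<mu>0\<bar>) (at \<mu>0 within D)"
      unfolding w_def by (intro tendsto_intros tendsto_vertex_gap[OF \<mu>0(1) that])
    then show ?thesis using \<mu>0(2) by simp
  qed
  define W where "W = {\<mu>\<in>V. w \<mu> < r0 * \<epsilon>}"
  have "continuous_on V w"
    unfolding w_def using tendsto_vertex_gap
    by (intro continuous_intros) (auto simp: continuous_on_def)
  then have "open (V \<inter> w -` {..<r0 * \<epsilon>})"
    by (rule continuous_open_preimage) (auto intro: V)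
  then have "open W"
    by (simp add: W_def vimage_def Int_def)
  have WV: "W \<subseteq> V" by (auto simp: W_def)
  have "\<mu>0 \<in> W"
    using \<mu>0 r0 by (simp add: W_def w_def \<epsilon>_def)
  define Y where "Y \<mu> = Z \<mu> \<inter> ball x0 \<epsilon>" for \<mu>
  have Y_iff: "x \<in> Y \<mu> \<longleftrightarrow> 0 < e * x \<and> (x\<^sup>2 - vertex \<mu>)\<^sup>2 = gap \<mu>" if "\<mu> \<in> W" for x \<mu>
  proof
    assume "x \<in> Y \<mu>"
    then show "0 < e * x \<and> (x\<^sup>2 - vertex \<mu>)\<^sup>2 = gap \<mu>"
      using side[of x] Z[of \<mu> x] that WV by (auto simp: Y_def)
  next
    assume x: "0 < e * x \<and> (x\<^sup>2 - vertex \<mu>)\<^sup>2 = gap \<mu>"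
    have "w \<mu> / r0 < \<epsilon>"
      using that r0(1) by (subst pos_divide_less_eq) (auto simp: W_def mult.commute)
    then have "x \<in> ball x0 \<epsilon>"
      using near[of x \<mu>] x by (simp add: dist_real_def abs_minus_commute)
    then show "x \<in> Y \<mu>"
      using Z[of \<mu> x] x that WV by (auto simp: Y_def)
  qed
  have vpos: "sqrt \<bar>gap \<mu>\<bar> < vertex \<mu>" if "\<mu> \<in> W" for \<mu>
  proof -
    have "0 \<le> w \<mu>" by (simp add: w_def)
    then have "w \<mu> < vertex \<mu>0"
      using that r0 by (auto simp: W_def \<epsilon>_def power2_eq_square)
    then show ?thesis by (simp add: w_def)
  qed
  have sols: "0 < e * x \<and> x\<^sup>2 = u \<longleftrightarrow> x = e * sqrt u" if "0 < u" for x u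
  proof
    assume "0 < e * x \<and> x\<^sup>2 = u"
    then show "x = e * sqrt u"
      using e by auto
  next
    assume "x = e * sqrt u"
    then show "0 < e * x \<and> x\<^sup>2 = u"
      using e that by (auto simp: power_mult_distrib)
  qed
  have Y_neg: "Y \<mu> = {}" if "\<mu> \<in> W" "gap \<mu> < 0" for \<mu>
    using Y_iff[OF that(1)] that(2) zero_le_power2 by (metis equals0I not_less)
  have Y_pos: "Y \<mu> = {e * sqrt (vertex \<mu> - sqrt (gap \<mu>)), e * sqrt (vertex \<mu> + sqrt (gap \<mu>))}"
    if "\<mu> \<in> W" "0 \<le> gap \<mu>" for \<mu>
  proof -
    have "(x\<^sup>2 - vertex \<mu>)\<^sup>2 = gap \<mu> \<longleftrightarrow> x\<^sup>2 = vertex \<mu> - sqrt (gap \<mu>) \<or> x\<^sup>2 = vertex \<mu> + sqrt (gap \<mu>)" for x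
    proof -
      have "(x\<^sup>2 - vertex \<mu>)\<^sup>2 = gap \<mu> \<longleftrightarrow> (x\<^sup>2 - vertex \<mu>)\<^sup>2 = (sqrt (gap \<mu>))\<^sup>2"
        using that(2) by simp
      then show ?thesis
        unfolding power2_eq_iff by auto
    qed
    moreover have "0 < vertex \<mu> - sqrt (gap \<mu>)" "0 < vertex \<mu> + sqrt (gap \<mu>)"
      using vpos[OF that(1)] real_sqrt_ge_zero[OF that(2)] unfolding abs_of_nonneg[OF that(2)]
      by linarith+
    ultimately show ?thesis
      using Y_iff[OF that(1)] sols by blast
  qed
  have sqrt_ne: "e * sqrt (vertex \<mu> - sqrt (gap \<mu>)) \<noteq> e * sqrt (vertex \<mu> + sqrt (gap \<mu>))"
    if "0 < gap \<mu>" for \<mu>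
    using that e by auto
  have card_Y: "finite (Y \<mu>) \<and> card (Y \<mu>) \<le> 2 \<and> (card (Y \<mu>) = 2 \<longleftrightarrow> 0 < gap \<mu>)" if "\<mu> \<in> W" for \<mu>
  proof (cases "gap \<mu>" "0 :: real" rule: linorder_cases)
    case less
    then show ?thesis using Y_neg[OF that] by simp
  next
    case equal
    then show ?thesis using Y_pos[OF that] by simp
  next
    case greater
    then show ?thesis using Y_pos[OF that] sqrt_ne[of \<mu>] by simp
  qed
  define D where "D = {\<mu>\<in>W. card (Y \<mu>) = 2}"
  have D: "D = {\<mu>\<in>W. 0 < gap \<mu>}"
    using card_Y by (auto simp: D_def)
  have gap_eq: "gap \<mu> = (snd (a0 \<mu>, a1 \<mu>) / (2 * a2))\<^sup>2 - fst (a0 \<mu>, a1 \<mu>) / a2" for \<mu>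
    by (simp add: gap_def vertex_def power_divide)
  have "Y \<mu>0 = {x0}"
    using Y_pos[OF \<open>\<mu>0 \<in> W\<close>] \<mu>0 by (simp add: x0_def r0_def)
  moreover have "\<forall>\<mu>\<in>W. finite (Y \<mu>) \<and> card (Y \<mu>) \<le> 2"
    using card_Y by blast
  moreover have "\<mu>0 \<in> closure (interior D)"
  proof (rule closure_interior_preimage[OF \<open>open W\<close> \<open>\<mu>0 \<in> W\<close> WV])
    show "open {p. 0 < (snd p / (2 * a2))\<^sup>2 - fst p / a2}" for p :: "real \<times> real"
      using a2 by (intro open_Collect_less continuous_intros) auto
    show "(a0 \<mu>0, a1 \<mu>0) \<in> closure {p. 0 < (snd p / (2 * a2))\<^sup>2 - fst p / a2}"
      by (rule mem_closure_of_ray[where q = "(- a2, 0)"])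
        (use \<mu>0(2) a2 in \<open>simp add: gap_eq diff_divide_distrib\<close>)
  qed (use gap_eq in \<open>auto simp: D\<close>)
  moreover have "\<mu>0 \<in> closure (interior {\<mu>\<in>W. Y \<mu> = {}})"
  proof (rule closure_interior_preimage[OF \<open>open W\<close> \<open>\<mu>0 \<in> W\<close> WV])
    show "open {p. (snd p / (2 * a2))\<^sup>2 - fst p / a2 < 0}" for p :: "real \<times> real"
      using a2 by (intro open_Collect_less continuous_intros) auto
    show "(a0 \<mu>0, a1 \<mu>0) \<in> closure {p. (snd p / (2 * a2))\<^sup>2 - fst p / a2 < 0}"
      by (rule mem_closure_of_ray[where q = "(a2, 0)"])
        (use \<mu>0(2) a2 in \<open>simp add: gap_eq add_divide_distrib\<close>)
  qed (use gap_eq Y_neg in auto)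
  moreover have "\<forall>\<mu>\<in>D. \<exists>x y. Y \<mu> = {x, y} \<and> Q \<mu> x y"
  proof
    fix \<mu> assume "\<mu> \<in> D"
    then have \<mu>: "\<mu> \<in> W" "0 < gap \<mu>" "\<mu> \<in> V"
      using WV by (auto simp: D)
    let ?x = "e * sqrt (vertex \<mu> - sqrt (gap \<mu>))" and ?y = "e * sqrt (vertex \<mu> + sqrt (gap \<mu>))"
    have Y: "Y \<mu> = {?x, ?y}"
      using Y_pos \<mu> by simp
    have pos: "0 < vertex \<mu> - sqrt (gap \<mu>)" "0 < vertex \<mu> + sqrt (gap \<mu>)"
      using vpos[OF \<mu>(1)] real_sqrt_gt_zero[OF \<mu>(2)] unfolding abs_of_pos[OF \<mu>(2)]
      by linarith+
    have x: "?x \<in> Z \<mu>" "0 < e * ?x" "?x\<^sup>2 - vertex \<mu> = - sqrt (gap \<mu>)"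
      and y: "?y \<in> Z \<mu>" "0 < e * ?y" "?y\<^sup>2 - vertex \<mu> = sqrt (gap \<mu>)"
      using Y sols[OF pos(1), of ?x] sols[OF pos(2), of ?y] by (auto simp: Y_def)
    show "\<exists>x y. Y \<mu> = {x, y} \<and> Q \<mu> x y"
    proof (cases "a2 > 0")
      case True
      then have "Q \<mu> ?x ?y"
        using x y \<mu> by (intro Q) auto
      then show ?thesis using Y by blast
    next
      case False
      then have "Q \<mu> ?y ?x"
        using x y \<mu> a2 by (intro Q) (auto simp: mult_less_0_iff)
      then show ?thesis using Y by (metis insert_commute)
    qed
  qed
  moreover have "\<forall>\<eta>>0. \<forall>\<^sub>F \<mu> in at \<mu>0 within D. Y \<mu> \<subseteq> ball x0 \<eta>"
  proof (intro allI impI)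
    fix \<eta> :: real assume "\<eta> > 0"
    have "D \<subseteq> V" using WV by (auto simp: D)
    from w_lim[OF this] have "\<forall>\<^sub>F \<mu> in at \<mu>0 within D. w \<mu> < r0 * \<eta>"
      using \<open>\<eta> > 0\<close> r0(1) by (intro order_tendstoD(2)) auto
    moreover have "\<forall>\<^sub>F \<mu> in at \<mu>0 within D. \<mu> \<in> D"
      by (simp add: eventually_at_filter)
    ultimately show "\<forall>\<^sub>F \<mu> in at \<mu>0 within D. Y \<mu> \<subseteq> ball x0 \<eta>"
    proof eventually_elim
      case (elim \<mu>)
      have "w \<mu> / r0 < \<eta>"
        using elim(1) r0(1) by (subst pos_divide_less_eq) (auto simp: mult.commute)
      then have "\<bar>x - x0\<bar> < \<eta>" if "x \<in> Y \<mu>" for x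
        using near[of x \<mu>] Y_iff[of \<mu> x] that elim(2) by (force simp: D)
      then show ?case by (auto simp: dist_real_def abs_minus_commute)
    qed
  qed
  ultimately show ?thesis
    unfolding saddle_node_bifurcation_def Let_def r0_def[symmetric] x0_def[symmetric]
    using \<open>open W\<close> \<open>\<mu>0 \<in> W\<close> WV \<open>0 < \<epsilon>\<close> unfolding D_def Y_def
    by (intro exI[of _ \<epsilon>] conjI exI[of _ W])
qed

text \<open>Vieta: two radii that merge at \<open>r0\<close> give \<open>a1 = - 2 * a2 * r0\<^sup>2\<close> and \<open>a0 = a2 * r0 ^ 4\<close>.\<close>

lemma saddle_node_bifurcationD:
  assumes sn: "saddle_node_bifurcation V R Q \<mu>0 r0" and "0 < r0" and \<mu>0: "\<mu>0 \<in> V"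
  shows "gap \<mu>0 = 0" "0 < vertex \<mu>0"
proof -
  obtain \<epsilon> W where "\<epsilon> > 0" and W: "open W" "\<mu>0 \<in> W" "W \<subseteq> V"
    and *: "let Y = (\<lambda>\<mu>. R \<mu> \<inter> ball r0 \<epsilon>); D = {\<mu>\<in>W. card (Y \<mu>) = 2} in
         Y \<mu>0 = {r0} \<and> (\<forall>\<mu>\<in>W. finite (Y \<mu>) \<and> card (Y \<mu>) \<le> 2) \<and>
         \<mu>0 \<in> closure (interior D) \<and> \<mu>0 \<in> closure (interior {\<mu>\<in>W. Y \<mu> = {}}) \<and>
         (\<forall>\<mu>\<in>D. \<exists>x y. Y \<mu> = {x, y} \<and> Q \<mu> x y) \<and>
         (\<forall>\<eta>>0. \<forall>\<^sub>F \<mu> in at \<mu>0 within D. Y \<mu> \<subseteq> ball r0 \<eta>)"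
    using sn unfolding saddle_node_bifurcation_def by blast
  define Y where "Y \<mu> = R \<mu> \<inter> ball r0 \<epsilon>" for \<mu>
  define D where "D = {\<mu>\<in>W. card (Y \<mu>) = 2}"
  have cl: "\<mu>0 \<in> closure (interior D)" and "Y \<mu>0 = {r0}"
    and shrink: "\<And>\<eta>. \<eta> > 0 \<Longrightarrow> \<forall>\<^sub>F \<mu> in at \<mu>0 within D. Y \<mu> \<subseteq> ball r0 \<eta>"
    using * unfolding Let_def D_def Y_def by auto
  have nontriv: "at \<mu>0 within D \<noteq> bot"
    by (rule limit_point_of_closure_interior[OF cl])
  have DV: "D \<subseteq> V" using W by (auto simp: D_def)
  have inD: "\<forall>\<^sub>F \<mu> in at \<mu>0 within D. \<mu> \<in> D"
    by (simp add: eventually_at_filter)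
  have "\<exists>x y. x \<noteq> y \<and> Y \<mu> = {x, y}" if "\<mu> \<in> D" for \<mu>
    using that by (auto simp: D_def card_2_iff)
  then obtain x y where xy: "\<And>\<mu>. \<mu> \<in> D \<Longrightarrow> x \<mu> \<noteq> y \<mu> \<and> Y \<mu> = {x \<mu>, y \<mu>}"
    by metis
  have lim: "(z \<longlongrightarrow> r0) (at \<mu>0 within D)" if "\<And>\<mu>. \<mu> \<in> D \<Longrightarrow> z \<mu> \<in> Y \<mu>" for z
  proof (rule tendstoI)
    fix \<eta> :: real assume "\<eta> > 0"
    from shrink[OF this] inD show "\<forall>\<^sub>F \<mu> in at \<mu>0 within D. dist (z \<mu>) r0 < \<eta>"
      by eventually_elim (metis that subsetD mem_ball dist_commute)
  qed
  have x_lim: "(x \<longlongrightarrow> r0) (at \<mu>0 within D)" and y_lim: "(y \<longlongrightarrow> r0) (at \<mu>0 within D)"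
    by (rule lim, use xy in blast)+
  have vieta: "vertex \<mu> = ((x \<mu>)\<^sup>2 + (y \<mu>)\<^sup>2) / 2" if "\<mu> \<in> D" for \<mu>
  proof -
    have r: "x \<mu> \<in> R \<mu>" "y \<mu> \<in> R \<mu>" "x \<mu> \<noteq> y \<mu>"
      using xy[OF that] by (auto simp: Y_def)
    then have "((x \<mu>)\<^sup>2 - vertex \<mu>)\<^sup>2 = ((y \<mu>)\<^sup>2 - vertex \<mu>)\<^sup>2"
      using that DV by (auto simp: R_iff quartic_zero_iff)
    moreover have "(x \<mu>)\<^sup>2 \<noteq> (y \<mu>)\<^sup>2"
      using r that DV by (auto simp: R_iff power2_eq_iff)
    ultimately have "(x \<mu>)\<^sup>2 - vertex \<mu> = - ((y \<mu>)\<^sup>2 - vertex \<mu>)"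
      unfolding power2_eq_iff[of "(x \<mu>)\<^sup>2 - vertex \<mu>"] by linarith
    then have "2 * vertex \<mu> = (x \<mu>)\<^sup>2 + (y \<mu>)\<^sup>2" by linarith
    then show ?thesis by simp
  qed
  have "((\<lambda>\<mu>. ((x \<mu>)\<^sup>2 + (y \<mu>)\<^sup>2) / 2) \<longlongrightarrow> (r0\<^sup>2 + r0\<^sup>2) / 2) (at \<mu>0 within D)"
    by (intro tendsto_intros x_lim y_lim) simp
  moreover have "\<forall>\<^sub>F \<mu> in at \<mu>0 within D. ((x \<mu>)\<^sup>2 + (y \<mu>)\<^sup>2) / 2 = vertex \<mu>"
    using inD by eventually_elim (simp add: vieta)
  ultimately have "(vertex \<longlongrightarrow> r0\<^sup>2) (at \<mu>0 within D)"
    by (simp add: tendsto_cong)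
  then have v: "vertex \<mu>0 = r0\<^sup>2"
    using tendsto_unique[OF nontriv tendsto_vertex_gap(1)[OF \<mu>0 DV]] by blast
  then show "0 < vertex \<mu>0" using \<open>0 < r0\<close> by simp
  have "r0 \<in> R \<mu>0"
    using \<open>Y \<mu>0 = {r0}\<close> by (auto simp: Y_def)
  then show "gap \<mu>0 = 0"
    using \<mu>0 by (simp add: R_iff quartic_zero_iff v)
qed

end

section \<open>The inner and the outer branch of radii\<close>

text \<open>The two branches of positive zeros of \<open>a2 * ((r\<^sup>2 - fold_square p)\<^sup>2 - fold_gap p)\<close> over the
  plane of the coefficients \<open>p = (\<nu>0, \<nu>1)\<close>; the fold \<open>T_2SD a2\<close> is where they meet.\<close>

definition fold_square :: "real \<Rightarrow> real \<times> real \<Rightarrow> real" where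
  "fold_square a2 p = - (snd p / (2 * a2))"

definition fold_gap :: "real \<Rightarrow> real \<times> real \<Rightarrow> real" where
  "fold_gap a2 p = (fold_square a2 p)\<^sup>2 - fst p / a2"

definition outer_radius :: "real \<Rightarrow> real \<times> real \<Rightarrow> real" where
  "outer_radius a2 p = sqrt (fold_square a2 p + sqrt (fold_gap a2 p))"

definition inner_radius :: "real \<Rightarrow> real \<times> real \<Rightarrow> real" where
  "inner_radius a2 p = sqrt (fold_square a2 p - sqrt (fold_gap a2 p))"

definition outer_region :: "real \<Rightarrow> (real \<times> real) set" where
  "outer_region a2 = {p. fst p / a2 < 0 \<or> 0 < fold_square a2 p \<and> 0 < fold_gap a2 p}"

definition inner_region :: "real \<Rightarrow> (real \<times> real) set" where
  "inner_region a2 = {p. 0 < fst p / a2 \<and> 0 < fold_square a2 p \<and> 0 < fold_gap a2 p}"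

text \<open>In the coordinates \<open>(\<alpha>, v)\<close> the quadratic is \<open>a2 * (u\<^sup>2 - 2 * v * u + \<alpha>)\<close>, and the fold is the half
  parabola \<open>\<alpha> = v\<^sup>2\<close>, \<open>v > 0\<close>.\<close>

definition fold_point :: "real \<Rightarrow> real \<Rightarrow> real \<Rightarrow> real \<times> real" where
  "fold_point a2 \<alpha> v = (a2 * \<alpha>, - 2 * a2 * v)"

context
  fixes a2 :: real
  assumes a2: "a2 \<noteq> 0"
begin

lemma continuous_on_radius:
  "continuous_on A (outer_radius a2)" "continuous_on A (inner_radius a2)"
  unfolding outer_radius_def inner_radius_def fold_gap_def fold_square_def
  using a2 by (auto intro!: continuous_intros)

lemma T_2SD_eq: "T_2SD a2 = {p. fold_gap a2 p = 0 \<and> 0 < fold_square a2 p}"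
  using a2 by (auto simp: T_2SD_def fold_gap_def fold_square_def power_divide divide_less_0_iff mult_less_0_iff)

lemma fold_point_eq: "p = fold_point a2 (fst p / a2) (fold_square a2 p)"
  using a2 by (cases p) (simp add: fold_square_def fold_point_def)

lemma fold_point_simps [simp]:
  "fold_square a2 (fold_point a2 \<alpha> v) = v" "fst (fold_point a2 \<alpha> v) / a2 = \<alpha>"
  "fold_gap a2 (fold_point a2 \<alpha> v) = v\<^sup>2 - \<alpha>"
  using a2 by (simp_all add: fold_square_def fold_gap_def fold_point_def)

lemma fold_point_mem [simp]:
  "fold_point a2 \<alpha> v \<in> outer_region a2 \<longleftrightarrow> \<alpha> < 0 \<or> 0 < v \<and> \<alpha> < v\<^sup>2"
  "fold_point a2 \<alpha> v \<in> inner_region a2 \<longleftrightarrow> 0 < \<alpha> \<and> 0 < v \<and> \<alpha> < v\<^sup>2"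
  by (simp_all add: outer_region_def inner_region_def)

text \<open>The outer region lies under the graph \<open>\<alpha> = (max 0 v)\<^sup>2\<close>.\<close>

lemma path_connected_outer_region: "path_connected (outer_region a2)"
proof -
  define \<phi> where "\<phi> q = fold_point a2 ((max 0 (snd q))\<^sup>2 - fst q) (snd q)" for q :: "real \<times> real"
  have "outer_region a2 = \<phi> ` ({0<..} \<times> UNIV)"
  proof
    show "\<phi> ` ({0<..} \<times> UNIV) \<subseteq> outer_region a2"
      by (auto simp: \<phi>_def max_def)
    show "outer_region a2 \<subseteq> \<phi> ` ({0<..} \<times> UNIV)"
    proof
      fix p assume "p \<in> outer_region a2"
      then obtain \<alpha> v where p: "p = fold_point a2 \<alpha> v" "\<alpha> < 0 \<or> 0 < v \<and> \<alpha> < v\<^sup>2"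
        using fold_point_eq[of p] fold_point_mem(1) by metis
      then have "\<alpha> < (max 0 v)\<^sup>2"
        by (auto simp: max_def intro: less_le_trans)
      then have "((max 0 v)\<^sup>2 - \<alpha>, v) \<in> {0<..} \<times> UNIV"
        by simp
      moreover have "p = \<phi> ((max 0 v)\<^sup>2 - \<alpha>, v)"
        by (simp add: \<phi>_def p)
      ultimately show "p \<in> \<phi> ` ({0<..} \<times> UNIV)" by blast
    qed
  qed
  moreover have "path_connected ({0<..} \<times> UNIV :: (real \<times> real) set)"
    by (intro convex_imp_path_connected convex_Times) auto
  moreover have "continuous_on ({0<..} \<times> UNIV) \<phi>"
    unfolding \<phi>_def fold_point_def by (intro continuous_intros)
  ultimately show ?thesis
    by (simp add: path_connected_continuous_image)
qed

lemma path_connected_inner_region: "path_connected (inner_region a2)"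
proof -
  define \<phi> where "\<phi> q = fold_point a2 (fst q * (snd q)\<^sup>2) (snd q)" for q :: "real \<times> real"
  have "inner_region a2 = \<phi> ` ({0<..<1} \<times> {0<..})"
  proof
    show "\<phi> ` ({0<..<1} \<times> {0<..}) \<subseteq> inner_region a2"
      by (auto simp: \<phi>_def)
    show "inner_region a2 \<subseteq> \<phi> ` ({0<..<1} \<times> {0<..})"
    proof
      fix p assume "p \<in> inner_region a2"
      then obtain \<alpha> v where p: "p = fold_point a2 \<alpha> v" "0 < \<alpha> \<and> 0 < v \<and> \<alpha> < v\<^sup>2"
        using fold_point_eq[of p] fold_point_mem(2) by metis
      then have "(\<alpha> / v\<^sup>2, v) \<in> {0<..<1} \<times> {0<..}"
        by (simp add: divide_less_eq)
      moreover have "p = \<phi> (\<alpha> / v\<^sup>2, v)"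
        using p by (simp add: \<phi>_def)
      ultimately show "p \<in> \<phi> ` ({0<..<1} \<times> {0<..})" by blast
    qed
  qed
  moreover have "path_connected ({0<..<1} \<times> {0<..} :: (real \<times> real) set)"
    by (intro convex_imp_path_connected convex_Times) auto
  moreover have "continuous_on ({0<..<1} \<times> {0<..}) \<phi>"
    unfolding \<phi>_def fold_point_def by (intro continuous_intros)
  ultimately show ?thesis
    by (simp add: path_connected_continuous_image)
qed

lemma inner_subset_outer: "inner_region a2 \<subseteq> outer_region a2"
  by (auto simp: inner_region_def outer_region_def)

lemma outer_region_gap:
  assumes "p \<in> outer_region a2"
  shows "0 < fold_gap a2 p" "0 < fold_square a2 p + sqrt (fold_gap a2 p)"
proof -
  show g: "0 < fold_gap a2 p"
    using assms by (auto simp: outer_region_def fold_gap_def intro: less_le_trans)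
  show "0 < fold_square a2 p + sqrt (fold_gap a2 p)"
  proof (cases "0 < fold_square a2 p")
    case True
    then show ?thesis using g by (simp add: add_pos_pos)
  next
    case False
    then have "(fold_square a2 p)\<^sup>2 < fold_gap a2 p"
      using assms by (simp add: outer_region_def fold_gap_def)
    then have "\<bar>fold_square a2 p\<bar> < sqrt (fold_gap a2 p)"
      by (metis real_sqrt_abs real_sqrt_less_mono)
    then show ?thesis by linarith
  qed
qed

lemma inner_region_gap:
  assumes "p \<in> inner_region a2"
  shows "0 < fold_gap a2 p" "0 < fold_square a2 p - sqrt (fold_gap a2 p)"
proof -
  show "0 < fold_gap a2 p"
    using assms by (simp add: inner_region_def)
  have "fold_gap a2 p < (fold_square a2 p)\<^sup>2"
    using assms by (simp add: inner_region_def fold_gap_def)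
  then have "sqrt (fold_gap a2 p) < \<bar>fold_square a2 p\<bar>"
    by (metis real_sqrt_abs real_sqrt_less_mono)
  then show "0 < fold_square a2 p - sqrt (fold_gap a2 p)"
    using assms by (simp add: inner_region_def)
qed

lemma outer_radius_zero:
  assumes "p \<in> outer_region a2"
  shows "0 < outer_radius a2 p" "(outer_radius a2 p)\<^sup>2 - fold_square a2 p = sqrt (fold_gap a2 p)"
  using outer_region_gap[OF assms] by (simp_all add: outer_radius_def)

lemma inner_radius_zero:
  assumes "p \<in> inner_region a2"
  shows "0 < inner_radius a2 p" "(inner_radius a2 p)\<^sup>2 - fold_square a2 p = - sqrt (fold_gap a2 p)"
  using inner_region_gap[OF assms] by (simp_all add: inner_radius_def)

lemma radius_iff:
  assumes "p \<notin> T_2SD a2"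
  shows "0 < r \<and> (r\<^sup>2 - fold_square a2 p)\<^sup>2 = fold_gap a2 p \<longleftrightarrow>
    p \<in> outer_region a2 \<and> r = outer_radius a2 p \<or> p \<in> inner_region a2 \<and> r = inner_radius a2 p"
proof
  assume "p \<in> outer_region a2 \<and> r = outer_radius a2 p \<or> p \<in> inner_region a2 \<and> r = inner_radius a2 p"
  then show "0 < r \<and> (r\<^sup>2 - fold_square a2 p)\<^sup>2 = fold_gap a2 p"
  proof
    assume "p \<in> outer_region a2 \<and> r = outer_radius a2 p"
    then show ?thesis
      using outer_radius_zero[of p] outer_region_gap[of p] by simp
  next
    assume "p \<in> inner_region a2 \<and> r = inner_radius a2 p"
    then show ?thesis
      using inner_radius_zero[of p] inner_region_gap[of p] by simp
  qed
next
  let ?v = "fold_square a2 p" and ?g = "fold_gap a2 p"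
  assume r: "0 < r \<and> (r\<^sup>2 - ?v)\<^sup>2 = ?g"
  then have g: "0 \<le> ?g" by (metis zero_le_power2)
  have "(r\<^sup>2 - ?v)\<^sup>2 = (sqrt ?g)\<^sup>2"
    using r g by simp
  then consider (outer) "r\<^sup>2 = ?v + sqrt ?g" | (inner) "r\<^sup>2 = ?v - sqrt ?g"
    unfolding power2_eq_iff by force
  then show "p \<in> outer_region a2 \<and> r = outer_radius a2 p \<or> p \<in> inner_region a2 \<and> r = inner_radius a2 p"
  proof cases
    case outer
    have "r = outer_radius a2 p"
      using r unfolding outer_radius_def outer[symmetric] by simp
    moreover have "p \<in> outer_region a2"
    proof (rule ccontr)
      assume "p \<notin> outer_region a2"
      then have g_le: "?g \<le> ?v\<^sup>2" and v: "?v \<le> 0 \<or> ?g = 0"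
        using g by (auto simp: outer_region_def fold_gap_def)
      have pos: "0 < ?v + sqrt ?g"
        using r outer by (metis zero_less_power)
      from v show False
      proof
        assume "?v \<le> 0"
        then show False
          using real_sqrt_le_mono[OF g_le] pos by simp
      next
        assume "?g = 0"
        then show False
          using assms pos by (simp add: T_2SD_eq)
      qed
    qed
    ultimately show ?thesis by simp
  next
    case inner
    have pos: "0 < ?v - sqrt ?g"
      using r inner by (metis zero_less_power)
    have "r = inner_radius a2 p"
      using r unfolding inner_radius_def inner[symmetric] by simp
    moreover have v: "0 < ?v"
      using pos g by (metis diff_gt_0_iff_gt le_less_trans real_sqrt_ge_zero)
    moreover have "?g \<noteq> 0"
      using assms v by (simp add: T_2SD_eq)
    moreover have "(sqrt ?g)\<^sup>2 < ?v\<^sup>2"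
      using pos g by (intro power_strict_mono) auto
    ultimately show ?thesis
      using g by (simp add: inner_region_def fold_gap_def)
  qed
qed

lemma radius_iff_fold:
  assumes "p \<in> T_2SD a2"
  shows "0 < r \<and> (r\<^sup>2 - fold_square a2 p)\<^sup>2 = fold_gap a2 p \<longleftrightarrow> r = outer_radius a2 p"
proof -
  have "fold_gap a2 p = 0" "0 < fold_square a2 p"
    using assms by (auto simp: T_2SD_eq)
  moreover have "0 < r \<and> r\<^sup>2 = u \<longleftrightarrow> r = sqrt u" if "0 < u" for u
    using that by auto
  ultimately show ?thesis by (simp add: outer_radius_def)
qed

lemma inner_outer_differ: "p \<in> inner_region a2 \<Longrightarrow> inner_radius a2 p \<noteq> outer_radius a2 p"
  using inner_region_gap(1)[of p] by (simp add: inner_radius_def outer_radius_def)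

lemma inner_outer_agree: "p \<in> T_2SD a2 \<Longrightarrow> inner_radius a2 p = outer_radius a2 p"
  by (simp add: T_2SD_eq inner_radius_def outer_radius_def)

lemma outer_region_boundary:
  assumes "fst p = 0" "fold_square a2 p < 0"
  shows "p \<in> closure (outer_region a2)" "outer_radius a2 p = 0"
proof -
  show "p \<in> closure (outer_region a2)"
    by (rule mem_closure_of_ray[where q = "(- a2, 0)"])
      (use assms a2 in \<open>auto simp: outer_region_def\<close>)
  show "outer_radius a2 p = 0"
    using assms by (simp add: outer_radius_def fold_gap_def)
qed

text \<open>Parameters in the inner region approach both of its edges, \<open>\<nu>0 = 0\<close> and the fold.\<close>

lemma inner_region_edges:
  assumes "0 < v"
  shows "fold_point a2 0 v \<in> closure (inner_region a2)" "fold_point a2 (v\<^sup>2) v \<in> closure (inner_region a2)"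
proof -
  have cont: "continuous_on (closure {0<..<1}) (\<lambda>t. fold_point a2 (t * v\<^sup>2) v)"
    unfolding fold_point_def by (intro continuous_intros)
  have "fold_point a2 (t * v\<^sup>2) v \<in> inner_region a2" if "t \<in> {0<..<1}" for t
    using assms that by simp
  then have "(\<lambda>t. fold_point a2 (t * v\<^sup>2) v) ` closure {0<..<1} \<subseteq> closure (inner_region a2)"
    by (intro image_closure_subset[OF cont closed_closure]) (use closure_subset in blast)
  then have "fold_point a2 (t * v\<^sup>2) v \<in> closure (inner_region a2)" if "t \<in> {0..1}" for t
    using that by (auto simp: closure_greaterThanLessThan)
  from this[of 0] this[of 1]
  show "fold_point a2 0 v \<in> closure (inner_region a2)" "fold_point a2 (v\<^sup>2) v \<in> closure (inner_region a2)"
    by simp_all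
qed

lemma inner_region_boundary:
  assumes "fst p = 0" "0 < fold_square a2 p"
  shows "p \<in> closure (inner_region a2)" "inner_radius a2 p = 0"
proof -
  show "p \<in> closure (inner_region a2)"
    using inner_region_edges(1)[OF assms(2)] fold_point_eq[of p] assms(1) by simp
  show "inner_radius a2 p = 0"
    using assms by (simp add: inner_radius_def fold_gap_def)
qed

lemma fold_in_closure:
  assumes "p \<in> T_2SD a2"
  shows "p \<in> closure (inner_region a2)"
proof -
  have "0 < fold_square a2 p" "fst p / a2 = (fold_square a2 p)\<^sup>2"
    using assms by (auto simp: T_2SD_eq fold_gap_def)
  then show ?thesis
    using inner_region_edges(2)[of "fold_square a2 p"] fold_point_eq[of p] by simp
qed

end

section \<open>Sign patterns and folds of unfoldings of a fifth power\<close>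

text \<open>An unfolding of \<open>x ^ 5\<close> by odd functions: \<open>D j \<alpha> \<beta>\<close> is the \<open>j\<close>-th derivative in the state
  variable \<open>x\<close>, and the Taylor polynomial of degree four at the origin is \<open>\<alpha> * x + \<beta> * x ^ 3\<close>.\<close>

locale quintic_unfolding =
  fixes D :: "nat \<Rightarrow> real \<Rightarrow> real \<Rightarrow> real \<Rightarrow> real" and \<eta> \<epsilon> :: real
  assumes \<eta>: "0 < \<eta>" and \<epsilon>: "0 < \<epsilon>"
    and deriv: "\<alpha> \<in> {- \<eta>..\<eta>} \<Longrightarrow> \<beta> \<in> {- \<eta>..\<eta>} \<Longrightarrow> x \<in> {0..\<epsilon>} \<Longrightarrow> j < 5 \<Longrightarrow>
      (D j \<alpha> \<beta> has_real_derivative D (Suc j) \<alpha> \<beta> x) (at x)"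
    and init: "\<alpha> \<in> {- \<eta>..\<eta>} \<Longrightarrow> \<beta> \<in> {- \<eta>..\<eta>} \<Longrightarrow>
      D 0 \<alpha> \<beta> 0 = 0 \<and> D 1 \<alpha> \<beta> 0 = \<alpha> \<and> D 2 \<alpha> \<beta> 0 = 0 \<and> D 3 \<alpha> \<beta> 0 = 6 * \<beta> \<and> D 4 \<alpha> \<beta> 0 = 0"
    and D5_pos: "\<alpha> \<in> {- \<eta>..\<eta>} \<Longrightarrow> \<beta> \<in> {- \<eta>..\<eta>} \<Longrightarrow> x \<in> {0..\<epsilon>} \<Longrightarrow> 0 < D 5 \<alpha> \<beta> x"
    and D3_mono: "\<alpha> \<in> {- \<eta>..\<eta>} \<Longrightarrow> \<beta> \<in> {- \<eta>..\<eta>} \<Longrightarrow> \<beta>' \<in> {- \<eta>..\<eta>} \<Longrightarrow> \<beta> < \<beta>' \<Longrightarrow> x \<in> {0..\<epsilon>} \<Longrightarrow>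
      D 3 \<alpha> \<beta> x < D 3 \<alpha> \<beta>' x"
    and cont0: "continuous_on ({- \<eta>..\<eta>} \<times> {- \<eta>..\<eta>} \<times> {0..\<epsilon>}) (\<lambda>(\<alpha>, \<beta>, x). D 0 \<alpha> \<beta> x)"
    and cont1: "continuous_on ({- \<eta>..\<eta>} \<times> {- \<eta>..\<eta>} \<times> {0..\<epsilon>}) (\<lambda>(\<alpha>, \<beta>, x). D 1 \<alpha> \<beta> x)"
begin

abbreviation "P \<equiv> {- \<eta>..\<eta>}"
abbreviation "F \<equiv> D 0"

text \<open>The next three lemmas integrate the positive fifth derivative back to
  \<open>x\<^sup>2 * D 2 - 3 * x * D 1 + 3 * D 0\<close>, the numerator of the derivative of \<open>(x * D 1 - D 0) / x ^ 3\<close>.  The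
  polynomial \<open>\<alpha> * x + \<beta> * x ^ 3\<close> does not contribute to it.\<close>

lemma D4_pos:
  assumes "\<alpha> \<in> P" "\<beta> \<in> P" "0 < x" "x \<le> \<epsilon>"
  shows "0 < D 4 \<alpha> \<beta> x"
proof -
  have "D 4 \<alpha> \<beta> 0 < D 4 \<alpha> \<beta> x"
  proof (rule DERIV_pos_imp_increasing[OF \<open>0 < x\<close>])
    fix t assume "0 \<le> t" "t \<le> x"
    then have "(D 4 \<alpha> \<beta> has_real_derivative D 5 \<alpha> \<beta> t) (at t)" "0 < D 5 \<alpha> \<beta> t"
      using deriv[of \<alpha> \<beta> t 4] D5_pos[of \<alpha> \<beta> t] assms by auto
    then show "\<exists>y. (D 4 \<alpha> \<beta> has_real_derivative y) (at t) \<and> 0 < y" by blast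
  qed
  then show ?thesis using init[OF assms(1,2)] by simp
qed

lemma D3_slope:
  assumes "\<alpha> \<in> P" "\<beta> \<in> P" "0 < x" "x \<le> \<epsilon>"
  shows "0 < x * D 3 \<alpha> \<beta> x - D 2 \<alpha> \<beta> x"
proof -
  let ?f = "\<lambda>x. x * D 3 \<alpha> \<beta> x - D 2 \<alpha> \<beta> x"
  have der: "(?f has_real_derivative t * D 4 \<alpha> \<beta> t) (at t)" if "0 \<le> t" "t \<le> x" for t
    using deriv[of \<alpha> \<beta> t 3] deriv[of \<alpha> \<beta> t 2] assms that
    by (auto intro!: derivative_eq_intros simp: numeral_eq_Suc)
  have "?f 0 < ?f x"
  proof (rule DERIV_pos_imp_increasing_open[OF \<open>0 < x\<close>])
    fix t assume t: "0 < t" "t < x"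
    then have "0 < t * D 4 \<alpha> \<beta> t"
      using D4_pos[OF assms(1,2), of t] assms by simp
    then show "\<exists>y. (?f has_real_derivative y) (at t) \<and> 0 < y"
      using der[of t] t by auto
  next
    show "continuous_on {0..x} ?f"
      using der by (intro DERIV_atLeastAtMost_imp_continuous_on) auto
  qed
  then show ?thesis using init[OF assms(1,2)] by simp
qed

lemma quotient_slope:
  assumes "\<alpha> \<in> P" "\<beta> \<in> P" "0 < x" "x \<le> \<epsilon>"
  shows "0 < x\<^sup>2 * D 2 \<alpha> \<beta> x - 3 * x * D 1 \<alpha> \<beta> x + 3 * F \<alpha> \<beta> x"
proof -
  let ?f = "\<lambda>x. x\<^sup>2 * D 2 \<alpha> \<beta> x - 3 * x * D 1 \<alpha> \<beta> x + 3 * F \<alpha> \<beta> x"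
  have der: "(?f has_real_derivative t * (t * D 3 \<alpha> \<beta> t - D 2 \<alpha> \<beta> t)) (at t)" if "0 \<le> t" "t \<le> x" for t
    using deriv[of \<alpha> \<beta> t 0] deriv[of \<alpha> \<beta> t 1] deriv[of \<alpha> \<beta> t 2] assms that
    by (auto intro!: derivative_eq_intros simp: numeral_eq_Suc algebra_simps)
  have "?f 0 < ?f x"
  proof (rule DERIV_pos_imp_increasing_open[OF \<open>0 < x\<close>])
    fix t assume t: "0 < t" "t < x"
    then have "0 < t * (t * D 3 \<alpha> \<beta> t - D 2 \<alpha> \<beta> t)"
      using D3_slope[OF assms(1,2), of t] assms by simp
    then show "\<exists>y. (?f has_real_derivative y) (at t) \<and> 0 < y"
      using der[of t] t by auto
  next
    show "continuous_on {0..x} ?f"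
      using der by (intro DERIV_atLeastAtMost_imp_continuous_on) auto
  qed
  then show ?thesis using init[OF assms(1,2)] by simp
qed

text \<open>\<open>G \<alpha> \<beta> x = F \<alpha> \<beta> x / x\<close> is a strictly convex function of \<open>x\<^sup>2\<close>: twice its derivative in
  \<open>x\<^sup>2\<close> is \<open>(x * D 1 - F) / x ^ 3\<close>.\<close>

definition G :: "real \<Rightarrow> real \<Rightarrow> real \<Rightarrow> real" where
  "G \<alpha> \<beta> x = (if x = 0 then \<alpha> else F \<alpha> \<beta> x / x)"

definition slope :: "real \<Rightarrow> real \<Rightarrow> real \<Rightarrow> real" where
  "slope \<alpha> \<beta> x = (x * D 1 \<alpha> \<beta> x - F \<alpha> \<beta> x) / x ^ 3"

lemma slope_mono:
  assumes "\<alpha> \<in> P" "\<beta> \<in> P" "0 < x" "x < y" "y \<le> \<epsilon>"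
  shows "slope \<alpha> \<beta> x < slope \<alpha> \<beta> y"
proof (rule DERIV_pos_imp_increasing[OF \<open>x < y\<close>])
  fix t assume t: "x \<le> t" "t \<le> y"
  then have "0 < t" using assms by simp
  have "(slope \<alpha> \<beta> has_real_derivative (t\<^sup>2 * D 2 \<alpha> \<beta> t - 3 * t * D 1 \<alpha> \<beta> t + 3 * F \<alpha> \<beta> t) / t ^ 4) (at t)"
    unfolding slope_def
    using deriv[of \<alpha> \<beta> t 0] deriv[of \<alpha> \<beta> t 1] assms t \<open>0 < t\<close>
    by (auto intro!: derivative_eq_intros simp: numeral_eq_Suc field_simps)
  moreover have "0 < (t\<^sup>2 * D 2 \<alpha> \<beta> t - 3 * t * D 1 \<alpha> \<beta> t + 3 * F \<alpha> \<beta> t) / t ^ 4"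
    using quotient_slope[OF assms(1,2) \<open>0 < t\<close>] t assms \<open>0 < t\<close> by simp
  ultimately show "\<exists>d. (slope \<alpha> \<beta> has_real_derivative d) (at t) \<and> 0 < d" by blast
qed

lemma G_deriv:
  assumes "\<alpha> \<in> P" "\<beta> \<in> P" "0 < x" "x \<le> \<epsilon>"
  shows "(G \<alpha> \<beta> has_real_derivative x * slope \<alpha> \<beta> x) (at x)"
proof -
  have "((\<lambda>x. F \<alpha> \<beta> x / x) has_real_derivative x * slope \<alpha> \<beta> x) (at x)"
    unfolding slope_def using deriv[of \<alpha> \<beta> x 0] assms
    by (auto intro!: derivative_eq_intros simp: power3_eq_cube field_simps)
  moreover have "\<forall>\<^sub>F y in nhds x. F \<alpha> \<beta> y / y = G \<alpha> \<beta> y"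
    using eventually_nhds_in_open[of "{0<..}" x] assms(3)
    by (rule_tac eventually_mono[of "\<lambda>y. y \<in> {0<..}"]) (auto simp: G_def)
  ultimately show ?thesis
    using DERIV_cong_ev[of x x "\<lambda>x. F \<alpha> \<beta> x / x" "G \<alpha> \<beta>"] by blast
qed

text \<open>At \<open>x = 0\<close> the quotient is a value of the first derivative at a point even closer to \<open>0\<close>, by the mean
  value theorem.\<close>

lemma continuous_on_G: "continuous_on (P \<times> P \<times> {0..\<epsilon>}) (\<lambda>(\<alpha>, \<beta>, x). G \<alpha> \<beta> x)"
  unfolding continuous_on_iff
proof (intro ballI allI impI)
  fix p :: "real \<times> real \<times> real" and e :: real
  assume p: "p \<in> P \<times> P \<times> {0..\<epsilon>}" and "0 < e"
  obtain \<alpha>0 \<beta>0 x0 where p_eq: "p = (\<alpha>0, \<beta>0, x0)" by (cases p)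
  show "\<exists>d>0. \<forall>p'\<in>P \<times> P \<times> {0..\<epsilon>}. dist p' p < d \<longrightarrow>
      dist (case p' of (\<alpha>, \<beta>, x) \<Rightarrow> G \<alpha> \<beta> x) (case p of (\<alpha>, \<beta>, x) \<Rightarrow> G \<alpha> \<beta> x) < e"
  proof (cases "x0 = 0")
    case True
    have "(\<lambda>(\<alpha>, \<beta>, x). D 1 \<alpha> \<beta> x) p = \<alpha>0"
      using init[of \<alpha>0 \<beta>0] p by (simp add: p_eq True)
    then obtain d where "d > 0" and d: "\<And>p'. p' \<in> P \<times> P \<times> {0..\<epsilon>} \<Longrightarrow> dist p' p < d \<Longrightarrow>
        dist ((\<lambda>(\<alpha>, \<beta>, x). D 1 \<alpha> \<beta> x) p') \<alpha>0 < e"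
      using cont1[unfolded continuous_on_iff, rule_format, OF p \<open>0 < e\<close>] by metis
    have "dist (G \<alpha> \<beta> x) \<alpha>0 < e"
      if p': "(\<alpha>, \<beta>, x) \<in> P \<times> P \<times> {0..\<epsilon>}" and near: "dist (\<alpha>, \<beta>, x) p < d" for \<alpha> \<beta> x
    proof -
      obtain \<xi> where \<xi>: "0 \<le> \<xi>" "\<xi> \<le> x" "G \<alpha> \<beta> x = D 1 \<alpha> \<beta> \<xi>"
      proof (cases "x = 0")
        case True
        then show ?thesis using that[of 0] init[of \<alpha> \<beta>] p' by (simp add: G_def)
      next
        case False
        then have "0 < x" using p' by simp
        obtain z where "0 < z" "z < x" "F \<alpha> \<beta> x - F \<alpha> \<beta> 0 = (x - 0) * D 1 \<alpha> \<beta> z"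
          using MVT2[OF \<open>0 < x\<close>, of "F \<alpha> \<beta>" "D 1 \<alpha> \<beta>"] deriv[of \<alpha> \<beta> _ 0] p' by auto
        then show ?thesis
          using that[of z] init[of \<alpha> \<beta>] p' \<open>0 < x\<close> by (simp add: G_def)
      qed
      have "dist (\<alpha>, \<beta>, \<xi>) p \<le> dist (\<alpha>, \<beta>, x) p"
        using \<xi>(1,2) unfolding p_eq True dist_Pair_Pair dist_real_def
        by (intro real_sqrt_le_mono add_left_mono power_mono) auto
      then have "dist (D 1 \<alpha> \<beta> \<xi>) \<alpha>0 < e"
        using d[of "(\<alpha>, \<beta>, \<xi>)"] near p' \<xi> by simp
      then show ?thesis by (simp add: \<xi>(3))
    qed
    then show ?thesis
      using \<open>d > 0\<close> by (intro exI[of _ d]) (auto simp: p_eq True G_def[of _ _ 0])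
  next
    case False
    then have "0 < x0" using p p_eq by simp
    let ?S = "P \<times> P \<times> {x0 / 2..\<epsilon>}"
    have "continuous_on ?S (\<lambda>q. (\<lambda>(\<alpha>, \<beta>, x). F \<alpha> \<beta> x) q / snd (snd q))"
      using \<open>0 < x0\<close> by (intro continuous_intros continuous_on_subset[OF cont0]) auto
    then have "continuous_on ?S (\<lambda>(\<alpha>, \<beta>, x). G \<alpha> \<beta> x)"
      by (rule continuous_on_eq) (use \<open>0 < x0\<close> in \<open>auto simp: G_def\<close>)
    moreover have "p \<in> ?S"
      using p \<open>0 < x0\<close> by (simp add: p_eq)
    ultimately obtain d where "d > 0" and d: "\<And>p'. p' \<in> ?S \<Longrightarrow> dist p' p < d \<Longrightarrow>
      dist ((\<lambda>(\<alpha>, \<beta>, x). G \<alpha> \<beta> x) p') ((\<lambda>(\<alpha>, \<beta>, x). G \<alpha> \<beta> x) p) < e"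
      unfolding continuous_on_iff using \<open>0 < e\<close> by metis
    have "p' \<in> ?S" if "p' \<in> P \<times> P \<times> {0..\<epsilon>}" "dist p' p < x0 / 2" for p'
    proof -
      have "\<bar>snd (snd p') - x0\<bar> < x0 / 2"
        using dist_snd_le[of "snd p'" "snd p"] dist_snd_le[of p' p] that(2)
        by (simp add: p_eq dist_real_def)
      then have "x0 / 2 \<le> snd (snd p')"
        unfolding abs_less_iff by linarith
      then show ?thesis using that(1) by (auto simp: mem_Times_iff)
    qed
    then show ?thesis
      using d \<open>d > 0\<close> \<open>0 < x0\<close> by (intro exI[of _ "min d (x0 / 2)"]) auto
  qed
qed

lemma continuous_on_G_slice:
  assumes "\<alpha> \<in> P" "\<beta> \<in> P"
  shows "continuous_on {0..\<epsilon>} (G \<alpha> \<beta>)"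
proof -
  have "continuous_on {0..\<epsilon>} (\<lambda>x. (\<alpha>, \<beta>, x))"
    by (intro continuous_intros)
  moreover have "(\<lambda>x. (\<alpha>, \<beta>, x)) ` {0..\<epsilon>} \<subseteq> P \<times> P \<times> {0..\<epsilon>}"
    using assms by blast
  ultimately show ?thesis
    using continuous_on_compose2[OF continuous_on_G] by fastforce
qed

lemma G_sign: "0 < x \<Longrightarrow> sgn (G \<alpha> \<beta> x) = sgn (F \<alpha> \<beta> x)"
  by (simp add: G_def sgn_divide)

text \<open>A nonnegative value between two nonpositive ones would give a slope \<open>\<ge> 0\<close> before a slope \<open>\<le> 0\<close>.\<close>

lemma G_quasiconvex:
  assumes "\<alpha> \<in> P" "\<beta> \<in> P" and "0 \<le> x" "x < y" "y < z" "z \<le> \<epsilon>"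
    and "G \<alpha> \<beta> x \<le> 0" "G \<alpha> \<beta> z \<le> 0"
  shows "G \<alpha> \<beta> y < 0"
proof (rule ccontr)
  assume y: "\<not> G \<alpha> \<beta> y < 0"
  have mvt: "\<exists>t. u < t \<and> t < v \<and> G \<alpha> \<beta> v - G \<alpha> \<beta> u = (v - u) * (t * slope \<alpha> \<beta> t)"
    if "0 \<le> u" "u < v" "v \<le> \<epsilon>" for u v
  proof -
    have "continuous_on {u..v} (G \<alpha> \<beta>)"
      using continuous_on_G_slice[OF assms(1,2)] that by (auto elim: continuous_on_subset)
    moreover have "G \<alpha> \<beta> differentiable at t" if "u < t" "t < v" for t
      using G_deriv[OF assms(1,2), of t] that \<open>0 \<le> u\<close> \<open>v \<le> \<epsilon>\<close>
      by (auto simp: real_differentiable_def)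
    ultimately obtain l t where "u < t" "t < v" "DERIV (G \<alpha> \<beta>) t :> l" "G \<alpha> \<beta> v - G \<alpha> \<beta> u = (v - u) * l"
      using MVT[OF \<open>u < v\<close>] by metis
    moreover from this have "l = t * slope \<alpha> \<beta> t"
      using G_deriv[OF assms(1,2), of t] that by (intro DERIV_unique) auto
    ultimately show ?thesis by blast
  qed
  obtain s where s: "x < s" "s < y" "G \<alpha> \<beta> y - G \<alpha> \<beta> x = (y - x) * (s * slope \<alpha> \<beta> s)"
    using mvt[of x y] assms by auto
  obtain t where t: "y < t" "t < z" "G \<alpha> \<beta> z - G \<alpha> \<beta> y = (z - y) * (t * slope \<alpha> \<beta> t)"
    using mvt[of y z] assms by auto
  have "0 \<le> (y - x) * (s * slope \<alpha> \<beta> s)" "(z - y) * (t * slope \<alpha> \<beta> t) \<le> 0"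
    using y assms s(3) t(3) by linarith+
  moreover have "0 < s" "0 < t" using assms s t by linarith+
  ultimately have "0 \<le> slope \<alpha> \<beta> s" "slope \<alpha> \<beta> t \<le> 0"
    using assms by (auto simp: zero_le_mult_iff mult_le_0_iff)
  moreover have "slope \<alpha> \<beta> s < slope \<alpha> \<beta> t"
    using slope_mono[OF assms(1,2) \<open>0 < s\<close>, of t] s t assms by simp
  ultimately show False by simp
qed

text \<open>The difference of the two functions vanishes to second order at \<open>0\<close>, and its third derivative is positive.\<close>

lemma F_mono:
  assumes "\<alpha> \<in> P" "\<beta> \<in> P" "\<beta>' \<in> P" "\<beta> < \<beta>'" "0 < x" "x \<le> \<epsilon>"
  shows "F \<alpha> \<beta> x < F \<alpha> \<beta>' x"
proof -
  define d where "d j t = D j \<alpha> \<beta>' t - D j \<alpha> \<beta> t" for j t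
  have "\<exists>t>0. t < x \<and> d 0 x = (\<Sum>m<3. d m 0 / fact m * x ^ m) + d 3 t / fact 3 * x ^ 3"
  proof (rule Maclaurin[OF \<open>0 < x\<close>])
    show "\<forall>m t. m < 3 \<and> 0 \<le> t \<and> t \<le> x \<longrightarrow> (d m has_real_derivative d (Suc m) t) (at t)"
      unfolding d_def using assms by (auto intro!: DERIV_diff deriv)
  qed auto
  then obtain t where t: "0 < t" "t < x" "d 0 x = (\<Sum>m<3. d m 0 / fact m * x ^ m) + d 3 t / fact 3 * x ^ 3"
    by blast
  have "(\<Sum>m<3. d m 0 / fact m * x ^ m) = 0"
    using init[OF assms(1,2)] init[OF assms(1,3)] by (simp add: d_def numeral_eq_Suc)
  moreover have "0 < d 3 t / fact 3 * x ^ 3"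
    using D3_mono[OF assms(1-4), of t] t assms by (simp add: d_def)
  ultimately show ?thesis using t(3) by (simp add: d_def)
qed

lemma F_pos:
  assumes "\<alpha> \<in> P" "\<beta> \<in> P" "0 \<le> \<alpha>" "0 \<le> \<beta>" "0 < x" "x \<le> \<epsilon>"
  shows "0 < F \<alpha> \<beta> x"
proof -
  have "\<exists>t>0. t < x \<and> F \<alpha> \<beta> x = (\<Sum>m<5. D m \<alpha> \<beta> 0 / fact m * x ^ m) + D 5 \<alpha> \<beta> t / fact 5 * x ^ 5"
  proof (rule Maclaurin[OF \<open>0 < x\<close>])
    show "\<forall>m t. m < 5 \<and> 0 \<le> t \<and> t \<le> x \<longrightarrow> (D m \<alpha> \<beta> has_real_derivative D (Suc m) \<alpha> \<beta> t) (at t)"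
      using assms by (auto intro!: deriv)
  qed auto
  then obtain t where t: "0 < t" "t < x"
    "F \<alpha> \<beta> x = (\<Sum>m<5. D m \<alpha> \<beta> 0 / fact m * x ^ m) + D 5 \<alpha> \<beta> t / fact 5 * x ^ 5"
    by blast
  have "(\<Sum>m<5. D m \<alpha> \<beta> 0 / fact m * x ^ m) = \<alpha> * x + \<beta> * x ^ 3"
    using init[OF assms(1,2)] by (simp add: numeral_eq_Suc)
  moreover have "0 < D 5 \<alpha> \<beta> t / fact 5 * x ^ 5"
    using D5_pos[OF assms(1,2), of t] t assms by simp
  ultimately show ?thesis
    using t(3) assms by (simp add: add_nonneg_pos)
qed

lemma F_neg_right:
  assumes "\<beta> \<in> P" "\<beta> < 0"
  shows "\<exists>x\<in>{0<..\<epsilon>}. F 0 \<beta> x < 0"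
proof -
  have P0: "0 \<in> P" using \<eta> by simp
  have "(D 3 0 \<beta> \<longlongrightarrow> D 3 0 \<beta> 0) (at_right 0)"
    using deriv[OF P0 assms(1), of 0 3] \<epsilon> DERIV_isCont
    by (auto simp: isCont_def intro: filterlim_mono[OF _ order_refl at_le])
  moreover have "D 3 0 \<beta> 0 < 0"
    using init[OF P0 assms(1)] assms(2) by simp
  ultimately have "\<forall>\<^sub>F t in at_right 0. D 3 0 \<beta> t < 0"
    by (rule order_tendstoD(2))
  then obtain d where "d > 0" and d: "\<And>t. 0 < t \<Longrightarrow> t < d \<Longrightarrow> D 3 0 \<beta> t < 0"
    unfolding eventually_at_right_field by auto
  define x where "x = min \<epsilon> d"
  have x: "0 < x" "x \<le> \<epsilon>" "x \<le> d"
    using \<open>d > 0\<close> \<epsilon> by (auto simp: x_def)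
  have "\<exists>t>0. t < x \<and> F 0 \<beta> x = (\<Sum>m<3. D m 0 \<beta> 0 / fact m * x ^ m) + D 3 0 \<beta> t / fact 3 * x ^ 3"
  proof (rule Maclaurin[OF \<open>0 < x\<close>])
    show "\<forall>m t. m < 3 \<and> 0 \<le> t \<and> t \<le> x \<longrightarrow> (D m 0 \<beta> has_real_derivative D (Suc m) 0 \<beta> t) (at t)"
      using P0 assms x by (auto intro!: deriv)
  qed auto
  then obtain t where t: "0 < t" "t < x"
    "F 0 \<beta> x = (\<Sum>m<3. D m 0 \<beta> 0 / fact m * x ^ m) + D 3 0 \<beta> t / fact 3 * x ^ 3"
    by blast
  have "(\<Sum>m<3. D m 0 \<beta> 0 / fact m * x ^ m) = 0"
    using init[OF P0 assms(1)] by (simp add: numeral_eq_Suc)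
  moreover have "D 3 0 \<beta> t / fact 3 * x ^ 3 < 0"
    using d[of t] t x by (simp add: mult_neg_pos divide_neg_pos)
  ultimately show ?thesis
    using t(3) x by (intro bexI[of _ x]) auto
qed

lemma F_neg_left:
  assumes "\<alpha> \<in> P" "\<beta> \<in> P" "\<alpha> < 0"
  shows "\<exists>x\<in>{0<..\<epsilon>}. F \<alpha> \<beta> x < 0"
proof -
  have "(F \<alpha> \<beta> has_real_derivative \<alpha>) (at 0)"
    using deriv[OF assms(1,2), of 0 0] init[OF assms(1,2)] \<epsilon> by simp
  then obtain d where "d > 0" and d: "\<And>h. 0 < h \<Longrightarrow> h < d \<Longrightarrow> F \<alpha> \<beta> h < 0"
    using DERIV_neg_dec_right[of "F \<alpha> \<beta>" \<alpha> 0] assms(3) init[OF assms(1,2)] by auto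
  show ?thesis
    using d[of "min (d / 2) \<epsilon>"] \<open>d > 0\<close> \<epsilon> by (intro bexI[of _ "min (d / 2) \<epsilon>"]) auto
qed


end

text \<open>The parameter box is so small that \<open>F\<close> is still positive at the right end \<open>\<epsilon>\<close>; all
  equilibria that take part in the bifurcations lie in between.\<close>

locale bounded_quintic_unfolding = quintic_unfolding +
  assumes end_pos: "\<alpha> \<in> {- \<eta>..\<eta>} \<Longrightarrow> \<beta> \<in> {- \<eta>..\<eta>} \<Longrightarrow> 0 < D 0 \<alpha> \<beta> \<epsilon>"

lemma (in quintic_unfolding) restrict_to_bounded:
  "\<exists>\<eta>'. 0 < \<eta>' \<and> \<eta>' \<le> \<eta> \<and> bounded_quintic_unfolding D \<eta>' \<epsilon>"
proof -
  have 1: "continuous_on (P \<times> P) (\<lambda>p. (fst p, snd p, \<epsilon>))"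
    by (intro continuous_intros)
  have 2: "(\<lambda>p. (fst p, snd p, \<epsilon>)) ` (P \<times> P) \<subseteq> P \<times> P \<times> {0..\<epsilon>}"
    using \<epsilon> by auto
  have cont: "continuous_on (P \<times> P) (\<lambda>p. F (fst p) (snd p) \<epsilon>)"
    using continuous_on_compose2[OF cont0 1 2] by simp
  have pos: "0 < F 0 0 \<epsilon>"
    using F_pos[of 0 0 \<epsilon>] \<eta> \<epsilon> by simp
  have "(0, 0) \<in> P \<times> P"
    using \<eta> by simp
  from cont[unfolded continuous_on_iff, rule_format, OF this pos]
  obtain d where "d > 0" and d: "\<And>p. p \<in> P \<times> P \<Longrightarrow> dist p (0, 0) < d \<Longrightarrow> dist (F (fst p) (snd p) \<epsilon>) (F 0 0 \<epsilon>) < F 0 0 \<epsilon>"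
    unfolding fst_conv snd_conv by blast
  define \<eta>' where "\<eta>' = min \<eta> (d / 3)"
  have \<eta>': "0 < \<eta>'" "\<eta>' \<le> \<eta>" "\<eta>' \<le> d / 3"
    using \<eta> \<open>d > 0\<close> by (auto simp: \<eta>'_def)
  have "0 < F \<alpha> \<beta> \<epsilon>" if "\<alpha> \<in> {- \<eta>'..\<eta>'}" "\<beta> \<in> {- \<eta>'..\<eta>'}" for \<alpha> \<beta>
  proof -
    have "dist (\<alpha>, \<beta>) (0, 0) \<le> \<bar>\<alpha>\<bar> + \<bar>\<beta>\<bar>"
      using norm_Pair_le[of \<alpha> \<beta>] by (simp add: dist_norm)
    also have "\<dots> < d"
      using that \<eta>' \<open>d > 0\<close> by auto
    finally show ?thesis
      using d[of "(\<alpha>, \<beta>)"] that \<eta>' by (auto simp: dist_real_def)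
  qed
  moreover have "{- \<eta>'..\<eta>'} \<times> {- \<eta>'..\<eta>'} \<times> {0..\<epsilon>} \<subseteq> P \<times> P \<times> {0..\<epsilon>}"
    using \<eta>' by auto
  note continuous_on_subset[OF cont0 this] continuous_on_subset[OF cont1 this]
  ultimately have "bounded_quintic_unfolding D \<eta>' \<epsilon>"
    using \<eta>' \<epsilon> init D5_pos D3_mono
    by unfold_locales (auto intro!: deriv)
  with \<eta>' show ?thesis by blast
qed

text \<open>The sign pattern of \<open>F \<alpha> \<beta>\<close> on the positive half line is that of \<open>(x - p) * (x - q)\<close>: there are
  no positive equilibria for \<open>p = q = 0\<close>, one transversal equilibrium for \<open>p = 0 < q\<close>, a degenerate
  one for \<open>0 < p = q\<close>, and two for \<open>0 < p < q\<close>.\<close>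

definition sign_pattern :: "(real \<Rightarrow> real) \<Rightarrow> real \<Rightarrow> real \<Rightarrow> real \<Rightarrow> bool" where
  "sign_pattern f \<epsilon> p q \<longleftrightarrow> 0 \<le> p \<and> p \<le> q \<and> q < \<epsilon> \<and>
    (\<forall>x\<in>{0<..\<epsilon>}. sgn (f x) = sgn ((x - p) * (x - q)))"

context bounded_quintic_unfolding
begin

text \<open>By quasiconvexity \<open>{x. G \<alpha> \<beta> x \<le> 0}\<close> is an interval \<open>{p..q}\<close>, in whose interior \<open>G\<close> is negative.\<close>

lemma sign_pattern_exists:
  assumes "\<alpha> \<in> P" "\<beta> \<in> P"
  obtains p q where "sign_pattern (F \<alpha> \<beta>) \<epsilon> p q"
    "p = q \<longleftrightarrow> \<not> (\<exists>x\<in>{0<..\<epsilon>}. F \<alpha> \<beta> x < 0)" "p = 0 \<longleftrightarrow> \<alpha> \<le> 0 \<or> \<not> (\<exists>x\<in>{0<..\<epsilon>}. F \<alpha> \<beta> x \<le> 0)"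
proof -
  note cont = continuous_on_G_slice[OF assms]
  define S where "S = {x\<in>{0..\<epsilon>}. 0 \<le> - G \<alpha> \<beta> x}"
  have "compact S"
    unfolding S_def by (intro compact_Icc_superlevel continuous_on_minus cont)
  have sgn_F: "F \<alpha> \<beta> x < 0 \<longleftrightarrow> G \<alpha> \<beta> x < 0" "F \<alpha> \<beta> x \<le> 0 \<longleftrightarrow> G \<alpha> \<beta> x \<le> 0" if "0 < x" for x
    using that by (auto simp: G_def divide_less_0_iff divide_le_0_iff)
  show ?thesis
  proof (cases "S = {}")
    case True
    have pos: "0 < G \<alpha> \<beta> x" if "x \<in> {0..\<epsilon>}" for x
      using True that by (force simp: S_def)
    have "0 < F \<alpha> \<beta> x" if "x \<in> {0<..\<epsilon>}" for x
      using pos[of x] sgn_F[of x] that by force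
    then have "sign_pattern (F \<alpha> \<beta>) \<epsilon> 0 0" "\<not> (\<exists>x\<in>{0<..\<epsilon>}. F \<alpha> \<beta> x \<le> 0)"
      using \<epsilon> by (force simp: sign_pattern_def)+
    moreover from this(2) have "\<not> (\<exists>x\<in>{0<..\<epsilon>}. F \<alpha> \<beta> x < 0)"
      by (meson less_imp_le)
    ultimately show ?thesis
      using that[of 0 0] by blast
  next
    case False
    obtain p where "p \<in> S" and p: "\<And>x. x \<in> S \<Longrightarrow> p \<le> x"
      using compact_attains_inf[OF \<open>compact S\<close> False] by blast
    obtain q where "q \<in> S" and q: "\<And>x. x \<in> S \<Longrightarrow> x \<le> q"
      using compact_attains_sup[OF \<open>compact S\<close> False] by blast
    have pq: "0 \<le> p" "p \<le> q" "q \<le> \<epsilon>" "G \<alpha> \<beta> p \<le> 0" "G \<alpha> \<beta> q \<le> 0"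
      using \<open>p \<in> S\<close> \<open>q \<in> S\<close> q by (auto simp: S_def)
    have "0 < G \<alpha> \<beta> \<epsilon>"
      using end_pos[OF assms] \<epsilon> by (simp add: G_def)
    then have "q < \<epsilon>"
      using pq by (metis less_eq_real_def not_less)
    have out: "0 < G \<alpha> \<beta> x" if "x \<in> {0..\<epsilon>}" "x < p \<or> q < x" for x
      using p[of x] q[of x] that by (force simp: S_def)
    have ins: "G \<alpha> \<beta> x < 0" if "p < x" "x < q" for x
      by (rule G_quasiconvex[OF assms pq(1) that pq(3-5)])
    have "G \<alpha> \<beta> q = 0"
    proof (rule ccontr)
      assume "G \<alpha> \<beta> q \<noteq> 0"
      then have "G \<alpha> \<beta> q < 0" using pq by simp
      then obtain x where "q \<le> x" "x \<le> \<epsilon>" "G \<alpha> \<beta> x = G \<alpha> \<beta> q / 2"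
        using IVT'[of "G \<alpha> \<beta>" q "G \<alpha> \<beta> q / 2" \<epsilon>] \<open>0 < G \<alpha> \<beta> \<epsilon>\<close> pq continuous_on_subset[OF cont]
        by auto
      then show False
        using q[of x] \<open>G \<alpha> \<beta> q < 0\<close> pq by (auto simp: S_def)
    qed
    have Gp: "G \<alpha> \<beta> p = 0" if "0 < p"
    proof (rule ccontr)
      assume "G \<alpha> \<beta> p \<noteq> 0"
      then have "G \<alpha> \<beta> p < 0" using pq by simp
      moreover have "0 < G \<alpha> \<beta> 0"
        using out[of 0] that \<epsilon> by simp
      ultimately obtain x where "0 \<le> x" "x \<le> p" "G \<alpha> \<beta> x = G \<alpha> \<beta> p / 2"
        using IVT2'[of "G \<alpha> \<beta>" p "G \<alpha> \<beta> p / 2" 0] pq continuous_on_subset[OF cont]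
        by auto
      then show False
        using p[of x] \<open>G \<alpha> \<beta> p < 0\<close> pq by (auto simp: S_def)
    qed
    have "sgn (F \<alpha> \<beta> x) = sgn ((x - p) * (x - q))" if x: "x \<in> {0<..\<epsilon>}" for x
    proof -
      consider "x < p" | "x = p" | "p < x" "x < q" | "x = q" | "q < x" by linarith
      then have "sgn (G \<alpha> \<beta> x) = sgn ((x - p) * (x - q))"
      proof cases
        case 1
        then show ?thesis using out[of x] x pq by (simp add: sgn_mult)
      next
        case 2
        then show ?thesis using Gp x by simp
      next
        case 3
        then show ?thesis using ins by (simp add: sgn_mult)
      next
        case 4
        then show ?thesis using \<open>G \<alpha> \<beta> q = 0\<close> by simp
      next
        case 5
        then show ?thesis using out[of x] x pq by (simp add: sgn_mult)
      qed
      then show ?thesis using G_sign[of x \<alpha> \<beta>] x by simp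
    qed
    then have pattern: "sign_pattern (F \<alpha> \<beta>) \<epsilon> p q"
      using pq \<open>q < \<epsilon>\<close> by (simp add: sign_pattern_def)
    have "p = q \<longleftrightarrow> \<not> (\<exists>x\<in>{0<..\<epsilon>}. F \<alpha> \<beta> x < 0)"
    proof
      assume "p = q"
      show "\<not> (\<exists>x\<in>{0<..\<epsilon>}. F \<alpha> \<beta> x < 0)"
      proof
        assume "\<exists>x\<in>{0<..\<epsilon>}. F \<alpha> \<beta> x < 0"
        then obtain x where x: "x \<in> {0<..\<epsilon>}" "F \<alpha> \<beta> x < 0" by blast
        then have "(x - p) * (x - p) < 0"
          using pattern \<open>p = q\<close> unfolding sign_pattern_def by (metis sgn_less)
        then show False
          by (metis not_square_less_zero)
      qed
    next
      assume *: "\<not> (\<exists>x\<in>{0<..\<epsilon>}. F \<alpha> \<beta> x < 0)"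
      show "p = q"
      proof (rule ccontr)
        assume "p \<noteq> q"
        then have "F \<alpha> \<beta> ((p + q) / 2) < 0"
          using ins[of "(p + q) / 2"] sgn_F(1)[of "(p + q) / 2"] pq by simp
        then show False
          using * pq \<open>p \<noteq> q\<close> by auto
      qed
    qed
    moreover have "p = 0 \<longleftrightarrow> \<alpha> \<le> 0 \<or> \<not> (\<exists>x\<in>{0<..\<epsilon>}. F \<alpha> \<beta> x \<le> 0)"
    proof
      assume "p = 0"
      then show "\<alpha> \<le> 0 \<or> \<not> (\<exists>x\<in>{0<..\<epsilon>}. F \<alpha> \<beta> x \<le> 0)"
        using pq(4) by (simp add: G_def)
    next
      assume *: "\<alpha> \<le> 0 \<or> \<not> (\<exists>x\<in>{0<..\<epsilon>}. F \<alpha> \<beta> x \<le> 0)"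
      show "p = 0"
      proof (rule ccontr)
        assume "p \<noteq> 0"
        then have "0 < p" "p \<in> {0<..\<epsilon>}" "F \<alpha> \<beta> p \<le> 0"
          using pq sgn_F(2)[of p] by auto
        moreover have "0 < \<alpha>"
          using out[of 0] \<open>0 < p\<close> \<epsilon> by (simp add: G_def)
        ultimately show False using * by force
      qed
    qed
    ultimately show ?thesis using that pattern by blast
  qed
qed

text \<open>For \<open>\<alpha> > 0\<close> nonpositive values occur exactly for \<open>\<beta>\<close> up to the fold.\<close>

definition threshold :: "real \<Rightarrow> real" where
  "threshold \<alpha> = (if \<alpha> \<le> 0 then 0 else Sup {\<beta> \<in> P. \<exists>x\<in>{0<..\<epsilon>}. F \<alpha> \<beta> x \<le> 0})"

text \<open>The projection of a closed set along the compact interval \<open>{0..\<epsilon>}\<close>.\<close>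

lemma closed_nonpositive: "closed {p \<in> P \<times> P. \<exists>x\<in>{0..\<epsilon>}. G (fst p) (snd p) x \<le> 0}"
proof -
  define K where "K = {q \<in> P \<times> P \<times> {0..\<epsilon>}. (\<lambda>(\<alpha>, \<beta>, x). G \<alpha> \<beta> x) q \<le> 0}"
  have "closed ((P \<times> P \<times> {0..\<epsilon>}) \<inter> (\<lambda>(\<alpha>, \<beta>, x). G \<alpha> \<beta> x) -` {..0})"
    by (intro continuous_closed_preimage continuous_on_G closed_Times) auto
  moreover have K: "K = (P \<times> P \<times> {0..\<epsilon>}) \<inter> ((P \<times> P \<times> {0..\<epsilon>}) \<inter> (\<lambda>(\<alpha>, \<beta>, x). G \<alpha> \<beta> x) -` {..0})"
    by (auto simp: K_def)
  moreover have "compact (P \<times> P \<times> {0..\<epsilon>})"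
    by (intro compact_Times) auto
  ultimately have "compact K"
    unfolding K by (metis compact_Int_closed)
  then have "compact ((\<lambda>q. (fst q, fst (snd q))) ` K)"
    by (intro compact_continuous_image continuous_intros)
  moreover have "(\<lambda>q. (fst q, fst (snd q))) ` K = {p \<in> P \<times> P. \<exists>x\<in>{0..\<epsilon>}. G (fst p) (snd p) x \<le> 0}"
    by (force simp: K_def image_iff)
  ultimately show ?thesis
    by (simp add: compact_imp_closed)
qed

lemma nonpositive_iff:
  assumes "0 < \<alpha>"
  shows "(\<exists>x\<in>{0..\<epsilon>}. G \<alpha> \<beta> x \<le> 0) \<longleftrightarrow> (\<exists>x\<in>{0<..\<epsilon>}. F \<alpha> \<beta> x \<le> 0)"
proof -
  have "x \<in> {0..\<epsilon>} \<and> G \<alpha> \<beta> x \<le> 0 \<longleftrightarrow> x \<in> {0<..\<epsilon>} \<and> F \<alpha> \<beta> x \<le> 0" for x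
    using assms by (cases "x = 0") (auto simp: G_def divide_le_0_iff)
  then show ?thesis by blast
qed

lemma F_continuous_parameters:
  assumes "x \<in> {0..\<epsilon>}"
  shows "continuous_on (P \<times> P) (\<lambda>p. F (fst p) (snd p) x)"
proof -
  have 1: "continuous_on (P \<times> P) (\<lambda>p. (fst p, snd p, x))"
    by (intro continuous_intros)
  have 2: "(\<lambda>p. (fst p, snd p, x)) ` (P \<times> P) \<subseteq> P \<times> P \<times> {0..\<epsilon>}"
    using assms by auto
  show ?thesis
    using continuous_on_compose2[OF cont0 1 2] by simp
qed

lemma F_tendsto:
  assumes "x \<in> {0..\<epsilon>}" "\<alpha> \<in> {- \<eta><..<\<eta>}" "\<beta> \<in> P"
  shows "((\<lambda>\<alpha>. F \<alpha> \<beta> x) \<longlongrightarrow> F \<alpha> \<beta> x) (at \<alpha>)"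
proof -
  have 1: "continuous_on P (\<lambda>\<alpha>. (\<alpha>, \<beta>))"
    by (intro continuous_intros)
  have 2: "(\<lambda>\<alpha>. (\<alpha>, \<beta>)) ` P \<subseteq> P \<times> P"
    using assms by auto
  have "continuous_on P (\<lambda>\<alpha>. F \<alpha> \<beta> x)"
    using continuous_on_compose2[OF F_continuous_parameters[OF assms(1)] 1 2] by simp
  then have "isCont (\<lambda>\<alpha>. F \<alpha> \<beta> x) \<alpha>"
    using assms(2) by (intro continuous_on_interior[of P]) (auto simp: interior_atLeastAtMost_real)
  then show ?thesis by (simp add: isCont_def)
qed

text \<open>For \<open>\<alpha> > 0\<close> the set of \<open>\<beta>\<close> with a nonpositive value is a closed lower set because \<open>F\<close> increases
  with \<open>\<beta>\<close>; at its maximum the two equilibria merge.\<close>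

lemma threshold_pos:
  assumes "0 < \<alpha>" "\<alpha> \<le> \<eta>" and neg: "\<exists>x\<in>{0<..\<epsilon>}. F \<alpha> (- \<eta>) x < 0"
  shows "threshold \<alpha> \<in> P" "threshold \<alpha> < 0"
    and "\<beta> \<in> P \<Longrightarrow> (\<exists>x\<in>{0<..\<epsilon>}. F \<alpha> \<beta> x \<le> 0) \<longleftrightarrow> \<beta> \<le> threshold \<alpha>"
    and "\<beta> \<in> P \<Longrightarrow> (\<exists>x\<in>{0<..\<epsilon>}. F \<alpha> \<beta> x < 0) \<longleftrightarrow> \<beta> < threshold \<alpha>"
proof -
  have \<alpha>: "\<alpha> \<in> P" and P: "- \<eta> \<in> P" using assms \<eta> by auto
  define L where "L = {\<beta> \<in> P. \<exists>x\<in>{0<..\<epsilon>}. F \<alpha> \<beta> x \<le> 0}"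
  let ?\<kappa> = "threshold \<alpha>"
  have \<kappa>: "?\<kappa> = Sup L"
    using assms by (simp add: threshold_def L_def)
  have "L = (\<lambda>\<beta>. (\<alpha>, \<beta>)) -` {p \<in> P \<times> P. \<exists>x\<in>{0..\<epsilon>}. G (fst p) (snd p) x \<le> 0}"
    using \<alpha> by (auto simp: L_def nonpositive_iff[OF \<open>0 < \<alpha>\<close>])
  moreover have "isCont (\<lambda>\<beta>. (\<alpha>, \<beta>)) \<beta>" for \<beta>
    by (intro continuous_intros)
  ultimately have "closed L"
    using continuous_closed_vimage[OF closed_nonpositive, of "\<lambda>\<beta>. (\<alpha>, \<beta>)"] by simp
  have "- \<eta> \<in> L"
    using neg P by (force simp: L_def)
  moreover have bdd: "bdd_above L"
    by (rule bdd_aboveI[of _ \<eta>]) (auto simp: L_def)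
  ultimately have \<kappa>L: "?\<kappa> \<in> L"
    unfolding \<kappa> using \<open>closed L\<close> by (intro closed_contains_Sup) auto
  then show \<kappa>P: "?\<kappa> \<in> P" by (simp add: L_def)
  obtain x1 where x1: "x1 \<in> {0<..\<epsilon>}" "F \<alpha> ?\<kappa> x1 \<le> 0"
    using \<kappa>L by (auto simp: L_def)
  have upper: "\<beta> \<le> ?\<kappa>" if "\<beta> \<in> P" "\<exists>x\<in>{0<..\<epsilon>}. F \<alpha> \<beta> x \<le> 0" for \<beta>
    unfolding \<kappa> using that bdd by (intro cSup_upper) (auto simp: L_def)
  show \<kappa>neg: "?\<kappa> < 0"
    using F_pos[OF \<alpha> \<kappa>P, of x1] x1 \<open>0 < \<alpha>\<close> by force
  have below: "\<exists>x\<in>{0<..\<epsilon>}. F \<alpha> \<beta> x < 0" if "\<beta> \<in> P" "\<beta> < ?\<kappa>" for \<beta>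
    using F_mono[OF \<alpha> that(1) \<kappa>P that(2), of x1] x1 by force
  show "(\<exists>x\<in>{0<..\<epsilon>}. F \<alpha> \<beta> x \<le> 0) \<longleftrightarrow> \<beta> \<le> ?\<kappa>" if "\<beta> \<in> P"
    using upper[OF that] below[OF that] x1 by (cases "\<beta> = ?\<kappa>") force+
  show "(\<exists>x\<in>{0<..\<epsilon>}. F \<alpha> \<beta> x < 0) \<longleftrightarrow> \<beta> < ?\<kappa>" if "\<beta> \<in> P"
  proof
    assume "\<exists>x\<in>{0<..\<epsilon>}. F \<alpha> \<beta> x < 0"
    then obtain x where x: "x \<in> {0<..\<epsilon>}" "F \<alpha> \<beta> x < 0" by blast
    have "\<beta> \<noteq> ?\<kappa>"
    proof
      assume "\<beta> = ?\<kappa>"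
      have 1: "continuous_on P (\<lambda>\<beta>. (\<alpha>, \<beta>))"
        by (intro continuous_intros)
      have 2: "(\<lambda>\<beta>. (\<alpha>, \<beta>)) ` P \<subseteq> P \<times> P"
        using \<alpha> by auto
      have "continuous_on P (\<lambda>\<beta>. F \<alpha> \<beta> x)"
        using continuous_on_compose2[OF F_continuous_parameters 1 2, of x] x by simp
      then have "((\<lambda>\<beta>. F \<alpha> \<beta> x) \<longlongrightarrow> F \<alpha> \<beta> x) (at \<beta> within P)"
        using \<open>\<beta> \<in> P\<close> unfolding continuous_on_def by blast
      then have "((\<lambda>\<beta>. F \<alpha> \<beta> x) \<longlongrightarrow> F \<alpha> \<beta> x) (at \<beta> within {\<beta><..<\<eta>})"
        using \<open>\<beta> \<in> P\<close> by (elim tendsto_within_subset) auto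
      then have "\<forall>\<^sub>F b in at \<beta> within {\<beta><..<\<eta>}. F \<alpha> b x < 0"
        using x(2) by (rule order_tendstoD(2))
      moreover have "\<forall>\<^sub>F b in at \<beta> within {\<beta><..<\<eta>}. b \<in> {\<beta><..<\<eta>}"
        by (simp add: eventually_at_filter)
      moreover have "at \<beta> within {\<beta><..<\<eta>} \<noteq> bot"
        using \<kappa>neg \<eta> \<open>\<beta> = ?\<kappa>\<close> by (simp add: at_within_eq_bot_iff)
      ultimately obtain b where b: "F \<alpha> b x < 0" "b \<in> {\<beta><..<\<eta>}"
        by (metis (no_types, lifting) eventually_conj eventually_happens)
      then have "b \<in> P" using \<open>\<beta> \<in> P\<close> by simp
      then have "b \<le> ?\<kappa>"
        using upper[of b] b x by force
      then show False using b \<open>\<beta> = ?\<kappa>\<close> by simp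
    qed
    moreover have "\<beta> \<le> ?\<kappa>"
      using upper[OF \<open>\<beta> \<in> P\<close>] x by force
    ultimately show "\<beta> < ?\<kappa>" by simp
  qed (use below that in blast)
qed

text \<open>The fold is a graph over \<open>\<alpha>\<close>, extended by the half axis \<open>\<alpha> \<le> 0\<close>: on \<open>\<alpha> = 0\<close> the value \<open>0\<close>
  separates the two kinds of pitchfork bifurcation.\<close>

lemma threshold_describes_pattern:
  assumes neg: "\<exists>x\<in>{0<..\<epsilon>}. F \<alpha> (- \<eta>) x < 0" and "\<alpha> \<in> P" "\<beta> \<in> P"
  shows "\<exists>p q. sign_pattern (F \<alpha> \<beta>) \<epsilon> p q \<and>
    (p = q \<longleftrightarrow> 0 \<le> \<alpha> \<and> threshold \<alpha> \<le> \<beta>) \<and> (p = 0 \<longleftrightarrow> \<alpha> \<le> 0 \<or> threshold \<alpha> < \<beta>)"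
proof -
  obtain p q where pq: "sign_pattern (F \<alpha> \<beta>) \<epsilon> p q"
    "p = q \<longleftrightarrow> \<not> (\<exists>x\<in>{0<..\<epsilon>}. F \<alpha> \<beta> x < 0)" "p = 0 \<longleftrightarrow> \<alpha> \<le> 0 \<or> \<not> (\<exists>x\<in>{0<..\<epsilon>}. F \<alpha> \<beta> x \<le> 0)"
    by (rule sign_pattern_exists[OF assms(2,3)])
  have "(\<exists>x\<in>{0<..\<epsilon>}. F \<alpha> \<beta> x < 0) \<longleftrightarrow> \<not> (0 \<le> \<alpha> \<and> threshold \<alpha> \<le> \<beta>)"
  proof (cases \<alpha> "0 :: real" rule: linorder_cases)
    case less
    then show ?thesis using F_neg_left[OF assms(2,3)] by simp
  next
    case equal
    have "\<not> (\<exists>x\<in>{0<..\<epsilon>}. F 0 \<beta> x < 0)" if "0 \<le> \<beta>"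
      using F_pos[of 0 \<beta>] that assms(3) \<eta> by force
    then show ?thesis
      using equal F_neg_right[OF assms(3)] by (force simp: threshold_def)
  next
    case greater
    then show ?thesis using threshold_pos(4)[OF greater _ neg assms(3)] assms(2) by auto
  qed
  moreover have "(\<exists>x\<in>{0<..\<epsilon>}. F \<alpha> \<beta> x \<le> 0) \<longleftrightarrow> \<beta> \<le> threshold \<alpha>" if "0 < \<alpha>"
    using threshold_pos(3)[OF that _ neg assms(3)] assms(2) by auto
  ultimately have "(p = q \<longleftrightarrow> 0 \<le> \<alpha> \<and> threshold \<alpha> \<le> \<beta>) \<and> (p = 0 \<longleftrightarrow> \<alpha> \<le> 0 \<or> threshold \<alpha> < \<beta>)"
    using pq(2,3) by (cases "0 < \<alpha>") auto
  with pq(1) show ?thesis by blast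
qed

text \<open>\<open>c < threshold \<alpha>\<close> means that some value at \<open>(\<alpha>, c)\<close> is negative, an open condition; \<open>threshold \<alpha> < c\<close> means for
  \<open>\<alpha> > 0\<close> that all values of \<open>G\<close> are positive, which is open by compactness.  At \<open>\<alpha> = 0\<close> the upper
  bound holds since the threshold is nowhere positive.\<close>

lemma continuous_on_threshold:
  assumes neg: "\<And>\<alpha>. \<alpha> \<in> {- d<..<d} \<Longrightarrow> \<exists>x\<in>{0<..\<epsilon>}. F \<alpha> (- \<eta>) x < 0" and d: "0 < d" "d \<le> \<eta>"
  shows "continuous_on {- d<..<d} threshold"
proof -
  have "(threshold \<longlongrightarrow> threshold \<alpha>) (at \<alpha>)" if \<alpha>: "\<alpha> \<in> {- d<..<d}" for \<alpha>
  proof (rule order_tendstoI)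
    have \<alpha>P: "\<alpha> \<in> {- \<eta><..<\<eta>}" using \<alpha> d by auto
    have near: "\<forall>\<^sub>F a in at \<alpha>. a \<in> {- d<..<d}"
      using \<alpha> by (intro eventually_at_in_open') auto
    have nonpos: "threshold a \<le> 0" if "a \<in> {- d<..<d}" for a
      using threshold_pos(2)[OF _ _ neg[OF that]] that d by (cases "0 < a") (auto simp: threshold_def)
    {
      fix c assume c: "c < threshold \<alpha>"
      have "\<forall>\<^sub>F a in at \<alpha>. a < 0 \<or> c < threshold a"
      proof (cases "c < - \<eta> \<or> \<alpha> < 0")
        case True
        then show ?thesis
        proof
          assume "c < - \<eta>"
          show ?thesis
            using near
          proof eventually_elim
            case (elim a)
            have "- \<eta> \<le> threshold a"
              using threshold_pos(1)[OF _ _ neg[OF elim]] elim d \<eta> by (cases "0 < a") (auto simp: threshold_def)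
            then show ?case using \<open>c < - \<eta>\<close> by simp
          qed
        next
          assume "\<alpha> < 0"
          then have "\<forall>\<^sub>F a in at \<alpha>. a < 0"
            by (intro order_tendstoD(2)[OF tendsto_ident_at])
          then show ?thesis by eventually_elim simp
        qed
      next
        case False
        then have cP: "c \<in> P" and "0 \<le> \<alpha>"
          using c nonpos[OF \<alpha>] \<eta> by auto
        have "\<exists>x\<in>{0<..\<epsilon>}. F \<alpha> c x < 0"
        proof (cases "\<alpha> = 0")
          case True
          then show ?thesis using F_neg_right[OF cP] c by (simp add: threshold_def)
        next
          case False
          then show ?thesis
            using threshold_pos(4)[OF _ _ neg[OF \<alpha>] cP] \<open>0 \<le> \<alpha>\<close> \<alpha>P c by auto
        qed
        then obtain x where x: "x \<in> {0<..\<epsilon>}" "F \<alpha> c x < 0" by blast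
        have "\<forall>\<^sub>F a in at \<alpha>. F a c x < 0"
          using F_tendsto[of x \<alpha> c] x \<alpha>P cP by (intro order_tendstoD(2)) auto
        then show ?thesis
          using near
        proof eventually_elim
          case (elim a)
          show ?case
          proof (cases a "0 :: real" rule: linorder_cases)
            case greater
            then show ?thesis
              using threshold_pos(4)[OF greater _ neg[OF elim(2)] cP] elim x(1) d by auto
          next
            case equal
            then have "c < 0"
              using F_pos[of 0 c x] elim(1) x(1) cP \<eta> by force
            then show ?thesis by (simp add: equal threshold_def)
          qed simp
        qed
      qed
      then show "\<forall>\<^sub>F a in at \<alpha>. c < threshold a"
        by eventually_elim (use c nonpos[OF \<alpha>] in \<open>auto simp: threshold_def\<close>)
    next
      fix c assume c: "threshold \<alpha> < c"
      show "\<forall>\<^sub>F a in at \<alpha>. threshold a < c"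
      proof (cases "0 < c \<or> \<alpha> \<le> 0")
        case True
        then have "0 < c" using c by (auto simp: threshold_def)
        from near show ?thesis
          by eventually_elim (use nonpos \<open>0 < c\<close> in force)
      next
        case False
        then have "0 < \<alpha>" "c \<le> 0" by auto
        have cP: "c \<in> P"
          using threshold_pos(1)[OF \<open>0 < \<alpha>\<close> _ neg[OF \<alpha>]] c \<open>c \<le> 0\<close> \<alpha>P \<eta> by auto
        let ?N = "{p \<in> P \<times> P. \<exists>x\<in>{0..\<epsilon>}. G (fst p) (snd p) x \<le> 0}"
        have "(\<alpha>, c) \<notin> ?N"
          using threshold_pos(3)[OF \<open>0 < \<alpha>\<close> _ neg[OF \<alpha>] cP] nonpositive_iff[OF \<open>0 < \<alpha>\<close>, of c] c \<alpha>P
          by auto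
        moreover have "((\<lambda>a. (a, c)) \<longlongrightarrow> (\<alpha>, c)) (at \<alpha>)"
          by (intro tendsto_intros)
        ultimately have "\<forall>\<^sub>F a in at \<alpha>. (a, c) \<in> - ?N"
          using closed_nonpositive by (intro topological_tendstoD) (auto simp: open_Compl)
        moreover have "\<forall>\<^sub>F a in at \<alpha>. 0 < a"
          using \<open>0 < \<alpha>\<close> by (intro order_tendstoD(1)[OF tendsto_ident_at])
        ultimately show ?thesis
          using near
        proof eventually_elim
          case (elim a)
          then have "\<not> (\<exists>x\<in>{0<..\<epsilon>}. F a c x \<le> 0)"
            using nonpositive_iff[of a c] cP d by auto
          then show ?case
            using threshold_pos(3)[OF elim(2) _ neg[OF elim(3)] cP] elim d by auto
        qed
      qed
    }
  qed
  then show ?thesis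
    by (auto simp: continuous_on_def intro: tendsto_within_subset[OF _ subset_UNIV])
qed

theorem fold_graph:
  obtains d \<kappa> where "0 < d" "d \<le> \<eta>" "continuous_on {- d<..<d} \<kappa>" "\<kappa> 0 = 0"
    "\<And>\<alpha> \<beta>. \<alpha> \<in> {- d<..<d} \<Longrightarrow> \<beta> \<in> {- d<..<d} \<Longrightarrow> \<exists>p q. sign_pattern (F \<alpha> \<beta>) \<epsilon> p q \<and>
      (p = q \<longleftrightarrow> 0 \<le> \<alpha> \<and> \<kappa> \<alpha> \<le> \<beta>) \<and> (p = 0 \<longleftrightarrow> \<alpha> \<le> 0 \<or> \<kappa> \<alpha> < \<beta>)"
proof -
  have P: "- \<eta> \<in> P" using \<eta> by simp
  obtain x where x: "x \<in> {0<..\<epsilon>}" "F 0 (- \<eta>) x < 0"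
    using F_neg_right[OF P] \<eta> by auto
  have "\<forall>\<^sub>F \<alpha> in at 0. F \<alpha> (- \<eta>) x < 0"
    using F_tendsto[of x 0 "- \<eta>"] x P \<eta> by (intro order_tendstoD(2)) auto
  then obtain d0 where "0 < d0" and d0: "\<And>\<alpha>. \<alpha> \<noteq> 0 \<Longrightarrow> \<bar>\<alpha>\<bar> < d0 \<Longrightarrow> F \<alpha> (- \<eta>) x < 0"
    unfolding eventually_at by (auto simp: dist_real_def)
  define d where "d = min d0 \<eta>"
  have d: "0 < d" "d \<le> \<eta>" "d \<le> d0"
    using \<open>0 < d0\<close> \<eta> by (auto simp: d_def)
  have neg: "\<exists>x\<in>{0<..\<epsilon>}. F \<alpha> (- \<eta>) x < 0" if "\<alpha> \<in> {- d<..<d}" for \<alpha>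
    using d0[of \<alpha>] x that d by (cases "\<alpha> = 0") (auto intro!: bexI[of _ x])
  show ?thesis
  proof (rule that[of d threshold])
    show "continuous_on {- d<..<d} threshold"
      using neg d by (intro continuous_on_threshold)
    show "\<exists>p q. sign_pattern (F \<alpha> \<beta>) \<epsilon> p q \<and>
      (p = q \<longleftrightarrow> 0 \<le> \<alpha> \<and> threshold \<alpha> \<le> \<beta>) \<and> (p = 0 \<longleftrightarrow> \<alpha> \<le> 0 \<or> threshold \<alpha> < \<beta>)"
      if "\<alpha> \<in> {- d<..<d}" "\<beta> \<in> {- d<..<d}" for \<alpha> \<beta>
      using that d by (intro threshold_describes_pattern neg) auto
  qed (use d in \<open>auto simp: threshold_def\<close>)
qed

end

section \<open>Determinacy\<close>

definition clip :: "real \<Rightarrow> real \<Rightarrow> real" where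
  "clip r x = max (- r) (min r x)"

text \<open>The odd piecewise linear map with vertices \<open>(p, p')\<close>, \<open>(q, q')\<close> and \<open>(\<epsilon>, \<delta>)\<close>.\<close>

lemma odd_piecewise_linear_map:
  assumes "0 \<le> p" "p \<le> q" "q < \<epsilon>" "0 \<le> p'" "p' \<le> q'" "q' < \<delta>"
    and p: "p = 0 \<longleftrightarrow> p' = 0" and pq: "p = q \<longleftrightarrow> p' = q'"
  obtains h :: "real \<Rightarrow> real" where "strict_mono h" "continuous_on UNIV h" "\<And>x. h (- x) = - h x"
    "h p = p'" "h q = q'" "h \<epsilon> = \<delta>"
proof -
  define s1 where "s1 = (if p = 0 then 1 else p' / p)"
  define s2 where "s2 = (if p = q then 1 else (q' - p') / (q - p))"
  define s3 where "s3 = (\<delta> - q') / (\<epsilon> - q)"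
  define h where "h x = s1 * clip p x + s2 * (clip q x - clip p x) + s3 * (x - clip q x)" for x
  define m where "m = min s1 (min s2 s3)"
  have "0 < s1" "0 < s2" "0 < s3"
    using assms by (auto simp: s1_def s2_def s3_def)
  then have "0 < m" and m: "m \<le> s1" "m \<le> s2" "m \<le> s3"
    by (auto simp: m_def)
  have "strict_mono h"
  proof
    fix x y :: real assume "x < y"
    have inc: "0 \<le> clip p y - clip p x" "0 \<le> (clip q y - clip p y) - (clip q x - clip p x)"
      "0 \<le> (y - clip q y) - (x - clip q x)"
      using \<open>x < y\<close> assms(1,2) by (auto simp: clip_def max_def min_def)
    have "h y - h x = s1 * (clip p y - clip p x) + s2 * ((clip q y - clip p y) - (clip q x - clip p x))
        + s3 * ((y - clip q y) - (x - clip q x))"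
      by (simp add: h_def algebra_simps)
    also have "\<dots> \<ge> m * (clip p y - clip p x) + m * ((clip q y - clip p y) - (clip q x - clip p x))
        + m * ((y - clip q y) - (x - clip q x))"
      by (intro add_mono mult_right_mono m inc)
    also have "m * (clip p y - clip p x) + m * ((clip q y - clip p y) - (clip q x - clip p x))
        + m * ((y - clip q y) - (x - clip q x)) = m * (y - x)"
      by (simp add: algebra_simps)
    finally have "m * (y - x) \<le> h y - h x" .
    moreover have "0 < m * (y - x)"
      using \<open>0 < m\<close> \<open>x < y\<close> by simp
    ultimately show "h x < h y" by linarith
  qed
  moreover have "continuous_on UNIV h"
    unfolding h_def clip_def by (intro continuous_intros)
  moreover have "h (- x) = - h x" for x
  proof -
    have "clip r (- x) = - clip r x" if "0 \<le> r" for r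
      using that by (auto simp: clip_def max_def min_def)
    then show ?thesis
      using assms(1,2) by (simp add: h_def algebra_simps)
  qed
  moreover have clip_id: "clip r x = x" if "0 \<le> x" "x \<le> r" for r x
    using that by (auto simp: clip_def)
  moreover have clip_top: "clip r x = r" if "0 \<le> r" "r \<le> x" for r x
    using that by (auto simp: clip_def)
  have seg: "s1 * p = p'" "s2 * (q - p) = q' - p'" "s3 * (\<epsilon> - q) = \<delta> - q'"
    using assms by (auto simp: s1_def s2_def s3_def)
  have "h p = p'" "h q = q'" "h \<epsilon> = \<delta>"
    unfolding h_def using assms(1-3) seg
    by (simp_all add: clip_id[of p p] clip_id[of p q] clip_id[of q q] clip_top[of p q] clip_top[of p \<epsilon>] clip_top[of q \<epsilon>])
  ultimately show ?thesis using that by blast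
qed

text \<open>Orbits of a scalar equation are determined by the sign of its right-hand side.\<close>

lemma reaches_transfer:
  assumes h: "strict_mono h" "continuous_on UNIV h" "h a = c" "h b = d"
    and sgn: "\<And>w. w \<in> {a..b} \<Longrightarrow> sgn (f w) = sgn (g (h w))"
    and lip: "L-lipschitz_on {a..b} f" "M-lipschitz_on {c..d} g"
    and xy: "x \<in> {a..b}" "y \<in> {a..b}"
  shows "reaches f {a..b} x y \<longleftrightarrow> reaches g {c..d} (h x) (h y)"
proof -
  have mono: "h u \<le> h v \<longleftrightarrow> u \<le> v" "h u < h v \<longleftrightarrow> u < v" "h u = h v \<longleftrightarrow> u = v" for u v
    using h(1) by (simp_all add: strict_mono_less_eq strict_mono_less strict_mono_eq)
  have image: "h ` {u..v} = {h u..h v}" if "u \<le> v" for u v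
  proof
    show "h ` {u..v} \<subseteq> {h u..h v}" using mono by auto
    show "{h u..h v} \<subseteq> h ` {u..v}"
      using IVT'[of h u _ v] that continuous_on_subset[OF h(2)] by fastforce
  qed
  have "h x \<in> {c..d}" "h y \<in> {c..d}"
    using xy h(3,4) mono by auto
  then have "reaches g {c..d} (h x) (h y) \<longleftrightarrow> x = y \<or> (x < y \<and> (\<forall>w\<in>{h x..h y}. 0 < g w)) \<or>
      (y < x \<and> (\<forall>w\<in>{h y..h x}. g w < 0))"
    using reaches_iff[OF _ lip(2)] mono by simp
  moreover have "reaches f {a..b} x y \<longleftrightarrow> x = y \<or> (x < y \<and> (\<forall>w\<in>{x..y}. 0 < f w)) \<or>
      (y < x \<and> (\<forall>w\<in>{y..x}. f w < 0))"
    using reaches_iff[OF _ lip(1)] xy by simp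
  moreover have "(\<forall>w\<in>{h u..h v}. 0 < g w) \<longleftrightarrow> (\<forall>w\<in>{u..v}. 0 < f w)"
    "(\<forall>w\<in>{h u..h v}. g w < 0) \<longleftrightarrow> (\<forall>w\<in>{u..v}. f w < 0)"
    if "u < v" "u \<in> {a..b}" "v \<in> {a..b}" for u v
  proof -
    have "sgn (f w) = sgn (g (h w))" if "w \<in> {u..v}" for w
      using sgn that \<open>u \<in> {a..b}\<close> \<open>v \<in> {a..b}\<close> by auto
    then have "0 < f w \<longleftrightarrow> 0 < g (h w)" "f w < 0 \<longleftrightarrow> g (h w) < 0" if "w \<in> {u..v}" for w
      using that by (metis sgn_greater, metis sgn_less)
    then show "(\<forall>w\<in>{h u..h v}. 0 < g w) \<longleftrightarrow> (\<forall>w\<in>{u..v}. 0 < f w)"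
      "(\<forall>w\<in>{h u..h v}. g w < 0) \<longleftrightarrow> (\<forall>w\<in>{u..v}. f w < 0)"
      using \<open>u < v\<close> by (simp_all flip: image)
  qed
  ultimately show ?thesis using xy by blast
qed

text \<open>The vertices of the piecewise linear map are the zeros; the common factor \<open>s\<close> reverses time in both
  equations if it is negative.\<close>

lemma same_pattern_equivalent:
  assumes f: "sign_pattern f \<epsilon> p q" and g: "sign_pattern g \<delta> p' q'"
    and "p = 0 \<longleftrightarrow> p' = 0" "p = q \<longleftrightarrow> p' = q'"
    and odd: "\<And>x. x \<in> {- \<epsilon>..\<epsilon>} \<Longrightarrow> f (- x) = - f x" "\<And>x. x \<in> {- \<delta>..\<delta>} \<Longrightarrow> g (- x) = - g x"
    and lip: "L-lipschitz_on {- \<epsilon>..\<epsilon>} f'" "M-lipschitz_on {- \<delta>..\<delta>} g'"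
    and f': "\<And>x. f x = s * f' x" and g': "\<And>x. g x = s * g' x" and "s \<noteq> 0"
  shows "\<exists>h h'. homeomorphism {- \<epsilon>..\<epsilon>} {- \<delta>..\<delta>} h h' \<and> (\<forall>x\<in>{- \<epsilon>..\<epsilon>}. h (- x) = - h x) \<and>
    (\<forall>x\<in>{- \<epsilon>..\<epsilon>}. \<forall>y\<in>{- \<epsilon>..\<epsilon>}. reaches f' {- \<epsilon>..\<epsilon>} x y \<longleftrightarrow> reaches g' {- \<delta>..\<delta>} (h x) (h y))"
proof -
  have pq: "0 \<le> p" "p \<le> q" "q < \<epsilon>" "0 \<le> p'" "p' \<le> q'" "q' < \<delta>"
    using f g by (auto simp: sign_pattern_def)
  obtain h where h: "strict_mono h" "continuous_on UNIV h" "\<And>x. h (- x) = - h x"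
    "h p = p'" "h q = q'" "h \<epsilon> = \<delta>"
    using odd_piecewise_linear_map[OF pq assms(3,4)] by blast
  have h_minus: "h (- \<epsilon>) = - \<delta>"
    using h(3)[of \<epsilon>] h(6) by simp
  have mono: "h u \<le> h v \<longleftrightarrow> u \<le> v" "h u < h v \<longleftrightarrow> u < v" for u v
    using h(1) by (simp_all add: strict_mono_less_eq strict_mono_less)
  have image: "h ` {- \<epsilon>..\<epsilon>} = {- \<delta>..\<delta>}"
  proof
    show "h ` {- \<epsilon>..\<epsilon>} \<subseteq> {- \<delta>..\<delta>}"
      using mono h(6) h_minus by (metis atLeastAtMost_iff image_subsetI)
    show "{- \<delta>..\<delta>} \<subseteq> h ` {- \<epsilon>..\<epsilon>}"
      using IVT'[of h "- \<epsilon>" _ \<epsilon>] h_minus h(6) pq continuous_on_subset[OF h(2)] by fastforce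
  qed
  have "inj_on h {- \<epsilon>..\<epsilon>}"
    using strict_mono_imp_inj_on[OF h(1)] inj_on_subset by blast
  then obtain h' where h': "homeomorphism {- \<epsilon>..\<epsilon>} {- \<delta>..\<delta>} h h'"
    using homeomorphism_compact[of "{- \<epsilon>..\<epsilon>}" h "{- \<delta>..\<delta>}"] image continuous_on_subset[OF h(2)]
    by auto
  have sgn_diff: "sgn (h u - h v) = sgn (u - v)" for u v
    using mono[of u v] mono[of v u] by (auto simp: sgn_if)
  have "h 0 = 0" using h(3)[of 0] by simp
  have pos: "sgn (f x) = sgn (g (h x))" if "x \<in> {0<..\<epsilon>}" for x
  proof -
    have "h x \<in> {0<..\<delta>}"
      using that mono[of 0 x] mono[of x \<epsilon>] \<open>h 0 = 0\<close> h(6) by auto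
    then have "sgn (g (h x)) = sgn (h x - h p) * sgn (h x - h q)"
      using g h(4,5) by (simp add: sign_pattern_def sgn_mult)
    also have "\<dots> = sgn (f x)"
      using f that by (simp add: sign_pattern_def sgn_mult sgn_diff)
    finally show ?thesis by simp
  qed
  have "sgn (f x) = sgn (g (h x))" if x: "x \<in> {- \<epsilon>..\<epsilon>}" for x
  proof -
    consider "0 < x" | "x = 0" | "x < 0" by linarith
    then show ?thesis
    proof cases
      case 1
      then show ?thesis using pos x by simp
    next
      case 2
      have "f 0 = 0" "g 0 = 0"
        using odd(1)[of 0] odd(2)[of 0] pq by auto
      then show ?thesis using 2 \<open>h 0 = 0\<close> by simp
    next
      case 3
      have "h x \<in> {- \<delta>..\<delta>}" using image x by blast
      then show ?thesis
        using pos[of "- x"] 3 x odd(1)[of x] odd(2)[of "h x"] h(3)[of x] by (simp add: sgn_minus)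
    qed
  qed
  then have "sgn s * sgn (f' x) = sgn s * sgn (g' (h x))" if "x \<in> {- \<epsilon>..\<epsilon>}" for x
    using that by (simp only: f' g' sgn_mult[symmetric])
  then have "sgn (f' x) = sgn (g' (h x))" if "x \<in> {- \<epsilon>..\<epsilon>}" for x
    using that \<open>s \<noteq> 0\<close> by (simp add: sgn_0_0)
  then have "\<forall>x\<in>{- \<epsilon>..\<epsilon>}. \<forall>y\<in>{- \<epsilon>..\<epsilon>}. reaches f' {- \<epsilon>..\<epsilon>} x y \<longleftrightarrow> reaches g' {- \<delta>..\<delta>} (h x) (h y)"
    using reaches_transfer[OF h(1,2) h_minus h(6) _ lip] by blast
  with h' h(3) show ?thesis by blast
qed

text \<open>A shear of the parameter plane along the second coordinate moves the graph of \<open>\<kappa>1\<close> onto that of \<open>\<kappa>2\<close>; it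
  fixes the first coordinate, the slope of the field at the origin.  The domain is cut down to the
  points for which both sides are in their boxes.\<close>

lemma fold_shear:
  fixes \<kappa>1 \<kappa>2 :: "real \<Rightarrow> real"
  assumes d: "0 < d1" "0 < d2" and s: "\<bar>s\<bar> = 1"
    and \<kappa>1: "continuous_on {- d1<..<d1} \<kappa>1" "\<kappa>1 0 = 0" and \<kappa>2: "continuous_on {- d2<..<d2} \<kappa>2" "\<kappa>2 0 = 0"
  obtains N N' \<Phi> \<Phi>' where "open N" "open N'" "0 \<in> N" "homeomorphism N N' \<Phi> \<Phi>'" "\<Phi> 0 = 0"
    "\<And>\<nu>. \<nu> \<in> N \<Longrightarrow> \<bar>fst \<nu>\<bar> < d1 \<and> \<bar>snd \<nu>\<bar> < d1 \<and> \<bar>fst (\<Phi> \<nu>)\<bar> < d2 \<and> \<bar>snd (\<Phi> \<nu>)\<bar> < d2"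
    "\<And>\<nu>. fst (\<Phi> \<nu>) = fst \<nu>" "\<And>\<nu>. s * snd (\<Phi> \<nu>) - \<kappa>2 (s * fst \<nu>) = s * snd \<nu> - \<kappa>1 (s * fst \<nu>)"
proof -
  have ss: "s * s = 1"
    using s by (metis abs_mult_self_eq mult_1)
  define d where "d = min d1 d2"
  define \<tau> where "\<tau> a = s * (\<kappa>2 (s * a) - \<kappa>1 (s * a))" for a
  define \<Phi> where "\<Phi> \<nu> = (fst \<nu>, snd \<nu> + \<tau> (fst \<nu>))" for \<nu> :: "real \<times> real"
  define \<Phi>' where "\<Phi>' \<nu> = (fst \<nu>, snd \<nu> - \<tau> (fst \<nu>))" for \<nu> :: "real \<times> real"
  define B where "B r = {- r<..<r} \<times> {- r<..<r}" for r :: real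
  define S where "S = {- d<..<d} \<times> (UNIV :: real set)"
  have "s * a \<in> {- r<..<r}" if "a \<in> {- r<..<r}" for a r
    using that s by (auto simp: abs_if split: if_splits)
  then have "continuous_on {- d<..<d} \<tau>"
    unfolding \<tau>_def using s
    by (intro continuous_intros continuous_on_compose2[OF \<kappa>1(1)] continuous_on_compose2[OF \<kappa>2(1)])
      (auto simp: d_def)
  then have "continuous_on S (\<lambda>\<nu>. \<tau> (fst \<nu>))"
    unfolding S_def by (rule continuous_on_compose2) (auto intro: continuous_intros)
  then have cont: "continuous_on S \<Phi>" "continuous_on S \<Phi>'"
    unfolding \<Phi>_def \<Phi>'_def by (auto intro!: continuous_intros)
  have "open S" "open (B r)" for r
    by (auto simp: S_def B_def intro: open_Times)
  define N where "N = S \<inter> \<Phi> -` B d2 \<inter> B d1"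
  define N' where "N' = S \<inter> \<Phi>' -` B d1 \<inter> B d2"
  have inv: "\<Phi>' (\<Phi> \<nu>) = \<nu>" "\<Phi> (\<Phi>' \<nu>) = \<nu>" for \<nu>
    by (simp_all add: \<Phi>_def \<Phi>'_def)
  have S: "\<Phi> \<nu> \<in> S \<longleftrightarrow> \<nu> \<in> S" "\<Phi>' \<nu> \<in> S \<longleftrightarrow> \<nu> \<in> S" for \<nu>
    by (simp_all add: \<Phi>_def \<Phi>'_def S_def mem_Times_iff)
  show ?thesis
  proof (rule that[of N N' \<Phi> \<Phi>'])
    have "open (S \<inter> \<Phi> -` B d2)" "open (S \<inter> \<Phi>' -` B d1)"
      by (intro continuous_open_preimage cont \<open>open S\<close> \<open>\<And>r. open (B r)\<close>)+
    then show "open N" "open N'"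
      unfolding N_def N'_def using \<open>\<And>r. open (B r)\<close> by blast+
    have "\<tau> 0 = 0" using \<kappa>1 \<kappa>2 by (simp add: \<tau>_def)
    then show "\<Phi> 0 = 0" by (simp add: \<Phi>_def zero_prod_def)
    then show "0 \<in> N"
      using d by (simp add: N_def S_def B_def d_def) (simp add: zero_prod_def)
    show "homeomorphism N N' \<Phi> \<Phi>'"
    proof (rule homeomorphismI)
      show "continuous_on N \<Phi>" "continuous_on N' \<Phi>'"
        using continuous_on_subset[OF cont(1), of N] continuous_on_subset[OF cont(2), of N']
        by (auto simp: N_def N'_def)
      have "\<Phi> \<nu> \<in> N'" if "\<nu> \<in> N" for \<nu>
        using that by (simp add: N_def N'_def inv S)
      then show "\<Phi> ` N \<subseteq> N'" by blast
      have "\<Phi>' \<nu> \<in> N" if "\<nu> \<in> N'" for \<nu>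
        using that by (simp add: N_def N'_def inv S)
      then show "\<Phi>' ` N' \<subseteq> N" by blast
    qed (simp_all add: inv)
    show "\<bar>fst \<nu>\<bar> < d1 \<and> \<bar>snd \<nu>\<bar> < d1 \<and> \<bar>fst (\<Phi> \<nu>)\<bar> < d2 \<and> \<bar>snd (\<Phi> \<nu>)\<bar> < d2" if "\<nu> \<in> N" for \<nu>
      using that by (auto simp: N_def B_def mem_Times_iff abs_less_iff)
    show "s * snd (\<Phi> \<nu>) - \<kappa>2 (s * fst \<nu>) = s * snd \<nu> - \<kappa>1 (s * fst \<nu>)" for \<nu>
      using ss by (simp add: \<Phi>_def \<tau>_def distrib_left flip: mult.assoc)
  qed (simp add: \<Phi>_def)
qed

text \<open>The state variable is the last coordinate of \<open>(real \<times> real) \<times> real\<close>.\<close>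

definition state_derivative :: "((real \<times> real) \<times> real \<Rightarrow> real) \<Rightarrow> (real \<times> real) \<times> real \<Rightarrow> real" where
  "state_derivative F p = frechet_derivative F (at p) ((0, 0), 1)"

lemma C_k_on_state_derivative:
  "C_k_on (Suc l) F S \<Longrightarrow> C_k_on l (state_derivative F) S"
proof -
  have "((0, 0), 1) \<in> (Basis :: ((real \<times> real) \<times> real) set)"
    by (simp add: Basis_prod_def zero_prod_def)
  then show "C_k_on (Suc l) F S \<Longrightarrow> C_k_on l (state_derivative F) S"
    by (simp add: state_derivative_def[abs_def])
qed

lemma smooth_state_derivatives:
  assumes "\<And>l. C_k_on l F S"
  shows "C_k_on l ((state_derivative ^^ j) F) S"
proof (induction j arbitrary: l)
  case (Suc j)
  show ?case
    unfolding funpow.simps o_def by (rule C_k_on_state_derivative[OF Suc])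
qed (simp add: assms)

lemma partial_derivative:
  assumes "open S" "C_k_on (Suc l) F S" "p \<in> S"
    and \<gamma>: "(\<gamma> has_derivative (\<lambda>h. h *\<^sub>R v)) (at t)" "\<gamma> t = p"
  shows "((\<lambda>t. F (\<gamma> t)) has_real_derivative frechet_derivative F (at p) v) (at t)"
proof -
  have "F differentiable at p"
    using assms(1-3) at_within_open[of p S] by (auto simp: differentiable_on_def)
  then have F: "(F has_derivative frechet_derivative F (at p)) (at (\<gamma> t))"
    using frechet_derivative_works \<gamma>(2) by blast
  then have "((\<lambda>t. F (\<gamma> t)) has_derivative (\<lambda>h. frechet_derivative F (at p) (h *\<^sub>R v))) (at t)"
    by (rule has_derivative_compose[OF \<gamma>(1)])
  moreover have "frechet_derivative F (at p) (h *\<^sub>R v) = frechet_derivative F (at p) v * h" for h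
    using has_derivative_bounded_linear[OF F] by (simp add: linear_scale bounded_linear.linear)
  ultimately show ?thesis
    by (simp add: has_field_derivative_def mult_commute_abs)
qed


text \<open>Bounds on the parameters and on the state that do not depend on each other.\<close>

lemma open_prod_box:
  fixes S :: "((real \<times> real) \<times> real) set"
  assumes "open S" "((0, 0), 0) \<in> S"
  obtains r where "0 < r" "\<And>a b x. \<bar>a\<bar> \<le> r \<Longrightarrow> \<bar>b\<bar> \<le> r \<Longrightarrow> \<bar>x\<bar> \<le> r \<Longrightarrow> ((a, b), x) \<in> S"
proof -
  obtain e where "e > 0" and e: "ball ((0, 0), 0) e \<subseteq> S"
    using assms by (meson open_contains_ball)
  have "((a, b), x) \<in> S" if "\<bar>a\<bar> \<le> e / 4" "\<bar>b\<bar> \<le> e / 4" "\<bar>x\<bar> \<le> e / 4" for a b x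
  proof -
    have "norm ((a, b), x) \<le> \<bar>a\<bar> + \<bar>b\<bar> + \<bar>x\<bar>"
      using norm_Pair_le[of "(a, b)" x] norm_Pair_le[of a b] by simp
    also have "\<dots> < e" using that \<open>e > 0\<close> by linarith
    finally have "((a, b), x) \<in> ball ((0, 0), 0) e"
      by (simp add: dist_norm norm_minus_commute zero_prod_def[symmetric] flip: norm_minus_cancel[of "((a, b), x)"])
    then show ?thesis using e by blast
  qed
  then show ?thesis
    using that[of "e / 4"] \<open>e > 0\<close> by simp
qed

lemma C1_lipschitz_on_Icc:
  fixes f :: "real \<Rightarrow> real"
  assumes "\<And>x. x \<in> {a..b} \<Longrightarrow> (f has_real_derivative f' x) (at x)" "continuous_on {a..b} f'"
  shows "\<exists>L. L-lipschitz_on {a..b} f"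
proof -
  have "compact (f' ` {a..b})"
    using assms(2) by (intro compact_continuous_image) auto
  then obtain L where L: "\<And>w. w \<in> {a..b} \<Longrightarrow> \<bar>f' w\<bar> \<le> L"
    by (metis compact_imp_bounded bounded_real image_eqI)
  have "(max L 0)-lipschitz_on {a..b} f"
  proof (rule lipschitz_onI)
    fix x y assume "x \<in> {a..b}" "y \<in> {a..b}"
    then have "norm (f x - f y) \<le> L * norm (x - y)"
      by (intro field_differentiable_bound[of "{a..b}" f f'])
        (use assms L in \<open>auto intro: has_field_derivative_at_within\<close>)
    also have "\<dots> \<le> max L 0 * norm (x - y)"
      by (intro mult_right_mono) auto
    finally show "dist (f x) (f y) \<le> max L 0 * dist x y"
      by (simp add: dist_norm)
  qed simp
  then show ?thesis by blast
qed

text \<open>The derivatives in the state variable of the truncated family \<open>x * (\<alpha> + \<beta> * x\<^sup>2 + A * x ^ 4)\<close>.\<close>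

fun truncated :: "real \<Rightarrow> nat \<Rightarrow> real \<Rightarrow> real \<Rightarrow> real \<Rightarrow> real" where
  "truncated A 0 \<alpha> \<beta> x = \<alpha> * x + \<beta> * x ^ 3 + A * x ^ 5"
| "truncated A (Suc 0) \<alpha> \<beta> x = \<alpha> + 3 * \<beta> * x ^ 2 + 5 * A * x ^ 4"
| "truncated A (Suc (Suc 0)) \<alpha> \<beta> x = 6 * \<beta> * x + 20 * A * x ^ 3"
| "truncated A (Suc (Suc (Suc 0))) \<alpha> \<beta> x = 6 * \<beta> + 60 * A * x ^ 2"
| "truncated A (Suc (Suc (Suc (Suc 0)))) \<alpha> \<beta> x = 120 * A * x"
| "truncated A (Suc (Suc (Suc (Suc (Suc j))))) \<alpha> \<beta> x = 120 * A"

lemma truncated_deriv: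
  assumes "j < 5"
  shows "(truncated A j \<alpha> \<beta> has_real_derivative truncated A (Suc j) \<alpha> \<beta> x) (at x)"
proof -
  have fns: "truncated A 0 \<alpha> \<beta> x = \<alpha> * x + \<beta> * x ^ 3 + A * x ^ 5"
    "truncated A (Suc 0) \<alpha> \<beta> x = \<alpha> + 3 * \<beta> * x ^ 2 + 5 * A * x ^ 4"
    "truncated A (Suc (Suc 0)) \<alpha> \<beta> x = 6 * \<beta> * x + 20 * A * x ^ 3"
    "truncated A (Suc (Suc (Suc 0))) \<alpha> \<beta> x = 6 * \<beta> + 60 * A * x ^ 2"
    "truncated A (Suc (Suc (Suc (Suc 0)))) \<alpha> \<beta> x = 120 * A * x" for x by simp_all
  note funs = fns[abs_def]
  consider "j = 0" | "j = Suc 0" | "j = Suc (Suc 0)" | "j = Suc (Suc (Suc 0))" | "j = Suc (Suc (Suc (Suc 0)))"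
    using assms by linarith
  then show ?thesis
    by cases (simp_all only: funs truncated.simps, auto intro!: derivative_eq_intros simp: power2_eq_square power3_eq_cube power4_eq_xxxx)
qed

lemma truncated_unfolding:
  assumes "0 < A" "0 < \<eta>" "0 < \<epsilon>"
  shows "quintic_unfolding (truncated A) \<eta> \<epsilon>"
  using assms truncated_deriv
  by unfold_locales
    (auto simp: numeral_eq_Suc split_beta intro!: continuous_intros)


text \<open>The jets of order five agree, so near the origin the fifth derivative in the state has the sign of
  \<open>a2\<close>, and the third one increases with \<open>\<nu>\<^sub>1\<close> because it is \<open>6 * \<nu>\<^sub>1\<close> at \<open>x = 0\<close>.  Multiplying the right-hand
  sides and both parameters by the sign \<open>s\<close> of \<open>a2\<close> turns both families into unfoldings of \<open>x ^ 5\<close>.\<close>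

theorem amplitude_five_determined:
  fixes a2 :: real
  assumes a2: "a2 \<noteq> 0"
  shows "determined 5 (\<lambda>(\<nu>0, \<nu>1) \<rho>. \<rho> * (\<nu>0 + \<nu>1 * \<rho>\<^sup>2 + a2 * \<rho> ^ 4))"
proof -
  define f :: "real \<times> real \<Rightarrow> real \<Rightarrow> real"
    where "f = (\<lambda>(\<nu>0, \<nu>1) \<rho>. \<rho> * (\<nu>0 + \<nu>1 * \<rho>\<^sup>2 + a2 * \<rho> ^ 4))"
  define s where "s = sgn a2"
  define A where "A = \<bar>a2\<bar>"
  have s: "s * s = 1" "\<bar>s\<bar> = 1" "s \<noteq> 0" "s * a2 = A" "0 < A"
    using a2 by (auto simp: s_def A_def sgn_if)
  have sss: "s * (s * x) = x" for x
    using s(1) by (simp flip: mult.assoc)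
  have sf: "truncated A 0 (s * fst \<nu>) (s * snd \<nu>) x = s * f \<nu> x" for \<nu> x
    unfolding s(4)[symmetric] by (cases \<nu>) (simp add: f_def algebra_simps power_numeral_reduce)
  have f: "f \<nu> x = s * truncated A 0 (s * fst \<nu>) (s * snd \<nu>) x" for \<nu> x
    by (simp only: sf sss)
  have f_deriv: "((\<lambda>x. s * truncated A j (s * fst \<nu>) (s * snd \<nu>) x) has_real_derivative
      s * truncated A (Suc j) (s * fst \<nu>) (s * snd \<nu>) x) (at x)" if "j < 5" for \<nu> j x
    using DERIV_cmult[OF truncated_deriv[OF that]] .
  have f_derivs: "(deriv ^^ j) (f \<nu>) = (\<lambda>x. s * truncated A j (s * fst \<nu>) (s * snd \<nu>) x)" if "j \<le> 5" for j \<nu>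
    using that
  proof (induction j)
    case 0
    show ?case using f by auto
  next
    case (Suc j)
    then have IH: "(deriv ^^ j) (f \<nu>) = (\<lambda>x. s * truncated A j (s * fst \<nu>) (s * snd \<nu>) x)" and "j < 5"
      by simp_all
    show ?case
      unfolding funpow.simps o_def IH using DERIV_imp_deriv[OF f_deriv[OF \<open>j < 5\<close>]] by blast
  qed
  have equivalent: "locally_equivalent g f"
    if "open G" and "(0, 0) \<in> G" and smooth: "\<And>l. C_k_on l (\<lambda>(\<nu>, x). g \<nu> x) G"
      and odd: "\<And>\<nu> x. (\<nu>, x) \<in> G \<Longrightarrow> (\<nu>, - x) \<in> G \<and> g \<nu> (- x) = - g \<nu> x"
      and jet: "\<And>\<nu> j. (\<nu>, 0) \<in> G \<Longrightarrow> j \<le> 5 \<Longrightarrow> (deriv ^^ j) (g \<nu>) 0 = (deriv ^^ j) (f \<nu>) 0"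
    for g :: "real \<times> real \<Rightarrow> real \<Rightarrow> real" and G
  proof -
    define E where "E j = (state_derivative ^^ j) (\<lambda>(\<nu>, x). g \<nu> x)" for j
    have E_smooth: "C_k_on l (E j) G" for l j
      unfolding E_def by (rule smooth_state_derivatives[OF smooth])
    have E_cont: "continuous_on G (E j)" for j
      using E_smooth[of 0 j] by simp
    have E_deriv: "((\<lambda>x. E j (\<nu>, x)) has_real_derivative E (Suc j) (\<nu>, x)) (at x)" if "(\<nu>, x) \<in> G" for j \<nu> x
    proof -
      have "((\<lambda>x. (\<nu>, x)) has_derivative (\<lambda>h. h *\<^sub>R ((0, 0), 1))) (at x)"
        by (auto intro!: derivative_eq_intros simp: zero_prod_def)
      from partial_derivative[OF \<open>open G\<close> E_smooth that this refl]
      show ?thesis by (simp add: E_def state_derivative_def)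
    qed
    have g_derivs: "(deriv ^^ j) (g \<nu>) x = E j (\<nu>, x)" if "(\<nu>, x) \<in> G" for j \<nu> x
      using that
    proof (induction j arbitrary: x)
      case 0
      show ?case by (simp add: E_def)
    next
      case (Suc j)
      have "\<forall>\<^sub>F y in nhds x. (\<nu>, y) \<in> G"
      proof -
        have "((\<lambda>y. (\<nu>, y)) \<longlongrightarrow> (\<nu>, x)) (nhds x)"
          by (intro tendsto_intros filterlim_ident)
        then show ?thesis
          using topological_tendstoD \<open>open G\<close> Suc.prems by blast
      qed
      then have "\<forall>\<^sub>F y in nhds x. (deriv ^^ j) (g \<nu>) y = E j (\<nu>, y)"
        by eventually_elim (rule Suc.IH)
      then have "deriv ((deriv ^^ j) (g \<nu>)) x = deriv (\<lambda>y. E j (\<nu>, y)) x"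
        by (intro deriv_cong_ev) auto
      then show ?case
        using DERIV_imp_deriv[OF E_deriv[OF Suc.prems]] by simp
    qed
    have E_init: "E j (\<nu>, 0) = s * truncated A j (s * fst \<nu>) (s * snd \<nu>) 0" if "(\<nu>, 0) \<in> G" "j \<le> 5" for \<nu> j
      using g_derivs[OF that(1)] jet[OF that] f_derivs[OF that(2)] by metis
    define H where "H p = frechet_derivative (E 3) (at p) ((0, 1), 0)" for p
    have H_deriv: "((\<lambda>b. E 3 ((a, b), x)) has_real_derivative H ((a, b), x)) (at b)" if "((a, b), x) \<in> G" for a b x
    proof -
      have "((\<lambda>b. ((a, b), x)) has_derivative (\<lambda>h. h *\<^sub>R ((0, 1), 0))) (at b)"
        by (auto intro!: derivative_eq_intros)
      from partial_derivative[OF \<open>open G\<close> E_smooth that this refl]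
      show ?thesis by (simp add: H_def)
    qed
    have "((0, 1), 0) \<in> (Basis :: ((real \<times> real) \<times> real) set)"
      by (simp add: Basis_prod_def)
    then have H_cont: "continuous_on G H"
      using E_smooth[of "Suc 0" 3] by (simp add: H_def[abs_def])
    have 0: "((0, 0), 0) \<in> G"
      using \<open>(0, 0) \<in> G\<close> by (simp add: zero_prod_def)
    have E5: "0 < s * E 5 ((0, 0), 0)"
      using E_init[OF 0, of 5] s by (simp add: numeral_eq_Suc)
    have "H ((0, 0), 0) = 6"
    proof (rule DERIV_unique)
      show "((\<lambda>b. E 3 ((0, b), 0)) has_real_derivative H ((0, 0), 0)) (at 0)"
        by (rule H_deriv[OF 0])
      have "((\<lambda>b. ((0, b), 0)) \<longlongrightarrow> ((0, 0), 0)) (nhds (0 :: real))"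
        by (intro tendsto_intros filterlim_ident)
      then have "\<forall>\<^sub>F b in nhds (0 :: real). ((0, b), 0) \<in> G"
        using topological_tendstoD \<open>open G\<close> 0 by blast
      then have "\<forall>\<^sub>F b in nhds 0. 6 * b = E 3 ((0, b), 0)"
      proof eventually_elim
        case (elim b)
        show ?case
          using E_init[OF elim, of 3] sss[of b] by (simp add: numeral_eq_Suc)
      qed
      moreover have "((\<lambda>b. 6 * b) has_real_derivative 6) (at 0)"
        by (auto intro!: derivative_eq_intros)
      ultimately show "((\<lambda>b. E 3 ((0, b), 0)) has_real_derivative 6) (at 0)"
        using DERIV_cong_ev[of 0 0 "\<lambda>b. 6 * b" "\<lambda>b. E 3 ((0, b), 0)" 6 6] by blast
    qed
    define S where "S = (G \<inter> (\<lambda>p. s * E 5 p) -` {0<..}) \<inter> (G \<inter> H -` {0<..})"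
    have "open S"
      unfolding S_def using \<open>open G\<close> E_cont H_cont
      by (intro open_Int continuous_open_preimage[OF _ \<open>open G\<close>]) (auto intro: continuous_intros)
    moreover have "((0, 0), 0) \<in> S"
      using 0 E5 \<open>H ((0, 0), 0) = 6\<close> by (simp add: S_def)
    ultimately obtain r where "0 < r"
      and r: "\<And>a b x. \<bar>a\<bar> \<le> r \<Longrightarrow> \<bar>b\<bar> \<le> r \<Longrightarrow> \<bar>x\<bar> \<le> r \<Longrightarrow> ((a, b), x) \<in> S"
      by (rule open_prod_box) blast
    have sr: "\<bar>s * a\<bar> \<le> r" if "a \<in> {- r..r}" for a
      using that s(2) by (auto simp: abs_mult)
    have rS: "((s * \<alpha>, s * \<beta>), x) \<in> S" "((s * \<alpha>, s * \<beta>), x) \<in> G"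
      if "\<alpha> \<in> {- r..r}" "\<beta> \<in> {- r..r}" "x \<in> {- r..r}" for \<alpha> \<beta> x
      using r[OF sr sr, of \<alpha> \<beta> x] that by (auto simp: S_def)
    define Dg where "Dg j \<alpha> \<beta> x = s * E j ((s * \<alpha>, s * \<beta>), x)" for j \<alpha> \<beta> x
    have Dg_init: "Dg j \<alpha> \<beta> 0 = truncated A j \<alpha> \<beta> 0" if "\<alpha> \<in> {- r..r}" "\<beta> \<in> {- r..r}" "j \<le> 5" for j \<alpha> \<beta>
      using E_init[OF rS(2)[OF that(1,2), of 0] that(3)] \<open>0 < r\<close> by (simp add: Dg_def sss)
    have cont: "continuous_on ({- r..r} \<times> {- r..r} \<times> {0..r}) (\<lambda>(\<alpha>, \<beta>, x). Dg j \<alpha> \<beta> x)" for j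
    proof -
      have 1: "continuous_on ({- r..r} \<times> {- r..r} \<times> {0..r}) (\<lambda>q. ((s * fst q, s * fst (snd q)), snd (snd q)))"
        by (intro continuous_intros)
      have 2: "(\<lambda>q. ((s * fst q, s * fst (snd q)), snd (snd q))) ` ({- r..r} \<times> {- r..r} \<times> {0..r}) \<subseteq> G"
        using rS(2) by fastforce
      show ?thesis
        using continuous_on_mult_left[OF continuous_on_compose2[OF E_cont 1 2], of s j]
        by (simp add: Dg_def split_beta)
    qed
    interpret g: quintic_unfolding Dg r r
    proof
      fix \<alpha> \<beta> x :: real and j :: nat
      assume \<alpha>\<beta>: "\<alpha> \<in> {- r..r}" "\<beta> \<in> {- r..r}"
      show "Dg 0 \<alpha> \<beta> 0 = 0 \<and> Dg 1 \<alpha> \<beta> 0 = \<alpha> \<and> Dg 2 \<alpha> \<beta> 0 = 0 \<and> Dg 3 \<alpha> \<beta> 0 = 6 * \<beta> \<and> Dg 4 \<alpha> \<beta> 0 = 0"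
        using Dg_init[OF \<alpha>\<beta>] by (simp add: numeral_eq_Suc)
      assume x: "x \<in> {0..r}"
      then have G: "((s * \<alpha>, s * \<beta>), x) \<in> S" "((s * \<alpha>, s * \<beta>), x) \<in> G"
        using rS[OF \<alpha>\<beta>, of x] by auto
      show "(Dg j \<alpha> \<beta> has_real_derivative Dg (Suc j) \<alpha> \<beta> x) (at x)"
        unfolding Dg_def by (rule DERIV_cmult[OF E_deriv[OF G(2)]])
      show "0 < Dg 5 \<alpha> \<beta> x"
        using G(1) by (simp add: S_def Dg_def)
      fix \<beta>' assume \<beta>': "\<beta>' \<in> {- r..r}" "\<beta> < \<beta>'"
      show "Dg 3 \<alpha> \<beta> x < Dg 3 \<alpha> \<beta>' x"
      proof (rule DERIV_pos_imp_increasing[OF \<beta>'(2)])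
        fix b assume b: "\<beta> \<le> b" "b \<le> \<beta>'"
        then have G: "((s * \<alpha>, s * b), x) \<in> S" "((s * \<alpha>, s * b), x) \<in> G"
          using rS[OF \<alpha>\<beta>(1), of b x] \<alpha>\<beta> \<beta>' x by auto
        have "((\<lambda>b. s * b) has_real_derivative s) (at b)"
          by (auto intro!: derivative_eq_intros)
        from DERIV_cmult[OF DERIV_chain2[OF H_deriv[OF G(2)] this], of s]
        have "((\<lambda>b. Dg 3 \<alpha> b x) has_real_derivative s * (H ((s * \<alpha>, s * b), x) * s)) (at b)"
          unfolding Dg_def .
        also have "s * (H ((s * \<alpha>, s * b), x) * s) = H ((s * \<alpha>, s * b), x)"
          using sss[of "H ((s * \<alpha>, s * b), x)"] by (metis mult.commute)
        finally have "((\<lambda>b. Dg 3 \<alpha> b x) has_real_derivative H ((s * \<alpha>, s * b), x)) (at b)" .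
        moreover have "0 < H ((s * \<alpha>, s * b), x)"
          using G(1) by (simp add: S_def)
        ultimately show "\<exists>y. ((\<lambda>b. Dg 3 \<alpha> b x) has_real_derivative y) (at b) \<and> 0 < y" by blast
      qed
    qed (use \<open>0 < r\<close> cont in auto)
    obtain \<eta>1 where \<eta>1: "0 < \<eta>1" "\<eta>1 \<le> r" "bounded_quintic_unfolding Dg \<eta>1 r"
      using g.restrict_to_bounded by blast
    interpret f: quintic_unfolding "truncated A" 1 1
      by (rule truncated_unfolding) (use s in auto)
    obtain \<eta>2 where \<eta>2: "0 < \<eta>2" "\<eta>2 \<le> 1" "bounded_quintic_unfolding (truncated A) \<eta>2 1"
      using f.restrict_to_bounded by blast
    obtain d1 \<kappa>1 where d1: "0 < d1" "d1 \<le> \<eta>1" "continuous_on {- d1<..<d1} \<kappa>1" "\<kappa>1 0 = 0"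
      and g_pattern: "\<And>\<alpha> \<beta>. \<alpha> \<in> {- d1<..<d1} \<Longrightarrow> \<beta> \<in> {- d1<..<d1} \<Longrightarrow> \<exists>p q. sign_pattern (Dg 0 \<alpha> \<beta>) r p q \<and>
        (p = q \<longleftrightarrow> 0 \<le> \<alpha> \<and> \<kappa>1 \<alpha> \<le> \<beta>) \<and> (p = 0 \<longleftrightarrow> \<alpha> \<le> 0 \<or> \<kappa>1 \<alpha> < \<beta>)"
      by (rule bounded_quintic_unfolding.fold_graph[OF \<eta>1(3)]) blast
    obtain d2 \<kappa>2 where d2: "0 < d2" "d2 \<le> \<eta>2" "continuous_on {- d2<..<d2} \<kappa>2" "\<kappa>2 0 = 0"
      and f_pattern: "\<And>\<alpha> \<beta>. \<alpha> \<in> {- d2<..<d2} \<Longrightarrow> \<beta> \<in> {- d2<..<d2} \<Longrightarrow> \<exists>p q. sign_pattern (truncated A 0 \<alpha> \<beta>) 1 p q \<and>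
        (p = q \<longleftrightarrow> 0 \<le> \<alpha> \<and> \<kappa>2 \<alpha> \<le> \<beta>) \<and> (p = 0 \<longleftrightarrow> \<alpha> \<le> 0 \<or> \<kappa>2 \<alpha> < \<beta>)"
      by (rule bounded_quintic_unfolding.fold_graph[OF \<eta>2(3)]) blast
    obtain N N' \<Phi> \<Phi>' where N: "open N" "open N'" "0 \<in> N" "homeomorphism N N' \<Phi> \<Phi>'" "\<Phi> 0 = 0"
      and box: "\<And>\<nu>. \<nu> \<in> N \<Longrightarrow> \<bar>fst \<nu>\<bar> < d1 \<and> \<bar>snd \<nu>\<bar> < d1 \<and> \<bar>fst (\<Phi> \<nu>)\<bar> < d2 \<and> \<bar>snd (\<Phi> \<nu>)\<bar> < d2"
      and \<Phi>: "\<And>\<nu>. fst (\<Phi> \<nu>) = fst \<nu>" "\<And>\<nu>. s * snd (\<Phi> \<nu>) - \<kappa>2 (s * fst \<nu>) = s * snd \<nu> - \<kappa>1 (s * fst \<nu>)"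
      by (rule fold_shear[OF d1(1) d2(1) s(2) d1(3,4) d2(3,4)]) blast
    have "\<exists>h h'. homeomorphism {- r..r} {- 1..1} h h' \<and> (\<forall>x\<in>{- r..r}. h (- x) = - h x) \<and>
        (\<forall>x\<in>{- r..r}. \<forall>y\<in>{- r..r}. reaches (g \<nu>) {- r..r} x y \<longleftrightarrow> reaches (f (\<Phi> \<nu>)) {- 1..1} (h x) (h y))"
      if "\<nu> \<in> N" for \<nu>
    proof -
      have small: "s * c \<in> {- d<..<d}" if "\<bar>c\<bar> < d" for c d
      proof -
        have "\<bar>s * c\<bar> < d" using that s(2) by (simp add: abs_mult)
        then show ?thesis by (simp add: abs_less_iff)
      qed
      obtain p q where pq: "sign_pattern (Dg 0 (s * fst \<nu>) (s * snd \<nu>)) r p q"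
        "p = q \<longleftrightarrow> 0 \<le> s * fst \<nu> \<and> \<kappa>1 (s * fst \<nu>) \<le> s * snd \<nu>"
        "p = 0 \<longleftrightarrow> s * fst \<nu> \<le> 0 \<or> \<kappa>1 (s * fst \<nu>) < s * snd \<nu>"
        using g_pattern[OF small small, of "fst \<nu>" "snd \<nu>"] box[OF \<open>\<nu> \<in> N\<close>] by blast
      obtain p' q' where pq': "sign_pattern (truncated A 0 (s * fst (\<Phi> \<nu>)) (s * snd (\<Phi> \<nu>))) 1 p' q'"
        "p' = q' \<longleftrightarrow> 0 \<le> s * fst (\<Phi> \<nu>) \<and> \<kappa>2 (s * fst (\<Phi> \<nu>)) \<le> s * snd (\<Phi> \<nu>)"
        "p' = 0 \<longleftrightarrow> s * fst (\<Phi> \<nu>) \<le> 0 \<or> \<kappa>2 (s * fst (\<Phi> \<nu>)) < s * snd (\<Phi> \<nu>)"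
        using f_pattern[OF small small, of "fst (\<Phi> \<nu>)" "snd (\<Phi> \<nu>)"] box[OF \<open>\<nu> \<in> N\<close>] by blast
      have same: "p = 0 \<longleftrightarrow> p' = 0" "p = q \<longleftrightarrow> p' = q'"
        using \<Phi>(2)[of \<nu>] unfolding pq(2,3) pq'(2,3) \<Phi>(1) by linarith+
      have Dg0: "Dg 0 (s * fst \<nu>) (s * snd \<nu>) x = s * g \<nu> x" for x
        by (simp add: Dg_def sss E_def)
      have inG: "(\<nu>, x) \<in> G" if "x \<in> {- r..r}" for x
      proof -
        have "((fst \<nu>, snd \<nu>), x) \<in> S"
          using box[OF \<open>\<nu> \<in> N\<close>] d1 \<eta>1 that by (intro r) auto
        then show ?thesis by (simp add: S_def)
      qed
      have "continuous_on {- r..r} (\<lambda>x. E 1 (\<nu>, x))"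
        using inG by (intro continuous_on_compose2[OF E_cont] continuous_intros) auto
      moreover have "(g \<nu> has_real_derivative E 1 (\<nu>, x)) (at x)" if "x \<in> {- r..r}" for x
        using E_deriv[OF inG[OF that], of 0] by (simp add: E_def)
      ultimately obtain L where L: "L-lipschitz_on {- r..r} (g \<nu>)"
        using C1_lipschitz_on_Icc[of "- r" r "g \<nu>" "\<lambda>x. E 1 (\<nu>, x)"] by blast
      have "continuous_on {- 1..1} (\<lambda>x. s * truncated A 1 (s * fst (\<Phi> \<nu>)) (s * snd (\<Phi> \<nu>)) x)"
        by (auto intro!: continuous_intros)
      moreover have "(f (\<Phi> \<nu>) has_real_derivative s * truncated A 1 (s * fst (\<Phi> \<nu>)) (s * snd (\<Phi> \<nu>)) x) (at x)" for x
        using f_deriv[of 0 "\<Phi> \<nu>" x] unfolding f[symmetric, abs_def] by simp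
      ultimately obtain M where M: "M-lipschitz_on {- 1..1} (f (\<Phi> \<nu>))"
        using C1_lipschitz_on_Icc[of "- 1" 1 "f (\<Phi> \<nu>)"
            "\<lambda>x. s * truncated A 1 (s * fst (\<Phi> \<nu>)) (s * snd (\<Phi> \<nu>)) x"] by blast
      show ?thesis
      proof (rule same_pattern_equivalent[OF pq(1) pq'(1) same _ _ L M Dg0 sf s(3)])
        show "Dg 0 (s * fst \<nu>) (s * snd \<nu>) (- x) = - Dg 0 (s * fst \<nu>) (s * snd \<nu>) x" if "x \<in> {- r..r}" for x
          using odd[OF inG[OF that]] by (simp add: Dg0)
        show "truncated A 0 (s * fst (\<Phi> \<nu>)) (s * snd (\<Phi> \<nu>)) (- x) = - truncated A 0 (s * fst (\<Phi> \<nu>)) (s * snd (\<Phi> \<nu>)) x" for x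
          by simp
      qed
    qed
    then show ?thesis
      unfolding locally_equivalent_def using N \<open>0 < r\<close>
      by (intro exI[of _ N] exI[of _ N'] exI[of _ \<Phi>] exI[of _ \<Phi>'] exI[of _ r] exI[of _ 1]) auto
  qed
  have "determined 5 f"
    unfolding determined_def
  proof (intro allI impI, elim conjE)
    fix g :: "real \<times> real \<Rightarrow> real \<Rightarrow> real" and G
    assume g: "open G" "(0, 0) \<in> G" "\<forall>l. C_k_on l (\<lambda>(\<nu>, x). g \<nu> x) G"
      "\<forall>\<nu> x. (\<nu>, x) \<in> G \<longrightarrow> (\<nu>, - x) \<in> G \<and> g \<nu> (- x) = - g \<nu> x"
      "\<forall>\<nu> j. (\<nu>, 0) \<in> G \<and> j \<le> 5 \<longrightarrow> (deriv ^^ j) (g \<nu>) 0 = (deriv ^^ j) (f \<nu>) 0"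
    show "locally_equivalent g f"
    proof (rule equivalent[OF g(1,2)])
      show "C_k_on l (\<lambda>(\<nu>, x). g \<nu> x) G" for l using g(3) by blast
      show "(\<nu>, - x) \<in> G \<and> g \<nu> (- x) = - g \<nu> x" if "(\<nu>, x) \<in> G" for \<nu> x
        using g(4) that by blast
      show "(deriv ^^ j) (g \<nu>) 0 = (deriv ^^ j) (f \<nu>) 0" if "(\<nu>, 0) \<in> G" "j \<le> 5" for \<nu> j
        using g(5) that by blast
    qed
  qed
  then show ?thesis by (simp add: f_def)
qed

section \<open>Bifurcations of hypertori on the leaf\<close>

theorem theorem5p2:
  fixes k :: nat and \<sigma> :: "nat \<Rightarrow> 'n::{finite,linorder}" and C :: "real ^ ('n::{finite,linorder})"
    and V :: "'m::euclidean_space set"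
    and a :: "nat \<Rightarrow> 'm \<Rightarrow> real" and b :: "nat \<Rightarrow> nat \<Rightarrow> 'm \<Rightarrow> real"
    and \<omega> :: "'n \<Rightarrow> real" and a\<^sub>2 :: real
  assumes "2 \<le> k" and "k \<le> CARD('n)"
    and "\<sigma> \<in> shuffle_perms k" and "C \<in> positive_sphere k \<sigma>"
    and "open V" and "0 \<in> V"
    and "\<forall>\<mu>\<in>V. a 2 \<mu> = a\<^sub>2" and "a\<^sub>2 \<noteq> 0"
    and "\<forall>j<2. a j 0 = 0"
    and "continuous_on V (\<lambda>\<mu>. (a 0 \<mu>, a 1 \<mu>))"
    and "\<forall>W. open W \<and> W \<subseteq> V \<longrightarrow> open ((\<lambda>\<mu>. (a 0 \<mu>, a 1 \<mu>)) ` W)"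
    and "\<forall>i\<in>{1..k}. b i 0 0 = 0"
    and "\<forall>j<2. \<forall>\<mu>\<in>V. b 1 j \<mu> = 0"
    and "\<forall>i. \<omega> i \<noteq> 0" and "\<forall>i j. i < j \<longrightarrow> \<omega> i / \<omega> j \<notin> \<rat>"
  shows
    "let X = closure (leaf k \<sigma> C);
         T = hypertorus k \<sigma> C;
         R = hypertorus_radii 2 a;
         \<nu> = (\<lambda>\<mu>. (a 0 \<mu>, a 1 \<mu>));
         sol = (\<lambda>\<mu>. leaf_solution k \<sigma> C (radial_rate 2 a \<mu>) (angular_rate 2 \<sigma> \<omega> b \<mu>));
         stable = (\<lambda>\<mu>. asymptotically_stable X (sol \<mu>));
         unstable = (\<lambda>\<mu> S. \<not> lyapunov_stable (sol \<mu>) S);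
         repel = (\<lambda>\<mu>. repelling X (sol \<mu>))
     in
       (\<forall>\<mu>\<in>V. \<forall>r\<in>R \<mu>. flow_invariant (sol \<mu>) (T r)) \<and>
       \<comment> \<open>bifurcations from the origin\<close>
       {\<mu>\<in>V. bifurcates_from_origin V R (\<lambda>\<mu> r. stable \<mu> (T r)) \<mu>} = {\<mu>\<in>V. \<nu> \<mu> \<in> T_SupP} \<and>
       {\<mu>\<in>V. bifurcates_from_origin V R (\<lambda>\<mu> r. unstable \<mu> (T r)) \<mu>} = {\<mu>\<in>V. \<nu> \<mu> \<in> T_SubP} \<and>
       \<comment> \<open>double saddle-node bifurcation of hypertori\<close>
       {\<mu>\<in>V. double_saddle_node_bifurcation V (amplitude 2 a) R
                (\<lambda>\<mu> r r'. stable \<mu> (T r) \<and> repel \<mu> (T r')) \<mu>} = {\<mu>\<in>V. \<nu> \<mu> \<in> T_2SD a\<^sub>2} \<and>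
       \<comment> \<open>the colliding hypertori are those bifurcated at \<open>T_SupP\<close> and at \<open>T_SubP\<close>\<close>
       (\<exists>D\<^sub>s D\<^sub>u r\<^sub>s r\<^sub>u.
          path_connected D\<^sub>s \<and> continuous_on (D\<^sub>s \<union> T_SupP \<union> T_2SD a\<^sub>2) r\<^sub>s \<and>
          path_connected D\<^sub>u \<and> continuous_on (D\<^sub>u \<union> T_SubP \<union> T_2SD a\<^sub>2) r\<^sub>u \<and>
          T_SupP \<subseteq> closure D\<^sub>s \<and> (\<forall>p\<in>T_SupP. r\<^sub>s p = 0) \<and>
          T_SubP \<subseteq> closure D\<^sub>u \<and> (\<forall>p\<in>T_SubP. r\<^sub>u p = 0) \<and>
          T_2SD a\<^sub>2 \<subseteq> closure (D\<^sub>s \<inter> D\<^sub>u) \<and> (\<forall>p\<in>T_2SD a\<^sub>2. r\<^sub>s p = r\<^sub>u p) \<and>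
          (\<forall>p\<in>D\<^sub>s \<inter> D\<^sub>u. r\<^sub>s p \<noteq> r\<^sub>u p) \<and>
          (\<forall>\<mu>\<in>V. \<nu> \<mu> \<notin> T_2SD a\<^sub>2 \<longrightarrow>
             R \<mu> = {r. \<nu> \<mu> \<in> D\<^sub>s \<and> r = r\<^sub>s (\<nu> \<mu>) \<or> \<nu> \<mu> \<in> D\<^sub>u \<and> r = r\<^sub>u (\<nu> \<mu>)}) \<and>
          (\<forall>\<mu>\<in>V. \<nu> \<mu> \<in> T_2SD a\<^sub>2 \<longrightarrow> R \<mu> = {r\<^sub>s (\<nu> \<mu>)}) \<and>
          (\<forall>\<mu>\<in>V. \<nu> \<mu> \<in> D\<^sub>s \<longrightarrow> stable \<mu> (T (r\<^sub>s (\<nu> \<mu>)))) \<and>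
          (\<forall>\<mu>\<in>V. \<nu> \<mu> \<in> D\<^sub>u \<longrightarrow> unstable \<mu> (T (r\<^sub>u (\<nu> \<mu>))))) \<and>
       determined 5 (\<lambda>(\<nu>\<^sub>0, \<nu>\<^sub>1) \<rho>. \<rho> * (\<nu>\<^sub>0 + \<nu>\<^sub>1 * \<rho>\<^sup>2 + a\<^sub>2 * \<rho> ^ 4)) \<and>
       \<comment> \<open>region with an inner and an outer hypertorus\<close>
       (\<forall>\<mu>\<in>V. (\<exists>r\<^sub>1 r\<^sub>2. r\<^sub>1 < r\<^sub>2 \<and> R \<mu> = {r\<^sub>1, r\<^sub>2}) \<longleftrightarrow>
          (a 1 \<mu>)\<^sup>2 > 4 * a\<^sub>2 * a 0 \<mu> \<and> a\<^sub>2 * a 0 \<mu> > 0 \<and> a\<^sub>2 * a 1 \<mu> < 0) \<and>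
       (\<forall>\<mu>\<in>V. \<forall>r\<^sub>1\<in>R \<mu>. \<forall>r\<^sub>2\<in>R \<mu>. r\<^sub>1 < r\<^sub>2 \<longrightarrow> T r\<^sub>1 \<subseteq> inside_in X (T r\<^sub>2)) \<and>
       (\<forall>\<mu>\<in>V. (a 1 \<mu>)\<^sup>2 > 4 * a\<^sub>2 * a 0 \<mu> \<and> a 0 \<mu> > 0 \<longrightarrow>
          unstable \<mu> {0} \<and>
          (\<forall>r\<^sub>1\<in>R \<mu>. \<forall>r\<^sub>2\<in>R \<mu>. r\<^sub>1 < r\<^sub>2 \<longrightarrow> stable \<mu> (T r\<^sub>1) \<and> unstable \<mu> (T r\<^sub>2))) \<and>
       (\<forall>\<mu>\<in>V. (a 1 \<mu>)\<^sup>2 > 4 * a\<^sub>2 * a 0 \<mu> \<and> a 0 \<mu> < 0 \<longrightarrow>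
          stable \<mu> {0} \<and>
          (\<forall>r\<^sub>1\<in>R \<mu>. \<forall>r\<^sub>2\<in>R \<mu>. r\<^sub>1 < r\<^sub>2 \<longrightarrow> repel \<mu> (T r\<^sub>1) \<and> stable \<mu> (T r\<^sub>2)))"
proof -
  let ?X = "closure (leaf k \<sigma> C)" and ?T = "hypertorus k \<sigma> C" and ?R = "hypertorus_radii 2 a"
  let ?\<nu> = "\<lambda>\<mu>. (a 0 \<mu>, a 1 \<mu>)"
  let ?sol = "\<lambda>\<mu>. leaf_solution k \<sigma> C (radial_rate 2 a \<mu>) (angular_rate 2 \<sigma> \<omega> b \<mu>)"
  let ?stable = "\<lambda>\<mu>. asymptotically_stable ?X (?sol \<mu>)"
  let ?unstable = "\<lambda>\<mu> S. \<not> lyapunov_stable (?sol \<mu>) S"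
  let ?repel = "\<lambda>\<mu>. repelling ?X (?sol \<mu>)"
  interpret leaf_geometry k \<sigma> C
    using assms by unfold_locales auto
  \<comment> \<open>the coefficient \<open>a 1\<close> is not to be rewritten\<close>
  note One_nat_def [simp del]
  \<comment> \<open>the field of the amplitude equation and its derivative\<close>
  define f' where "f' \<mu> x = a 0 \<mu> + 3 * a 1 \<mu> * x\<^sup>2 + 5 * a 2 \<mu> * x ^ 4" for \<mu> x
  have rate: "radial_rate 2 a \<mu> x = a 0 \<mu> + a 1 \<mu> * x\<^sup>2 + a 2 \<mu> * x ^ 4" for \<mu> x
    by (simp add: radial_rate_def numeral_eq_Suc One_nat_def)
  interpret amplitude_family V "a 0" "a 1" a\<^sub>2 ?R
    using assms by unfold_locales (auto simp: hypertorus_radii_def amplitude_def rate)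
  have amplitude_deriv: "((\<lambda>x. x * radial_rate 2 a \<mu> x) has_real_derivative f' \<mu> x) (at x)" for \<mu> x
    unfolding rate f'_def
    by (auto intro!: derivative_eq_intros simp: algebra_simps power2_eq_square power3_eq_cube power4_eq_xxxx)
  have f'_cont: "continuous_on UNIV (f' \<mu>)" for \<mu>
    unfolding f'_def by (intro continuous_intros)
  have flow: "leaf_flow k \<sigma> C (radial_rate 2 a \<mu>) (angular_rate 2 \<sigma> \<omega> b \<mu>) (f' \<mu>)" for \<mu>
    using amplitude_deriv f'_cont
    by unfold_locales (auto simp: angular_rate_def intro!: continuous_intros)
  have zero_iff: "radial_rate 2 a \<mu> x = 0 \<longleftrightarrow> (x\<^sup>2 - vertex \<mu>)\<^sup>2 = gap \<mu>" if "\<mu> \<in> V" for \<mu> x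
    using that assms(7) quartic_zero_iff[of \<mu> x] by (simp add: rate)
  have radius_mem: "r \<in> ?R \<mu> \<longleftrightarrow> 0 < r \<and> radial_rate 2 a \<mu> r = 0" for \<mu> r
    by (auto simp: hypertorus_radii_def amplitude_def)
  have slope: "f' \<mu> x = 2 * x\<^sup>2 * (a 1 \<mu> + 2 * a\<^sub>2 * x\<^sup>2)" "f' \<mu> x = 4 * x\<^sup>2 * (a\<^sub>2 * (x\<^sup>2 - vertex \<mu>))"
    if "\<mu> \<in> V" "radial_rate 2 a \<mu> x = 0" for \<mu> x
  proof -
    have "f' \<mu> x = radial_rate 2 a \<mu> x + 2 * x\<^sup>2 * (a 1 \<mu> + 2 * a\<^sub>2 * x\<^sup>2)"
      using assms(7) \<open>\<mu> \<in> V\<close> by (simp add: f'_def rate algebra_simps power_numeral_reduce)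
    then show "f' \<mu> x = 2 * x\<^sup>2 * (a 1 \<mu> + 2 * a\<^sub>2 * x\<^sup>2)" using that by simp
    then show "f' \<mu> x = 4 * x\<^sup>2 * (a\<^sub>2 * (x\<^sup>2 - vertex \<mu>))"
      unfolding slope_eq by simp
  qed
  have f'_sign: "f' \<mu> r < 0 \<longleftrightarrow> a 1 \<mu> + 2 * a\<^sub>2 * r\<^sup>2 < 0" "0 < f' \<mu> r \<longleftrightarrow> 0 < a 1 \<mu> + 2 * a\<^sub>2 * r\<^sup>2"
    "f' \<mu> r < 0 \<longleftrightarrow> a\<^sub>2 * (r\<^sup>2 - vertex \<mu>) < 0" "0 < f' \<mu> r \<longleftrightarrow> 0 < a\<^sub>2 * (r\<^sup>2 - vertex \<mu>)"
    if "\<mu> \<in> V" "radial_rate 2 a \<mu> r = 0" "r \<noteq> 0" for \<mu> r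
  proof -
    have pos: "0 < 2 * r\<^sup>2" "0 < 4 * r\<^sup>2" using that(3) by simp_all
    have sign: "c * x < 0 \<longleftrightarrow> x < 0" "0 < c * x \<longleftrightarrow> 0 < x" if "0 < c" for c x :: real
      using that by (simp_all add: mult_less_0_iff zero_less_mult_iff)
    show "f' \<mu> r < 0 \<longleftrightarrow> a 1 \<mu> + 2 * a\<^sub>2 * r\<^sup>2 < 0" "0 < f' \<mu> r \<longleftrightarrow> 0 < a 1 \<mu> + 2 * a\<^sub>2 * r\<^sup>2"
      unfolding slope(1)[OF that(1,2)] by (rule sign[OF pos(1)])+
    show "f' \<mu> r < 0 \<longleftrightarrow> a\<^sub>2 * (r\<^sup>2 - vertex \<mu>) < 0" "0 < f' \<mu> r \<longleftrightarrow> 0 < a\<^sub>2 * (r\<^sup>2 - vertex \<mu>)"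
      unfolding slope(2)[OF that(1,2)] by (rule sign[OF pos(2)])+
  qed
  have invariant: "flow_invariant (?sol \<mu>) (?T r)" if "r \<in> ?R \<mu>" for \<mu> r
    using leaf_flow.torus_invariant[OF flow] that by (simp add: radius_mem)
  have stable: "?stable \<mu> (?T r)" if "r \<in> ?R \<mu>" "f' \<mu> r < 0" for \<mu> r
    using leaf_flow.torus_stable[OF flow] that by (simp add: radius_mem)
  have unstable: "?unstable \<mu> (?T r)" if "r \<in> ?R \<mu>" "0 < f' \<mu> r" for \<mu> r
    using leaf_flow.torus_unstable[OF flow] that by (simp add: radius_mem)
  have repel: "?repel \<mu> (?T r)" if "r \<in> ?R \<mu>" "0 < f' \<mu> r" for \<mu> r
    using leaf_flow.torus_repelling[OF flow] that by (simp add: radius_mem)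
  have lyapunov: "?stable \<mu> S \<Longrightarrow> lyapunov_stable (?sol \<mu>) S" for \<mu> S
    by (simp add: asymptotically_stable_def)

  have down: "?stable \<mu> (?T r)" if "\<mu> \<in> V" "r \<in> ?R \<mu>" "a 1 \<mu> + 2 * a\<^sub>2 * r\<^sup>2 < 0" for \<mu> r
    using stable[OF that(2)] f'_sign(1)[of \<mu> r] that radius_mem[of r \<mu>] by force
  have up: "?unstable \<mu> (?T r)" if "\<mu> \<in> V" "r \<in> ?R \<mu>" "0 < a 1 \<mu> + 2 * a\<^sub>2 * r\<^sup>2" for \<mu> r
    using unstable[OF that(2)] f'_sign(2)[of \<mu> r] that radius_mem[of r \<mu>] by force
  \<comment> \<open>\<open>e\<close> is the sign of the slope that the property \<open>Pr\<close> is equivalent to\<close>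
  have pitchfork:
    "{\<mu>\<in>V. bifurcates_from_origin V ?R Pr \<mu>} = {\<mu>\<in>V. a 0 \<mu> = 0 \<and> 0 < e * a 1 \<mu>}"
    if e: "e \<noteq> 0"
      and yes: "\<And>\<mu> r. \<mu> \<in> V \<Longrightarrow> r \<in> ?R \<mu> \<Longrightarrow> 0 < e * (a 1 \<mu> + 2 * a\<^sub>2 * r\<^sup>2) \<Longrightarrow> Pr \<mu> r"
      and no: "\<And>\<mu> r. \<mu> \<in> V \<Longrightarrow> r \<in> ?R \<mu> \<Longrightarrow> e * (a 1 \<mu> + 2 * a\<^sub>2 * r\<^sup>2) < 0 \<Longrightarrow> \<not> Pr \<mu> r" for Pr and e :: real
  proof -
    have "bifurcates_from_origin V ?R Pr \<mu>0 \<longleftrightarrow> a 0 \<mu>0 = 0 \<and> 0 < e * a 1 \<mu>0" if \<mu>0: "\<mu>0 \<in> V" for \<mu>0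
    proof
      assume "a 0 \<mu>0 = 0 \<and> 0 < e * a 1 \<mu>0"
      then show "bifurcates_from_origin V ?R Pr \<mu>0"
        using yes by (intro bifurcates_from_originI \<mu>0) (auto simp: zero_less_mult_iff)
    next
      assume "bifurcates_from_origin V ?R Pr \<mu>0"
      then obtain \<mu> r where *: "a 0 \<mu>0 = 0" "a 1 \<mu>0 \<noteq> 0" "\<mu> \<in> V" "r \<in> ?R \<mu>" "Pr \<mu> r"
        "0 < a 1 \<mu>0 * (a 1 \<mu> + 2 * a\<^sub>2 * r\<^sup>2)"
        using bifurcates_from_originD[OF _ \<mu>0] by blast
      then have "\<not> e * (a 1 \<mu> + 2 * a\<^sub>2 * r\<^sup>2) < 0"
        using no[of \<mu> r] by blast
      then have "0 < e * a 1 \<mu>0"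
        using *(2,6) e by (auto simp: zero_less_mult_iff mult_less_0_iff)
      with * show "a 0 \<mu>0 = 0 \<and> 0 < e * a 1 \<mu>0" by blast
    qed
    then show ?thesis by blast
  qed
  have supercritical: "{\<mu>\<in>V. bifurcates_from_origin V ?R (\<lambda>\<mu> r. ?stable \<mu> (?T r)) \<mu>} = {\<mu>\<in>V. ?\<nu> \<mu> \<in> T_SupP}"
  proof -
    have "{\<mu>\<in>V. bifurcates_from_origin V ?R (\<lambda>\<mu> r. ?stable \<mu> (?T r)) \<mu>} = {\<mu>\<in>V. a 0 \<mu> = 0 \<and> 0 < (- 1) * a 1 \<mu>}"
    proof (rule pitchfork)
      show "?stable \<mu> (?T r)" if "\<mu> \<in> V" "r \<in> ?R \<mu>" "0 < (- 1) * (a 1 \<mu> + 2 * a\<^sub>2 * r\<^sup>2)" for \<mu> r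
        using down[OF that(1,2)] that(3) by simp
      show "\<not> ?stable \<mu> (?T r)" if "\<mu> \<in> V" "r \<in> ?R \<mu>" "(- 1) * (a 1 \<mu> + 2 * a\<^sub>2 * r\<^sup>2) < 0" for \<mu> r
        using up[OF that(1,2)] that(3) lyapunov[of \<mu> "?T r"] by auto
    qed simp
    then show ?thesis by (simp add: T_SupP_def)
  qed
  have subcritical: "{\<mu>\<in>V. bifurcates_from_origin V ?R (\<lambda>\<mu> r. ?unstable \<mu> (?T r)) \<mu>} = {\<mu>\<in>V. ?\<nu> \<mu> \<in> T_SubP}"
  proof -
    have "{\<mu>\<in>V. bifurcates_from_origin V ?R (\<lambda>\<mu> r. ?unstable \<mu> (?T r)) \<mu>} = {\<mu>\<in>V. a 0 \<mu> = 0 \<and> 0 < 1 * a 1 \<mu>}"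
    proof (rule pitchfork)
      show "?unstable \<mu> (?T r)" if "\<mu> \<in> V" "r \<in> ?R \<mu>" "0 < 1 * (a 1 \<mu> + 2 * a\<^sub>2 * r\<^sup>2)" for \<mu> r
        using up[OF that(1,2)] that(3) by simp
      show "\<not> ?unstable \<mu> (?T r)" if "\<mu> \<in> V" "r \<in> ?R \<mu>" "1 * (a 1 \<mu> + 2 * a\<^sub>2 * r\<^sup>2) < 0" for \<mu> r
        using down[OF that(1,2)] that(3) lyapunov[of \<mu> "?T r"] by auto
    qed simp
    then show ?thesis by (simp add: T_SubP_def)
  qed

  have saddle_node: "{\<mu>\<in>V. double_saddle_node_bifurcation V (amplitude 2 a) ?R
      (\<lambda>\<mu> r r'. ?stable \<mu> (?T r) \<and> ?repel \<mu> (?T r')) \<mu>} = {\<mu>\<in>V. ?\<nu> \<mu> \<in> T_2SD a\<^sub>2}"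
  proof -
    let ?Q = "\<lambda>\<mu> r r'. ?stable \<mu> (?T r) \<and> ?repel \<mu> (?T r')"
    have "double_saddle_node_bifurcation V (amplitude 2 a) ?R ?Q \<mu>0 \<longleftrightarrow> gap \<mu>0 = 0 \<and> 0 < vertex \<mu>0"
      if \<mu>0: "\<mu>0 \<in> V" for \<mu>0
    proof
      assume "double_saddle_node_bifurcation V (amplitude 2 a) ?R ?Q \<mu>0"
      then obtain r0 where "0 < r0" "saddle_node_bifurcation V ?R ?Q \<mu>0 r0"
        unfolding double_saddle_node_bifurcation_def by blast
      then show "gap \<mu>0 = 0 \<and> 0 < vertex \<mu>0"
        using saddle_node_bifurcationD[OF _ \<open>0 < r0\<close> \<mu>0] by blast
    next
      assume fold: "gap \<mu>0 = 0 \<and> 0 < vertex \<mu>0"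
      define r0 where "r0 = sqrt (vertex \<mu>0)"
      have "0 < r0" using fold by (simp add: r0_def)
      have "saddle_node_bifurcation V ?R ?Q \<mu>0 (1 * sqrt (vertex \<mu>0))"
      proof (rule saddle_node_bifurcationI[OF \<mu>0])
        show "x \<in> ?R \<mu> \<longleftrightarrow> (x\<^sup>2 - vertex \<mu>)\<^sup>2 = gap \<mu>" if "\<mu> \<in> V" "0 < 1 * x" for \<mu> x
          using that zero_iff by (simp add: radius_mem)
        show "?Q \<mu> x y" if "\<mu> \<in> V" "x \<in> ?R \<mu>" "y \<in> ?R \<mu>" "a\<^sub>2 * (x\<^sup>2 - vertex \<mu>) < 0" "0 < a\<^sub>2 * (y\<^sup>2 - vertex \<mu>)" for \<mu> x y
          using that stable[of x \<mu>] repel[of y \<mu>] f'_sign(3)[of \<mu> x] f'_sign(4)[of \<mu> y] by (auto simp: radius_mem)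
      qed (use fold in auto)
      moreover have "saddle_node_bifurcation V (\<lambda>\<mu>. {x. amplitude 2 a \<mu> x = 0})
          (\<lambda>\<mu> x y. asymptotically_stable UNIV (scalar_solution (amplitude 2 a \<mu>)) {x}
                 \<and> repelling UNIV (scalar_solution (amplitude 2 a \<mu>)) {y}) \<mu>0 (e * sqrt (vertex \<mu>0))"
        if e: "e \<in> {1, - 1}" for e
      proof (rule saddle_node_bifurcationI[OF \<mu>0 _ _ e])
        have deriv: "(amplitude 2 a \<mu> has_real_derivative f' \<mu> x) (at x)" for \<mu> x
          using amplitude_deriv by (simp add: amplitude_def[abs_def])
        show "x \<in> {x. amplitude 2 a \<mu> x = 0} \<longleftrightarrow> (x\<^sup>2 - vertex \<mu>)\<^sup>2 = gap \<mu>" if "\<mu> \<in> V" "0 < e * x" for \<mu> x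
          using that zero_iff by (auto simp: amplitude_def)
        show "asymptotically_stable UNIV (scalar_solution (amplitude 2 a \<mu>)) {x}
                 \<and> repelling UNIV (scalar_solution (amplitude 2 a \<mu>)) {y}"
          if "\<mu> \<in> V" "0 < e * x" "0 < e * y" "x \<in> {x. amplitude 2 a \<mu> x = 0}" "y \<in> {x. amplitude 2 a \<mu> x = 0}"
            "a\<^sub>2 * (x\<^sup>2 - vertex \<mu>) < 0" "0 < a\<^sub>2 * (y\<^sup>2 - vertex \<mu>)" for \<mu> x y
        proof
          have "x \<noteq> 0" "y \<noteq> 0" using that by auto
          then show "asymptotically_stable UNIV (scalar_solution (amplitude 2 a \<mu>)) {x}"
            using that f'_sign(3)[of \<mu> x]
            by (intro scalar_asymptotically_stable[OF deriv f'_cont]) (auto simp: amplitude_def)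
          show "repelling UNIV (scalar_solution (amplitude 2 a \<mu>)) {y}"
            using that f'_sign(4)[of \<mu> y] \<open>y \<noteq> 0\<close>
            by (intro scalar_repelling[OF deriv f'_cont]) (auto simp: amplitude_def)
        qed
      qed (use fold in auto)
      from this[of 1] this[of "- 1"] calculation
      show "double_saddle_node_bifurcation V (amplitude 2 a) ?R ?Q \<mu>0"
        unfolding double_saddle_node_bifurcation_def using \<open>0 < r0\<close>
        by (intro exI[of _ r0]) (simp add: r0_def)
    qed
    then show ?thesis using T_2SD_iff by blast
  qed

  \<comment> \<open>the branch with \<open>a\<^sub>2 * (r\<^sup>2 - vertex) < 0\<close> is the stable one\<close>
  define Ds where "Ds = (if a\<^sub>2 < 0 then outer_region a\<^sub>2 else inner_region a\<^sub>2)"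
  define Du where "Du = (if a\<^sub>2 < 0 then inner_region a\<^sub>2 else outer_region a\<^sub>2)"
  define rs where "rs = (if a\<^sub>2 < 0 then outer_radius a\<^sub>2 else inner_radius a\<^sub>2)"
  define ru where "ru = (if a\<^sub>2 < 0 then inner_radius a\<^sub>2 else outer_radius a\<^sub>2)"
  note branch_defs = Ds_def Du_def rs_def ru_def
  have fold: "fold_square a\<^sub>2 (?\<nu> \<mu>) = vertex \<mu>" "fold_gap a\<^sub>2 (?\<nu> \<mu>) = gap \<mu>" for \<mu>
    by (simp_all add: fold_square_def fold_gap_def vertex_def gap_def)
  have meet: "Ds \<inter> Du = inner_region a\<^sub>2"
    using inner_subset_outer[OF a2] by (auto simp: branch_defs)
  have region_zero: "outer_radius a\<^sub>2 (?\<nu> \<mu>) \<in> ?R \<mu>" "0 < (outer_radius a\<^sub>2 (?\<nu> \<mu>))\<^sup>2 - vertex \<mu>"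
    if "\<mu> \<in> V" "?\<nu> \<mu> \<in> outer_region a\<^sub>2" for \<mu>
    using outer_radius_zero[OF a2 that(2)] outer_region_gap[OF a2 that(2)] zero_iff[OF that(1)]
    by (simp_all add: radius_mem fold)
  have region_zero': "inner_radius a\<^sub>2 (?\<nu> \<mu>) \<in> ?R \<mu>" "(inner_radius a\<^sub>2 (?\<nu> \<mu>))\<^sup>2 - vertex \<mu> < 0"
    if "\<mu> \<in> V" "?\<nu> \<mu> \<in> inner_region a\<^sub>2" for \<mu>
    using inner_radius_zero[OF a2 that(2)] inner_region_gap[OF a2 that(2)] zero_iff[OF that(1)]
    by (simp_all add: radius_mem fold)
  have R_gap: "?R \<mu> = {r. 0 < r \<and> (r\<^sup>2 - fold_square a\<^sub>2 (?\<nu> \<mu>))\<^sup>2 = fold_gap a\<^sub>2 (?\<nu> \<mu>)}" if "\<mu> \<in> V" for \<mu>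
    by (rule set_eqI) (simp add: radius_mem fold zero_iff[OF that])
  have branch_stable: "?stable \<mu> (?T (rs (?\<nu> \<mu>)))" if "\<mu> \<in> V" "?\<nu> \<mu> \<in> Ds" for \<mu>
  proof -
    have "rs (?\<nu> \<mu>) \<in> ?R \<mu>" "a\<^sub>2 * ((rs (?\<nu> \<mu>))\<^sup>2 - vertex \<mu>) < 0"
    proof (atomize (full), cases "a\<^sub>2 < 0")
      case True
      then show "rs (?\<nu> \<mu>) \<in> ?R \<mu> \<and> a\<^sub>2 * ((rs (?\<nu> \<mu>))\<^sup>2 - vertex \<mu>) < 0"
        using region_zero[OF that(1)] that(2) by (simp add: Ds_def rs_def mult_less_0_iff)
    next
      case False
      then show "rs (?\<nu> \<mu>) \<in> ?R \<mu> \<and> a\<^sub>2 * ((rs (?\<nu> \<mu>))\<^sup>2 - vertex \<mu>) < 0"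
        using region_zero'[OF that(1)] that(2) a2 by (simp add: Ds_def rs_def mult_less_0_iff)
    qed
    moreover from this have "rs (?\<nu> \<mu>) \<noteq> 0" "radial_rate 2 a \<mu> (rs (?\<nu> \<mu>)) = 0"
      unfolding radius_mem by auto
    ultimately show ?thesis
      using stable f'_sign(3)[OF that(1)] by blast
  qed
  have branch_unstable: "?unstable \<mu> (?T (ru (?\<nu> \<mu>)))" if "\<mu> \<in> V" "?\<nu> \<mu> \<in> Du" for \<mu>
  proof -
    have "ru (?\<nu> \<mu>) \<in> ?R \<mu>" "0 < a\<^sub>2 * ((ru (?\<nu> \<mu>))\<^sup>2 - vertex \<mu>)"
    proof (atomize (full), cases "a\<^sub>2 < 0")
      case True
      then show "ru (?\<nu> \<mu>) \<in> ?R \<mu> \<and> 0 < a\<^sub>2 * ((ru (?\<nu> \<mu>))\<^sup>2 - vertex \<mu>)"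
        using region_zero'[OF that(1)] that(2) by (simp add: Du_def ru_def zero_less_mult_iff)
    next
      case False
      then show "ru (?\<nu> \<mu>) \<in> ?R \<mu> \<and> 0 < a\<^sub>2 * ((ru (?\<nu> \<mu>))\<^sup>2 - vertex \<mu>)"
        using region_zero[OF that(1)] that(2) a2 by (simp add: Du_def ru_def zero_less_mult_iff)
    qed
    moreover from this have "ru (?\<nu> \<mu>) \<noteq> 0" "radial_rate 2 a \<mu> (ru (?\<nu> \<mu>)) = 0"
      unfolding radius_mem by auto
    ultimately show ?thesis
      using unstable f'_sign(4)[OF that(1)] by blast
  qed
  have SupP: "p \<in> closure Ds \<and> rs p = 0" if "p \<in> T_SupP" for p
  proof (cases "a\<^sub>2 < 0")
    case True
    then have "fst p = 0" "fold_square a\<^sub>2 p < 0"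
      using that by (auto simp: T_SupP_def fold_square_def divide_less_0_iff zero_less_divide_iff)
    then show ?thesis
      using True outer_region_boundary[OF a2, of p] by (simp add: branch_defs)
  next
    case False
    then have "fst p = 0" "0 < fold_square a\<^sub>2 p"
      using that a2 by (auto simp: T_SupP_def fold_square_def divide_less_0_iff zero_less_divide_iff)
    then show ?thesis
      using False inner_region_boundary[OF a2, of p] by (simp add: branch_defs)
  qed
  have SubP: "p \<in> closure Du \<and> ru p = 0" if "p \<in> T_SubP" for p
  proof (cases "a\<^sub>2 < 0")
    case True
    then have "fst p = 0" "0 < fold_square a\<^sub>2 p"
      using that by (auto simp: T_SubP_def fold_square_def divide_less_0_iff zero_less_divide_iff)
    then show ?thesis
      using True inner_region_boundary[OF a2, of p] by (simp add: branch_defs)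
  next
    case False
    then have "fst p = 0" "fold_square a\<^sub>2 p < 0"
      using that a2 by (auto simp: T_SubP_def fold_square_def divide_less_0_iff zero_less_divide_iff)
    then show ?thesis
      using False outer_region_boundary[OF a2, of p] by (simp add: branch_defs)
  qed
  have branches: "path_connected Ds \<and> continuous_on (Ds \<union> T_SupP \<union> T_2SD a\<^sub>2) rs \<and>
          path_connected Du \<and> continuous_on (Du \<union> T_SubP \<union> T_2SD a\<^sub>2) ru \<and>
          T_SupP \<subseteq> closure Ds \<and> (\<forall>p\<in>T_SupP. rs p = 0) \<and>
          T_SubP \<subseteq> closure Du \<and> (\<forall>p\<in>T_SubP. ru p = 0) \<and>
          T_2SD a\<^sub>2 \<subseteq> closure (Ds \<inter> Du) \<and> (\<forall>p\<in>T_2SD a\<^sub>2. rs p = ru p) \<and>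
          (\<forall>p\<in>Ds \<inter> Du. rs p \<noteq> ru p) \<and>
          (\<forall>\<mu>\<in>V. ?\<nu> \<mu> \<notin> T_2SD a\<^sub>2 \<longrightarrow>
             ?R \<mu> = {r. ?\<nu> \<mu> \<in> Ds \<and> r = rs (?\<nu> \<mu>) \<or> ?\<nu> \<mu> \<in> Du \<and> r = ru (?\<nu> \<mu>)}) \<and>
          (\<forall>\<mu>\<in>V. ?\<nu> \<mu> \<in> T_2SD a\<^sub>2 \<longrightarrow> ?R \<mu> = {rs (?\<nu> \<mu>)}) \<and>
          (\<forall>\<mu>\<in>V. ?\<nu> \<mu> \<in> Ds \<longrightarrow> ?stable \<mu> (?T (rs (?\<nu> \<mu>)))) \<and>
          (\<forall>\<mu>\<in>V. ?\<nu> \<mu> \<in> Du \<longrightarrow> ?unstable \<mu> (?T (ru (?\<nu> \<mu>))))"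
  proof (intro conjI)
    show "path_connected Ds" "path_connected Du"
      using path_connected_outer_region[OF a2] path_connected_inner_region[OF a2] by (simp_all add: branch_defs)
    show "continuous_on (Ds \<union> T_SupP \<union> T_2SD a\<^sub>2) rs" "continuous_on (Du \<union> T_SubP \<union> T_2SD a\<^sub>2) ru"
      using continuous_on_radius[OF a2] by (simp_all add: rs_def ru_def)
    show "T_2SD a\<^sub>2 \<subseteq> closure (Ds \<inter> Du)"
      unfolding meet using fold_in_closure[OF a2] by blast
    show "\<forall>p\<in>T_2SD a\<^sub>2. rs p = ru p"
      using inner_outer_agree[OF a2] by (simp add: rs_def ru_def)
    show "\<forall>p\<in>Ds \<inter> Du. rs p \<noteq> ru p"
      unfolding meet using inner_outer_differ[OF a2] by (metis rs_def ru_def)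
    show "\<forall>\<mu>\<in>V. ?\<nu> \<mu> \<notin> T_2SD a\<^sub>2 \<longrightarrow>
             ?R \<mu> = {r. ?\<nu> \<mu> \<in> Ds \<and> r = rs (?\<nu> \<mu>) \<or> ?\<nu> \<mu> \<in> Du \<and> r = ru (?\<nu> \<mu>)}"
      using R_gap radius_iff[OF a2] by (auto simp: branch_defs)
    show "\<forall>\<mu>\<in>V. ?\<nu> \<mu> \<in> T_2SD a\<^sub>2 \<longrightarrow> ?R \<mu> = {rs (?\<nu> \<mu>)}"
      using R_gap radius_iff_fold[OF a2] inner_outer_agree[OF a2] by (auto simp: rs_def)
  qed (use SupP SubP branch_stable branch_unstable in auto)

  have regions: "?\<nu> \<mu> \<in> inner_region a\<^sub>2 \<longleftrightarrow>
      (a 1 \<mu>)\<^sup>2 > 4 * a\<^sub>2 * a 0 \<mu> \<and> a\<^sub>2 * a 0 \<mu> > 0 \<and> a\<^sub>2 * a 1 \<mu> < 0" for \<mu>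
  proof -
    have "gap \<mu> = ((a 1 \<mu>)\<^sup>2 - 4 * a\<^sub>2 * a 0 \<mu>) / (2 * a\<^sub>2)\<^sup>2"
      using a2 by (simp add: gap_def vertex_def field_simps power2_eq_square)
    then have "0 < gap \<mu> \<longleftrightarrow> (a 1 \<mu>)\<^sup>2 > 4 * a\<^sub>2 * a 0 \<mu>"
      using a2 by (simp add: zero_less_divide_iff)
    moreover have "0 < vertex \<mu> \<longleftrightarrow> a\<^sub>2 * a 1 \<mu> < 0"
      using a2 by (auto simp: vertex_def divide_less_0_iff mult_less_0_iff)
    moreover have "0 < a 0 \<mu> / a\<^sub>2 \<longleftrightarrow> a\<^sub>2 * a 0 \<mu> > 0"
      by (auto simp: zero_less_divide_iff zero_less_mult_iff)
    ultimately show ?thesis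
      by (auto simp: inner_region_def fold)
  qed
  have two_radii: "?\<nu> \<mu> \<in> inner_region a\<^sub>2 \<and> r1 = inner_radius a\<^sub>2 (?\<nu> \<mu>) \<and> r2 = outer_radius a\<^sub>2 (?\<nu> \<mu>)"
    if "\<mu> \<in> V" "r1 \<in> ?R \<mu>" "r2 \<in> ?R \<mu>" "r1 < r2" for \<mu> r1 r2
  proof -
    have fold': "?\<nu> \<mu> \<notin> T_2SD a\<^sub>2"
      using that R_gap[OF that(1)] radius_iff_fold[OF a2, of "?\<nu> \<mu>"] by force
    have "inner_radius a\<^sub>2 p \<le> outer_radius a\<^sub>2 p" if "p \<in> inner_region a\<^sub>2" for p
      using inner_region_gap(1)[OF a2 that] by (simp add: inner_radius_def outer_radius_def)
    then show ?thesis
      using that R_gap[OF that(1)] radius_iff[OF a2 fold'] by fastforce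
  qed
  have region_two: "(\<exists>r1 r2. r1 < r2 \<and> ?R \<mu> = {r1, r2}) \<longleftrightarrow> ?\<nu> \<mu> \<in> inner_region a\<^sub>2" if "\<mu> \<in> V" for \<mu>
  proof
    assume "\<exists>r1 r2. r1 < r2 \<and> ?R \<mu> = {r1, r2}"
    then show "?\<nu> \<mu> \<in> inner_region a\<^sub>2"
      using two_radii[OF that] by blast
  next
    assume in_reg: "?\<nu> \<mu> \<in> inner_region a\<^sub>2"
    then have out_reg: "?\<nu> \<mu> \<in> outer_region a\<^sub>2"
      using inner_subset_outer[OF a2] by blast
    have "?\<nu> \<mu> \<notin> T_2SD a\<^sub>2"
      using inner_region_gap(1)[OF a2 in_reg] by (auto simp: T_2SD_eq[OF a2])
    then have "?R \<mu> = {inner_radius a\<^sub>2 (?\<nu> \<mu>), outer_radius a\<^sub>2 (?\<nu> \<mu>)}"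
      using R_gap[OF that] radius_iff[OF a2] in_reg out_reg by auto
    moreover have "inner_radius a\<^sub>2 (?\<nu> \<mu>) < outer_radius a\<^sub>2 (?\<nu> \<mu>)"
      using inner_region_gap(1)[OF a2 in_reg] by (simp add: inner_radius_def outer_radius_def)
    ultimately show "\<exists>r1 r2. r1 < r2 \<and> ?R \<mu> = {r1, r2}" by blast
  qed
  \<comment> \<open>two radii require \<open>a\<^sub>2 * a 0 \<mu> > 0\<close>, so \<open>a 0 \<mu>\<close> has the sign of the slope at the outer one\<close>
  have signs: "f' \<mu> r1 * a 0 \<mu> < 0 \<and> 0 < f' \<mu> r2 * a 0 \<mu>"
    if "\<mu> \<in> V" "r1 \<in> ?R \<mu>" "r2 \<in> ?R \<mu>" "r1 < r2" for \<mu> r1 r2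
  proof -
    have in_reg: "?\<nu> \<mu> \<in> inner_region a\<^sub>2" and r: "r1 = inner_radius a\<^sub>2 (?\<nu> \<mu>)" "r2 = outer_radius a\<^sub>2 (?\<nu> \<mu>)"
      using two_radii[OF that] by auto
    have "r1\<^sup>2 - vertex \<mu> < 0" "0 < r2\<^sup>2 - vertex \<mu>"
      unfolding r using region_zero'(2)[OF that(1) in_reg] region_zero(2)[OF that(1)] in_reg
        inner_subset_outer[OF a2] by auto
    moreover have "0 < a\<^sub>2 * a 0 \<mu>"
      using in_reg regions by blast
    ultimately show ?thesis
      using f'_sign(3,4)[OF that(1), of r1] f'_sign(3,4)[OF that(1), of r2] that
      by (auto simp: radius_mem mult_less_0_iff zero_less_mult_iff)
  qed
  have nested: "?T r1 \<subseteq> inside_in ?X (?T r2)" if "r1 \<in> ?R \<mu>" "r1 < r2" for \<mu> r1 r2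
    using hypertorus_inside that by (simp add: radius_mem)
  have f'0: "f' \<mu> 0 = a 0 \<mu>" for \<mu>
    by (simp add: f'_def)
  have outer_unstable: "?unstable \<mu> {0} \<and>
      (\<forall>r1\<in>?R \<mu>. \<forall>r2\<in>?R \<mu>. r1 < r2 \<longrightarrow> ?stable \<mu> (?T r1) \<and> ?unstable \<mu> (?T r2))"
    if "\<mu> \<in> V" "a 0 \<mu> > 0" for \<mu>
    using leaf_flow.origin_unstable[OF flow, of \<mu>] f'0 that signs[OF that(1)] stable unstable
    by (auto simp: mult_less_0_iff zero_less_mult_iff)
  have inner_repelling: "?stable \<mu> {0} \<and>
      (\<forall>r1\<in>?R \<mu>. \<forall>r2\<in>?R \<mu>. r1 < r2 \<longrightarrow> ?repel \<mu> (?T r1) \<and> ?stable \<mu> (?T r2))"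
    if "\<mu> \<in> V" "a 0 \<mu> < 0" for \<mu>
    using leaf_flow.origin_stable[OF flow, of \<mu>] f'0 that signs[OF that(1)] stable repel
    by (auto simp: mult_less_0_iff zero_less_mult_iff)
  show ?thesis
    unfolding Let_def
  proof (intro conjI)
    show "\<forall>\<mu>\<in>V. \<forall>r\<in>?R \<mu>. flow_invariant (?sol \<mu>) (?T r)"
      using invariant by blast
    show "\<forall>\<mu>\<in>V. (\<exists>r1 r2. r1 < r2 \<and> ?R \<mu> = {r1, r2}) \<longleftrightarrow>
          (a 1 \<mu>)\<^sup>2 > 4 * a\<^sub>2 * a 0 \<mu> \<and> a\<^sub>2 * a 0 \<mu> > 0 \<and> a\<^sub>2 * a 1 \<mu> < 0"
      using region_two regions by blast
    show "\<forall>\<mu>\<in>V. \<forall>r1\<in>?R \<mu>. \<forall>r2\<in>?R \<mu>. r1 < r2 \<longrightarrow> ?T r1 \<subseteq> inside_in ?X (?T r2)"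
      using nested by blast
    show "\<forall>\<mu>\<in>V. (a 1 \<mu>)\<^sup>2 > 4 * a\<^sub>2 * a 0 \<mu> \<and> a 0 \<mu> > 0 \<longrightarrow> ?unstable \<mu> {0} \<and>
          (\<forall>r1\<in>?R \<mu>. \<forall>r2\<in>?R \<mu>. r1 < r2 \<longrightarrow> ?stable \<mu> (?T r1) \<and> ?unstable \<mu> (?T r2))"
      using outer_unstable by blast
    show "\<forall>\<mu>\<in>V. (a 1 \<mu>)\<^sup>2 > 4 * a\<^sub>2 * a 0 \<mu> \<and> a 0 \<mu> < 0 \<longrightarrow> ?stable \<mu> {0} \<and>
          (\<forall>r1\<in>?R \<mu>. \<forall>r2\<in>?R \<mu>. r1 < r2 \<longrightarrow> ?repel \<mu> (?T r1) \<and> ?stable \<mu> (?T r2))"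
      using inner_repelling by blast
  qed (rule supercritical subcritical saddle_node amplitude_five_determined[OF a2]
      | ((rule exI)+, rule branches))+
qed

end
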